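(* Let $H$ be a self-adjoint operator with domain $\mathcal{D}_H$ on a Hilbert space $\mathcal{H}$ and let $P$ be a spectral projector of $H$. Let $G$ be a linear operator with domain $\mathcal{D}_G$ and adjoint $G^*$ defined on $\mathcal{D}_{G^*}$ such that $G(\mathcal{D}_H)\subseteq\mathcal{D}_H\subseteq\mathcal{D}_G$ and $G^*(\mathcal{D}_H)\subseteq\mathcal{D}_H\subseteq\mathcal{D}_{G^*}$. Put $A=(1-P)GP$ and $B=PG(1-P)$. Then $$\mathrm{tr}\big(H^2(G^*[H,G]+G[H,G^*])P\big)-\mathrm{tr}\big(H([H,G^*][H,G]+[H,G][H,G^*])P\big)$$ $$=\mathrm{tr}\big(HA^*H^2A-HAH^2A^*\big)+\mathrm{tr}\big(HBH^2B^*-HB^*H^2B\big).$$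
   Context: $[X,Y]:=XY-YX$ denotes the commutator and $\mathrm{tr}$ the trace. The identity is understood for the case in which the traces involved are well defined (so that the cyclic property of the trace is available). *)

theory Defs
  imports "HOL-Analysis.Analysis"
begin

section \<open>Complex Hilbert spaces\<close>

text \<open>
  The topology and the norm come from the underlying real Hilbert space, whose inner product is
  the real part of the complex one. The complex inner product is conjugate linear in its first
  argument. No separability is assumed.
\<close>

class complex_hilbert = real_inner + complete_space +
  fixes scaleC :: "complex \<Rightarrow> 'a \<Rightarrow> 'a" (infixr "*\<^sub>C" 75)
    and cinner :: "'a \<Rightarrow> 'a \<Rightarrow> complex"
  assumes scaleC_of_real: "complex_of_real r *\<^sub>C x = r *\<^sub>R x"
    and scaleC_scaleC: "a *\<^sub>C (b *\<^sub>C x) = (a * b) *\<^sub>C x"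
    and scaleC_add_left: "(a + b) *\<^sub>C x = a *\<^sub>C x + b *\<^sub>C x"
    and scaleC_add_right: "a *\<^sub>C (x + y) = a *\<^sub>C x + a *\<^sub>C y"
    and cinner_commute: "cinner x y = cnj (cinner y x)"
    and cinner_add_right: "cinner x (y + z) = cinner x y + cinner x z"
    and cinner_scaleC_right: "cinner x (a *\<^sub>C y) = a * cinner x y"
    and Re_cinner: "Re (cinner x y) = x \<bullet> y"

instantiation complex :: complex_hilbert
begin

definition scaleC_complex :: "complex \<Rightarrow> complex \<Rightarrow> complex"
  where "scaleC_complex a x = a * x"

definition cinner_complex :: "complex \<Rightarrow> complex \<Rightarrow> complex"
  where "cinner_complex x y = cnj x * y"

instance
  by standard (simp_all add: scaleC_complex_def cinner_complex_def algebra_simps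
      scaleR_conv_of_real inner_complex_def)

end

definition dense_set :: "'a::topological_space set \<Rightarrow> bool"
  where "dense_set D \<longleftrightarrow> closure D = UNIV"

definition bounded_clinear :: "('a::complex_hilbert \<Rightarrow> 'a) \<Rightarrow> bool"
  where "bounded_clinear f \<longleftrightarrow> bounded_linear f \<and> (\<forall>c x. f (c *\<^sub>C x) = c *\<^sub>C f x)"

definition orthonormal_basis :: "'a::complex_hilbert set \<Rightarrow> bool"
  where "orthonormal_basis B \<longleftrightarrow>
    (\<forall>e\<in>B. cinner e e = 1) \<and>
    (\<forall>e\<in>B. \<forall>f\<in>B. e \<noteq> f \<longrightarrow> cinner e f = 0) \<and>
    (\<forall>x. (\<forall>e\<in>B. cinner e x = 0) \<longrightarrow> x = 0)"


section \<open>Operators with a domain\<close>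

text \<open>
  An operator on a Hilbert space is a partial function, \<open>dom T\<close> being its domain. The
  library's composition \<open>S \<circ>\<^sub>m T\<close> is then the product \<open>ST\<close> on its natural domain
  \<open>{x \<in> dom T. T x \<in> dom S}\<close>, sums and differences live on the intersection of the domains, and
  \<open>Some\<close> is the identity operator.
\<close>

type_synonym 'a lop = "'a \<rightharpoonup> 'a"

definition op_plus :: "'a::complex_hilbert lop \<Rightarrow> 'a lop \<Rightarrow> 'a lop"  (infixl "+\<^sub>o" 52)
  where "S +\<^sub>o T = (\<lambda>x. if x \<in> dom S \<inter> dom T then Some (the (S x) + the (T x)) else None)"

definition op_minus :: "'a::complex_hilbert lop \<Rightarrow> 'a lop \<Rightarrow> 'a lop"  (infixl "-\<^sub>o" 52)
  where "S -\<^sub>o T = (\<lambda>x. if x \<in> dom S \<inter> dom T then Some (the (S x) - the (T x)) else None)"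

definition commutator :: "'a::complex_hilbert lop \<Rightarrow> 'a lop \<Rightarrow> 'a lop"
  where "commutator S T = (S \<circ>\<^sub>m T) -\<^sub>o (T \<circ>\<^sub>m S)"

definition linear_op :: "'a::complex_hilbert lop \<Rightarrow> bool"
  where "linear_op T \<longleftrightarrow> T 0 = Some 0 \<and>
    (\<forall>a b x y u v. T x = Some u \<longrightarrow> T y = Some v \<longrightarrow>
      T (a *\<^sub>C x + b *\<^sub>C y) = Some (a *\<^sub>C u + b *\<^sub>C v))"

text \<open>
  For densely defined \<open>T\<close> there is at most one \<open>z\<close> below; for other \<open>T\<close> uniqueness always
  fails, so that \<open>adj T\<close> is the nowhere defined operator.
\<close>

definition adj :: "'a::complex_hilbert lop \<Rightarrow> 'a lop"
  where "adj T = (\<lambda>x.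
    if \<exists>!z. \<forall>y\<in>dom T. cinner x (the (T y)) = cinner z y
    then Some (THE z. \<forall>y\<in>dom T. cinner x (the (T y)) = cinner z y)
    else None)"

definition self_adjoint :: "'a::complex_hilbert lop \<Rightarrow> bool"
  where "self_adjoint T \<longleftrightarrow> linear_op T \<and> dense_set (dom T) \<and> adj T = T"


section \<open>Spectral projectors\<close>

definition orthogonal_projector :: "('a::complex_hilbert \<Rightarrow> 'a) \<Rightarrow> bool"
  where "orthogonal_projector Q \<longleftrightarrow> bounded_clinear Q \<and> (\<forall>x. Q (Q x) = Q x) \<and>
    (\<forall>x y. cinner (Q x) y = cinner x (Q y))"

definition projection_valued_measure :: "(real set \<Rightarrow> 'a::complex_hilbert \<Rightarrow> 'a) \<Rightarrow> bool"
  where "projection_valued_measure E \<longleftrightarrow>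
    (\<forall>S\<in>sets borel. orthogonal_projector (E S)) \<and>
    (\<forall>x. E UNIV x = x) \<and>
    (\<forall>S\<in>sets borel. \<forall>T\<in>sets borel. \<forall>x. E (S \<inter> T) x = E S (E T x)) \<and>
    (\<forall>F. range F \<subseteq> sets borel \<longrightarrow> disjoint_family F \<longrightarrow>
      (\<forall>x. (\<lambda>n::nat. E (F n) x) sums E (\<Union>n. F n) x))"

text \<open>The measure \<open>S \<mapsto> \<langle>x, E(S) x\<rangle> = \<parallel>E(S) x\<parallel>\<^sup>2\<close>.\<close>

definition scalar_measure ::
    "(real set \<Rightarrow> 'a::complex_hilbert \<Rightarrow> 'a) \<Rightarrow> 'a \<Rightarrow> real measure"
  where "scalar_measure E x = measure_of UNIV (sets borel) (\<lambda>S. ennreal ((norm (E S x))\<^sup>2))"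

text \<open>
  \<open>H = \<integral> t dE(t)\<close>: the domain consists of the \<open>x\<close> with \<open>\<integral> t\<^sup>2 d\<langle>x, E(t) x\<rangle> < \<infinity>\<close>, and
  \<open>\<langle>x, H x\<rangle> = \<integral> t d\<langle>x, E(t) x\<rangle>\<close> there, which determines \<open>H\<close> by polarization. By the spectral
  theorem every self-adjoint \<open>H\<close> has exactly one such \<open>E\<close> (on Borel sets).
\<close>

definition spectral_measure_of ::
    "'a::complex_hilbert lop \<Rightarrow> (real set \<Rightarrow> 'a \<Rightarrow> 'a) \<Rightarrow> bool"
  where "spectral_measure_of H E \<longleftrightarrow> projection_valued_measure E \<and>
    dom H = {x. (\<integral>\<^sup>+ t. ennreal (t\<^sup>2) \<partial>scalar_measure E x) < \<infinity>} \<and>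
    (\<forall>x\<in>dom H. cinner x (the (H x)) = complex_of_real (\<integral> t. t \<partial>scalar_measure E x))"

definition spectral_projector :: "'a::complex_hilbert lop \<Rightarrow> 'a lop \<Rightarrow> bool"
  where "spectral_projector H P \<longleftrightarrow>
    (\<exists>E. spectral_measure_of H E \<and> (\<exists>S\<in>sets borel. P = Some \<circ> E S))"


section \<open>Trace\<close>

definition hilbert_schmidt :: "('a::complex_hilbert \<Rightarrow> 'a) \<Rightarrow> bool"
  where "hilbert_schmidt T \<longleftrightarrow> bounded_clinear T \<and>
    (\<exists>B. orthonormal_basis B \<and> (\<lambda>e. (norm (T e))\<^sup>2) summable_on B)"

definition trace_class :: "('a::complex_hilbert \<Rightarrow> 'a) \<Rightarrow> bool"
  where "trace_class T \<longleftrightarrow> (\<exists>R S. hilbert_schmidt R \<and> hilbert_schmidt S \<and> T = R \<circ> S)"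

text \<open>
  For trace class operators the value does not depend on the orthonormal basis.
\<close>

definition trace_bounded :: "('a::complex_hilbert \<Rightarrow> 'a) \<Rightarrow> complex"
  where "trace_bounded T = (\<Sum>\<^sub>\<infinity>e\<in>(SOME B. orthonormal_basis B). cinner e (T e))"

text \<open>
  A product of unbounded operators that is bounded usually is so only on a dense domain. Its trace
  is that of its continuous extension, which is unique for a dense domain.
\<close>

definition bounded_extension :: "'a::complex_hilbert lop \<Rightarrow> 'a \<Rightarrow> 'a"
  where "bounded_extension T = (THE S. bounded_clinear S \<and> T \<subseteq>\<^sub>m (Some \<circ> S))"

definition tr :: "'a::complex_hilbert lop \<Rightarrow> complex"
  where "tr T = trace_bounded (bounded_extension T)"

text \<open>
  Well-definedness of the traces of a collection of operators: they have a common dense domain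
  (so that linear combinations of them are densely defined, too) and every one of them extends to
  a trace class operator.

  In the trace identity this is required not only of the operators whose traces are written down
  but also of the products \<open>HG\<^sup>*H\<^sup>2GP\<close>, \<open>HG\<^sup>*HGHP\<close>, \<open>HGH\<^sup>2G\<^sup>*P\<close>, \<open>HGHG\<^sup>*HP\<close> that remain on
  the left-hand side once the commutators are multiplied out, and of the single products on the
  right-hand side: these are the products to which the cyclic property of the trace is applied.
  Without them the identity fails even for bounded \<open>H\<close>, \<open>G\<close> and \<open>P = 1\<close>: if \<open>H\<close> and \<open>G\<close> are
  self-adjoint with trace class commutator, the left-hand side is \<open>2 tr (HGH[H, G])\<close>, which by the
  Helton-Howe formula need not vanish, whereas \<open>A = B = 0\<close>.
\<close>

definition traces_well_defined :: "'a::complex_hilbert lop set \<Rightarrow> bool"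
  where "traces_well_defined \<T> \<longleftrightarrow> dense_set (\<Inter>T\<in>\<T>. dom T) \<and>
    (\<forall>T\<in>\<T>. \<exists>S. trace_class S \<and> T \<subseteq>\<^sub>m (Some \<circ> S))"

end

theory Submission
  imports Defs
begin

text \<open>
  Write \<open>K = G\<^sup>*\<close> and \<open>Q = 1 - P\<close>. On the common domain of the products the commutators may be
  multiplied out, and the left-hand side becomes
  \<open>tr(HKH\<^sup>2GP) - tr(HGHKHP) + tr(HGH\<^sup>2KP) - tr(HKHGHP)\<close>. The last two terms arise from the first two
  by exchanging \<open>G\<close> and \<open>K\<close>, which replaces \<open>A\<close> by \<open>B\<^sup>*\<close> and \<open>B\<close> by \<open>A\<^sup>*\<close>. So it suffices to show
  \<open>tr(HKH\<^sup>2GP) - tr(HGHKHP) = tr(HA\<^sup>*H\<^sup>2A) - tr(HB\<^sup>*H\<^sup>2B)\<close>, the lemma \<open>half_trace_identity\<close>.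
  Formally this holds because \<open>P\<close> commutes with \<open>H\<close>: inserting \<open>1 = P + Q\<close> between the factors splits
  off \<open>HA\<^sup>*H\<^sup>2A\<close> from the first product and \<open>HBHB\<^sup>*H\<close>, with the trace of \<open>HB\<^sup>*H\<^sup>2B\<close>, from the
  second, and the remainders \<open>H (PKP) H\<^sup>2 (PGP)\<close> and \<open>H (PGP) H (PKP) H\<close> have equal traces by
  cyclicity.

  Two obstacles stand between this computation and a proof. The first one is unboundedness. The common
  domain is dense, but a priori it is not a core of anything. It is decisive that for \<open>x\<close> in it
  \<open>\<parallel>HGPx\<parallel>\<^sup>2 = \<langle>Px, w\<rangle>\<close> with \<open>w = KH\<^sup>2GPx\<close>, where \<open>Hw\<close> is bounded by \<open>x\<close>. The part of
  \<open>w\<close> belonging to the spectrum of \<open>H\<close> outside \<open>[-1, 1]\<close> is at most \<open>\<parallel>Hw\<parallel>\<close>, and inside one uses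
  that \<open>HG\<close> is bounded on spectral subspaces of bounded intervals, by the uniform boundedness principle
  (\<open>cutoff_bound\<close>). Therefore \<open>HGP\<close>, being closable, extends to a bounded operator \<open>M\<close>, and likewise
  \<open>HB\<close> to a bounded operator \<open>N\<close>. As \<open>H\<close> is closed, \<open>HM\<^sup>*M\<close>, \<open>HM\<^sup>*QM\<close> and \<open>HN\<^sup>*N\<close> are defined
  everywhere, and they are the trace class extensions of \<open>P HKH\<^sup>2GP\<close>, \<open>HA\<^sup>*H\<^sup>2A\<close> and \<open>HB\<^sup>*H\<^sup>2B\<close>.

  The second obstacle is cyclicity. The operator \<open>P HGHKHP\<close> equals \<open>x\<^sub>1Hx\<^sub>1\<^sup>* + x\<^sub>2Hx\<^sub>2\<^sup>*\<close> with
  \<open>x\<^sub>1 = PM\<close> and \<open>x\<^sub>2 = N\<close>. Its trace is given, but nothing is said about the two summands; it is the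
  products \<open>Hx\<^sub>i\<^sup>*x\<^sub>i\<close> in the opposite order that are known to be trace class. Here the symmetry of
  \<open>H\<close> helps: it allows \<open>xHx\<^sup>*\<close> to be recovered from the trace class operator \<open>\<alpha> = Hx\<^sup>*x\<close> by a
  series that converges in trace norm and whose trace telescopes to \<open>tr \<alpha>\<close> (locale
  \<open>symmetrizable\<close>). This yields \<open>tr(x\<^sub>iHx\<^sub>i\<^sup>*) = tr(Hx\<^sub>i\<^sup>*x\<^sub>i)\<close> for each \<open>i\<close>.
\<close>

section \<open>The complex inner product\<close>

lemma cinner_add_left: "cinner (x + y) z = cinner x z + cinner y z"
  by (metis cinner_commute cinner_add_right complex_cnj_add)

lemma cinner_scaleC_left: "cinner (a *\<^sub>C x) y = cnj a * cinner x y"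
  by (metis cinner_commute cinner_scaleC_right complex_cnj_mult)

lemma scaleC_minus_one: "(-1) *\<^sub>C x = - (x::'a::complex_hilbert)"
  using scaleC_of_real[of "-1" x] by simp

lemma scaleC_one: "1 *\<^sub>C x = (x::'a::complex_hilbert)"
  using scaleC_of_real[of "1" x] by simp

lemma scaleC_zero_right: "a *\<^sub>C 0 = (0::'a::complex_hilbert)"
  using scaleC_add_right[of a 0 0] by simp

lemma scaleC_minus_right: "a *\<^sub>C (- x) = - (a *\<^sub>C (x::'a::complex_hilbert))"
  using scaleC_add_right[of a x "-x"] by (simp add: scaleC_zero_right eq_neg_iff_add_eq_0 add.commute)

lemma scaleC_diff_right: "a *\<^sub>C (x - y) = a *\<^sub>C x - a *\<^sub>C (y::'a::complex_hilbert)"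
  using scaleC_add_right[of a x "-y"] by (simp add: scaleC_minus_right)

lemma cinner_minus_right: "cinner x (- y) = - cinner x y"
  using cinner_scaleC_right[of x "-1" y] by (simp add: scaleC_minus_one)

lemma cinner_minus_left: "cinner (- x) y = - cinner x y"
  using cinner_scaleC_left[of "-1" x y] by (simp add: scaleC_minus_one)

lemma cinner_diff_right: "cinner x (y - z) = cinner x y - cinner x z"
  using cinner_add_right[of x y "-z"] by (simp add: cinner_minus_right)

lemma cinner_diff_left: "cinner (x - y) z = cinner x z - cinner y z"
  using cinner_add_left[of x "-y" z] by (simp add: cinner_minus_left)

lemma cinner_zero_right [simp]: "cinner x 0 = 0"
  using cinner_diff_right[of x 0 0] by simp

lemma cinner_zero_left [simp]: "cinner 0 x = 0"
  using cinner_diff_left[of 0 0 x] by simp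

lemma cinner_scaleR_right: "cinner x (r *\<^sub>R y) = complex_of_real r * cinner x y"
  by (simp add: scaleC_of_real[symmetric] cinner_scaleC_right)

lemma cinner_scaleR_left: "cinner (r *\<^sub>R x) y = complex_of_real r * cinner x y"
  by (simp add: scaleC_of_real[symmetric] cinner_scaleC_left)

lemmas cinner_simps = cinner_add_left cinner_add_right cinner_diff_left cinner_diff_right
  cinner_minus_left cinner_minus_right

lemma cinner_self: "cinner x x = complex_of_real ((norm x)\<^sup>2)"
proof -
  have "Im (cinner x x) = 0"
    using cinner_commute[of x x] by (metis complex_cnj_cancel_iff complex_cnj cnj.simps(2) equal_neg_zero)
  then show ?thesis
    by (simp add: complex_eq_iff Re_cinner power2_norm_eq_inner)
qed

lemma cinner_self_eq_0: "cinner x x = 0 \<longleftrightarrow> x = 0"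
  by (simp add: cinner_self)

lemma cinner_eq_0_commute: "cinner x y = 0 \<longleftrightarrow> cinner y x = 0"
  by (metis cinner_commute complex_cnj_zero_iff)

lemma cmod_cinner_commute: "cmod (cinner x y) = cmod (cinner y x)"
  by (metis cinner_commute complex_mod_cnj)

lemma norm_scaleC: "norm (a *\<^sub>C x) = cmod a * norm x"
proof -
  have "complex_of_real ((norm (a *\<^sub>C x))\<^sup>2) = cnj a * (a * cinner x x)"
    by (simp only: cinner_self[symmetric] cinner_scaleC_left cinner_scaleC_right mult_ac)
  also have "\<dots> = (a * cnj a) * complex_of_real ((norm x)\<^sup>2)"
    by (simp add: cinner_self mult_ac)
  also have "\<dots> = complex_of_real ((cmod a * norm x)\<^sup>2)"
    by (simp add: complex_norm_square[symmetric] power_mult_distrib)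
  finally have "(norm (a *\<^sub>C x))\<^sup>2 = (cmod a * norm x)\<^sup>2"
    using of_real_eq_iff by blast
  then show ?thesis
    by (simp add: power2_eq_iff_nonneg)
qed

lemma Re_cinner_le: "Re (cinner x y) \<le> norm x * norm y"
  by (simp add: Re_cinner norm_cauchy_schwarz)

lemma cmod_cinner_le: "cmod (cinner x y) \<le> norm x * norm y"
proof (cases "cinner x y = 0")
  case False
  define c where "c = cnj (sgn (cinner x y))"
  have "cmod (cinner x y) = Re (cinner x (c *\<^sub>C y))"
  proof -
    have "cnj (sgn z) * z = complex_of_real (cmod z)" if "z \<noteq> 0" for z
      using that by (simp add: sgn_eq complex_cnj_divide mult.commute[of "cnj z"]
          complex_norm_square[symmetric] power2_eq_square)
    then show ?thesis
      using False by (simp add: c_def cinner_scaleC_right)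
  qed
  also have "\<dots> \<le> norm x * norm (c *\<^sub>C y)"
    by (rule Re_cinner_le)
  also have "\<dots> = norm x * norm y"
    using False by (simp add: norm_scaleC c_def norm_sgn)
  finally show ?thesis .
qed auto

lemma bounded_bilinear_cinner:
  "bounded_bilinear (cinner :: 'a::complex_hilbert \<Rightarrow> 'a \<Rightarrow> complex)"
proof
  show "\<exists>K. \<forall>a b. cmod (cinner a (b::'a)) \<le> norm a * norm b * K"
    by (rule exI[of _ 1]) (simp add: cmod_cinner_le)
qed (simp_all add: cinner_simps cinner_scaleR_left cinner_scaleR_right scaleR_conv_of_real)

lemmas tendsto_cinner = bounded_bilinear.tendsto[OF bounded_bilinear_cinner]
lemmas continuous_on_cinner = bounded_bilinear.continuous_on[OF bounded_bilinear_cinner]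

lemma cinner_ext: "(\<And>y. cinner y x = cinner y x') \<Longrightarrow> x = x'"
  using cinner_self_eq_0[of "x - x'"] by (simp add: cinner_simps)

lemma dense_set_eqI:
  fixes f g :: "'a::topological_space \<Rightarrow> 'b::t2_space"
  assumes "dense_set D" "continuous_on UNIV f" "continuous_on UNIV g" "\<And>x. x \<in> D \<Longrightarrow> f x = g x"
  shows "f x = g x"
proof -
  have "closed {x. f x = g x}"
    using assms(2,3) by (rule closed_Collect_eq)
  with assms(4) have "closure D \<subseteq> {x. f x = g x}"
    by (intro closure_minimal) auto
  with assms(1) show ?thesis by (auto simp: dense_set_def)
qed

lemma dense_set_mono: "dense_set D \<Longrightarrow> D \<subseteq> E \<Longrightarrow> dense_set E"
  unfolding dense_set_def using closure_mono by blast

lemma dense_cinner_ext: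
  assumes "dense_set D" "\<And>y. y \<in> D \<Longrightarrow> cinner y x = cinner y x'"
  shows "x = x'"
proof (rule cinner_ext)
  show "cinner y x = cinner y x'" for y
    by (rule dense_set_eqI[OF assms(1), of "\<lambda>y. cinner y x" "\<lambda>y. cinner y x'"])
      (auto intro!: continuous_on_cinner continuous_intros assms(2))
qed

lemma norm_le_if_cinner_le:
  assumes D: "dense_set D" and le: "\<And>y. y \<in> D \<Longrightarrow> cmod (cinner y x) \<le> norm y * C" and "0 \<le> C"
  shows "norm x \<le> C"
proof -
  have "closed {y. cmod (cinner y x) \<le> norm y * C}"
    by (intro closed_Collect_le continuous_intros continuous_on_cinner)
  with le have "closure D \<subseteq> {y. cmod (cinner y x) \<le> norm y * C}"
    by (intro closure_minimal) auto
  with D have "cmod (cinner x x) \<le> norm x * C"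
    by (auto simp: dense_set_def)
  then have "norm x * norm x \<le> norm x * C"
    by (simp add: cinner_self norm_mult norm_power power2_eq_square del: of_real_power)
  then show ?thesis
    using \<open>0 \<le> C\<close> by (cases "x = 0") (auto dest: mult_left_le_imp_le)
qed

section \<open>Bounded operators and their adjoints\<close>

lemma bounded_clinearD:
  assumes "bounded_clinear f"
  shows "f (x + y) = f x + f y" "f (x - y) = f x - f y" "f 0 = 0" "f (c *\<^sub>C x) = c *\<^sub>C f x"
    "f (r *\<^sub>R x) = r *\<^sub>R f x" "bounded_linear f"
  using assms unfolding bounded_clinear_def
  by (auto simp: linear_simps bounded_linear.linear linear_diff linear_0)

lemma bounded_clinear_norm: "bounded_clinear f \<Longrightarrow> norm (f x) \<le> onorm f * norm x"
  by (simp add: bounded_clinearD(6) onorm)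

lemma bounded_clinear_continuous_on: "bounded_clinear f \<Longrightarrow> continuous_on S f"
  by (simp add: bounded_clinearD(6) linear_continuous_on)

lemma bounded_clinear_tendsto: "bounded_clinear f \<Longrightarrow> (g \<longlongrightarrow> l) F \<Longrightarrow> ((\<lambda>x. f (g x)) \<longlongrightarrow> f l) F"
  by (simp add: bounded_clinearD(6) bounded_linear.tendsto)

lemma bounded_clinearI:
  assumes "\<And>x y. f (x + y) = f x + f y" "\<And>c x. f (c *\<^sub>C x) = c *\<^sub>C f x"
    and "\<And>x. norm (f x) \<le> norm x * K"
  shows "bounded_clinear f"
  unfolding bounded_clinear_def
proof (intro conjI allI bounded_linear_intro[where K = K])
  show "f (r *\<^sub>R x) = r *\<^sub>R f x" for r x
    using assms(2)[of "complex_of_real r" x] by (simp add: scaleC_of_real)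
qed (use assms in auto)

lemma bounded_clinear_id: "bounded_clinear (\<lambda>x. x)"
  by (auto simp: bounded_clinear_def)

lemma bounded_clinear_comp: "bounded_clinear f \<Longrightarrow> bounded_clinear g \<Longrightarrow> bounded_clinear (\<lambda>x. f (g x))"
  by (auto simp: bounded_clinear_def bounded_linear_compose)

lemma bounded_clinear_diff: "bounded_clinear f \<Longrightarrow> bounded_clinear g \<Longrightarrow> bounded_clinear (\<lambda>x. f x - g x)"
  by (auto simp: bounded_clinear_def bounded_linear_sub scaleC_diff_right)

lemma bounded_clinear_scaleR: "bounded_clinear f \<Longrightarrow> bounded_clinear (\<lambda>x. r *\<^sub>R f x)"
  unfolding bounded_clinear_def
  by (auto simp: bounded_linear_compose[OF bounded_linear_scaleR_right])
    (simp add: scaleC_of_real[symmetric] scaleC_scaleC mult.commute)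

text \<open>
  The Riesz representation: the vector is the minimizer of \<open>\<parallel>y\<parallel>\<^sup>2 - 2 f(y)\<close>, which exists because
  by the parallelogram law a minimizing sequence is a Cauchy sequence.
\<close>

lemma riesz_real:
  fixes f :: "'a::complex_hilbert \<Rightarrow> real"
  assumes "bounded_linear f"
  obtains z where "\<And>y. f y = z \<bullet> y"
proof -
  interpret f: bounded_linear f by fact
  define J where "J y = (norm y)\<^sup>2 - 2 * f y" for y
  obtain C where C: "\<And>y. \<bar>f y\<bar> \<le> norm y * C" "0 < C"
    using f.pos_bounded by auto
  have J_ge: "J y \<ge> - C\<^sup>2" for y
  proof -
    have "0 \<le> (norm y - C)\<^sup>2" by simp
    with C(1)[of y] show ?thesis
      unfolding J_def by (simp add: power2_eq_square algebra_simps)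
  qed
  define m where "m = (INF y. J y)"
  have bdd: "bdd_below (range J)"
    using J_ge by (auto simp: bdd_below_def)
  have m_le: "m \<le> J y" for y
    unfolding m_def by (rule cINF_lower[OF bdd]) auto
  have "\<exists>y. J y < m + 1 / real (Suc n)" for n
    using cInf_lessD[of "range J" "m + 1 / real (Suc n)"] by (auto simp: m_def)
  then obtain a where a: "\<And>n. J (a n) < m + 1 / real (Suc n)"
    by metis
  have para: "(norm (x - y))\<^sup>2 \<le> 2 * (J x + J y) - 4 * m" for x y
  proof -
    have "(norm ((1/2) *\<^sub>R (x + y)))\<^sup>2 = (norm (x + y))\<^sup>2 / 4"
      by (simp add: power_divide)
    then have "J ((1/2) *\<^sub>R (x + y)) = (norm (x + y))\<^sup>2 / 4 - (f x + f y)"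
      unfolding J_def by (simp add: f.scaleR f.add field_simps)
    with m_le[of "(1/2) *\<^sub>R (x + y)"]
    have "4 * m \<le> (norm (x + y))\<^sup>2 - 4 * (f x + f y)" by simp
    moreover have "(norm (x + y))\<^sup>2 + (norm (x - y))\<^sup>2 = 2 * (norm x)\<^sup>2 + 2 * (norm y)\<^sup>2"
      by (simp add: power2_norm_eq_inner inner_simps inner_commute)
    ultimately show ?thesis
      unfolding J_def by argo
  qed
  have "Cauchy a"
  proof (rule metric_CauchyI)
    fix e :: real assume "e > 0"
    obtain N where N: "4 / real (Suc N) < e\<^sup>2"
      using reals_Archimedean[of "e\<^sup>2 / 4"] \<open>e > 0\<close> by (auto simp: field_simps)
    have le: "J (a n) < m + 1 / real (Suc N)" if "n \<ge> N" for n
    proof -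
      have "1 / real (Suc n) \<le> 1 / real (Suc N)"
        using that by (simp add: frac_le)
      with a[of n] show ?thesis by linarith
    qed
    have "dist (a k) (a l) < e" if "k \<ge> N" "l \<ge> N" for k l
    proof -
      have "(norm (a k - a l))\<^sup>2 < e\<^sup>2"
        using para[of "a k" "a l"] le[OF that(1)] le[OF that(2)] N by argo
      then show ?thesis
        using \<open>e > 0\<close> by (simp add: dist_norm power_less_imp_less_base)
    qed
    then show "\<exists>M. \<forall>m\<ge>M. \<forall>n\<ge>M. dist (a m) (a n) < e" by blast
  qed
  then obtain z where z: "a \<longlonglongrightarrow> z"
    using Cauchy_convergent_iff convergent_def by blast
  have "(\<lambda>n. J (a n)) \<longlonglongrightarrow> J z"
    unfolding J_def by (intro tendsto_intros z f.tendsto)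
  moreover have "(\<lambda>n. m + 1 / real (Suc n)) \<longlonglongrightarrow> m + 0"
    by (intro tendsto_intros LIMSEQ_Suc[OF lim_1_over_n])
  ultimately have "J z \<le> m + 0"
    by (rule LIMSEQ_le) (use a less_imp_le in blast)
  then have "J z \<le> m" by simp
  have "f y = z \<bullet> y" for y
  proof (rule ccontr)
    assume ne: "f y \<noteq> z \<bullet> y"
    define d where "d = z \<bullet> y - f y"
    have d: "d \<noteq> 0" using ne by (simp add: d_def)
    have quad: "0 \<le> t\<^sup>2 * (norm y)\<^sup>2 + 2 * t * d" for t
    proof -
      have "J z \<le> J (z + t *\<^sub>R y)"
        using m_le \<open>J z \<le> m\<close> order_trans by blast
      moreover have "(norm (z + t *\<^sub>R y))\<^sup>2 = (norm z)\<^sup>2 + 2 * t * (z \<bullet> y) + t\<^sup>2 * (norm y)\<^sup>2"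
        by (simp only: power2_norm_eq_inner)
          (simp add: inner_simps inner_commute power2_eq_square algebra_simps)
      ultimately show ?thesis
        unfolding J_def d_def by (simp add: f.add f.scaleR algebra_simps)
    qed
    have "y \<noteq> 0" using d by (auto simp: d_def f.zero)
    then have "0 < (norm y)\<^sup>2" by simp
    moreover have "0 \<le> (- d / (norm y)\<^sup>2)\<^sup>2 * (norm y)\<^sup>2 + 2 * (- d / (norm y)\<^sup>2) * d"
      by (rule quad)
    moreover have "(- d / (norm y)\<^sup>2)\<^sup>2 * (norm y)\<^sup>2 + 2 * (- d / (norm y)\<^sup>2) * d = - d\<^sup>2 / (norm y)\<^sup>2"
      using \<open>y \<noteq> 0\<close> by (simp add: power2_eq_square field_simps)
    ultimately have "0 \<le> - d\<^sup>2 / (norm y)\<^sup>2" by (simp only:)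
    moreover have "0 < d\<^sup>2 / (norm y)\<^sup>2"
      using d \<open>y \<noteq> 0\<close> by (intro divide_pos_pos) auto
    ultimately show False by simp
  qed
  then show ?thesis using that by blast
qed

lemma riesz:
  fixes \<phi> :: "'a::complex_hilbert \<Rightarrow> complex"
  assumes add: "\<And>x y. \<phi> (x + y) = \<phi> x + \<phi> y" and scale: "\<And>c x. \<phi> (c *\<^sub>C x) = c * \<phi> x"
    and bound: "\<And>x. cmod (\<phi> x) \<le> norm x * K"
  obtains z where "\<And>y. \<phi> y = cinner z y"
proof -
  have "bounded_linear (\<lambda>y. Re (\<phi> y))"
  proof (rule bounded_linear_intro[where K = K])
    show "Re (\<phi> (r *\<^sub>R x)) = r *\<^sub>R Re (\<phi> x)" for r x
      by (simp add: scaleC_of_real[symmetric] scale)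
    show "norm (Re (\<phi> x)) \<le> norm x * K" for x
      using bound[of x] abs_Re_le_cmod[of "\<phi> x"] by simp
  qed (simp add: add)
  then obtain z where z: "\<And>y. Re (\<phi> y) = z \<bullet> y"
    using riesz_real by blast
  have "\<phi> y = cinner z y" for y
  proof (rule complex_eqI)
    show "Re (\<phi> y) = Re (cinner z y)" by (simp add: z Re_cinner)
    have "Re (\<phi> (\<i> *\<^sub>C y)) = Re (cinner z (\<i> *\<^sub>C y))"
      by (simp add: z Re_cinner)
    then show "Im (\<phi> y) = Im (cinner z y)"
      by (simp add: scale cinner_scaleC_right)
  qed
  then show ?thesis using that by blast
qed

text \<open>
  The adjoint of an everywhere defined bounded operator as a total function, in contrast to \<open>adj\<close>.
\<close>

definition badj :: "('a::complex_hilbert \<Rightarrow> 'a) \<Rightarrow> 'a \<Rightarrow> 'a"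
  where "badj f = (SOME g. \<forall>x y. cinner (f x) y = cinner x (g y))"

lemma cinner_badj:
  assumes "bounded_clinear f"
  shows "cinner (f x) y = cinner x (badj f y)"
proof -
  have bound: "cmod (cinner y (f x)) \<le> norm x * (norm y * onorm f)" for x y
  proof -
    have "cmod (cinner y (f x)) \<le> norm y * norm (f x)" by (rule cmod_cinner_le)
    also have "\<dots> \<le> norm y * (onorm f * norm x)"
      by (intro mult_left_mono bounded_clinear_norm[OF assms]) simp
    finally show ?thesis by (simp add: mult_ac)
  qed
  have "\<exists>z. \<forall>x. cinner z x = cinner y (f x)" for y
    by (rule riesz[of "\<lambda>x. cinner y (f x)" "norm y * onorm f"])
      (auto simp: bounded_clinearD(1,4)[OF assms] cinner_simps cinner_scaleC_right bound)
  then obtain g where "\<And>y x. cinner (g y) x = cinner y (f x)" by metis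
  then have "\<exists>g. \<forall>x y. cinner (f x) y = cinner x (g y)"
    by (metis cinner_commute)
  then have "\<forall>x y. cinner (f x) y = cinner x (badj f y)"
    unfolding badj_def by (rule someI_ex)
  then show ?thesis by blast
qed

lemma cinner_badj_left: "bounded_clinear f \<Longrightarrow> cinner (badj f x) y = cinner x (f y)"
  by (metis cinner_badj cinner_commute)

lemma bounded_clinear_badj:
  assumes "bounded_clinear f"
  shows "bounded_clinear (badj f)"
proof (rule bounded_clinearI[where K = "onorm f"])
  show "badj f (x + y) = badj f x + badj f y" for x y
    by (rule cinner_ext) (simp add: cinner_badj[OF assms, symmetric] cinner_simps)
  show "badj f (c *\<^sub>C x) = c *\<^sub>C badj f x" for c x
    by (rule cinner_ext) (simp add: cinner_badj[OF assms, symmetric] cinner_scaleC_right)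
  show "norm (badj f x) \<le> norm x * onorm f" for x
  proof (rule norm_le_if_cinner_le[of UNIV])
    have "cmod (cinner y (badj f x)) \<le> norm (f y) * norm x" for y
      using cmod_cinner_le by (simp add: cinner_badj[OF assms, symmetric])
    also have "norm (f y) * norm x \<le> norm y * (norm x * onorm f)" for y
      using mult_right_mono[OF bounded_clinear_norm[OF assms, of y], of "norm x"] by (simp add: mult_ac)
    finally show "cmod (cinner y (badj f x)) \<le> norm y * (norm x * onorm f)" for y .
  qed (simp_all add: dense_set_def onorm_pos_le[OF bounded_clinearD(6)[OF assms]])
qed

section \<open>Orthonormal bases\<close>

lemma orthonormal_basisD:
  assumes "orthonormal_basis B"
  shows "e \<in> B \<Longrightarrow> cinner e e = 1" "e \<in> B \<Longrightarrow> f \<in> B \<Longrightarrow> e \<noteq> f \<Longrightarrow> cinner e f = 0"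
    "(\<And>e. e \<in> B \<Longrightarrow> cinner e x = 0) \<Longrightarrow> x = 0"
  using assms unfolding orthonormal_basis_def by simp_all

lemma bessel_finite:
  assumes B: "orthonormal_basis B" and F: "finite F" "F \<subseteq> B"
  shows "(\<Sum>e\<in>F. (cmod (cinner e x))\<^sup>2) \<le> (norm x)\<^sup>2"
proof -
  define y where "y = (\<Sum>e\<in>F. cinner e x *\<^sub>C e)"
  have lin: "cinner z (\<Sum>e\<in>A. g e) = (\<Sum>e\<in>A. cinner z (g e))" for z g and A :: "'a set"
    by (induction A rule: infinite_finite_induct) (auto simp: cinner_simps)
  have ey: "cinner e y = cinner e x" if "e \<in> F" for e
  proof -
    have "cinner e y = (\<Sum>f\<in>F. if f = e then cinner e x else 0)"
      unfolding y_def lin cinner_scaleC_right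
      using orthonormal_basisD(1,2)[OF B] that F(2) by (intro sum.cong) (auto simp: subset_iff)
    then show ?thesis using that F(1) by simp
  qed
  have S: "cinner z y = (\<Sum>e\<in>F. cinner e x * cinner z e)" for z
    by (simp add: y_def lin cinner_scaleC_right)
  have sq: "complex_of_real (\<Sum>e\<in>F. (cmod (cinner e x))\<^sup>2) = (\<Sum>e\<in>F. cinner e x * cinner x e)"
  proof -
    have "complex_of_real ((cmod (cinner e x))\<^sup>2) = cinner e x * cinner x e" for e
      using cinner_commute[of x e] by (simp only: complex_norm_square)
    then show ?thesis by (simp only: of_real_sum)
  qed
  have xy: "cinner x y = complex_of_real (\<Sum>e\<in>F. (cmod (cinner e x))\<^sup>2)"
    unfolding sq by (rule S)
  have yy: "cinner y y = cinner x y"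
    unfolding S
  proof (rule sum.cong)
    fix e assume "e \<in> F"
    then have "cinner y e = cinner x e"
      using ey[of e] cinner_commute[of y e] cinner_commute[of x e] by simp
    then show "cinner e x * cinner y e = cinner e x * cinner x e" by simp
  qed simp
  have "cinner (x - y) (x - y) = cinner x x - cinner x y"
  proof -
    have "cinner y x = cnj (cinner x y)" by (rule cinner_commute)
    also have "\<dots> = cinner x y" by (simp only: xy complex_cnj_complex_of_real)
    finally show ?thesis by (simp only: cinner_simps yy) simp
  qed
  then have "complex_of_real ((norm (x - y))\<^sup>2) = complex_of_real ((norm x)\<^sup>2 - (\<Sum>e\<in>F. (cmod (cinner e x))\<^sup>2))"
    by (simp only: xy cinner_self of_real_diff)
  then have "(norm (x - y))\<^sup>2 = (norm x)\<^sup>2 - (\<Sum>e\<in>F. (cmod (cinner e x))\<^sup>2)"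
    unfolding of_real_eq_iff .
  then show ?thesis
    using zero_le_power2[of "norm (x - y)"] by linarith
qed

lemma bessel_summable:
  assumes "orthonormal_basis B"
  shows "(\<lambda>e. (cmod (cinner e x))\<^sup>2) summable_on B"
  by (rule nonneg_bdd_above_summable_on) (auto intro!: bdd_aboveI2 bessel_finite[OF assms])

lemma bessel_infsum:
  assumes "orthonormal_basis B"
  shows "(\<Sum>\<^sub>\<infinity>e\<in>B. (cmod (cinner e x))\<^sup>2) \<le> (norm x)\<^sup>2"
  by (rule infsum_le_finite_sums) (auto intro!: bessel_finite[OF assms] bessel_summable[OF assms])

lemma mult_le_sum_of_squares: "a * b \<le> a\<^sup>2 + b\<^sup>2" for a b :: real
proof -
  have "2 * (a * b) \<le> a\<^sup>2 + b\<^sup>2" "0 \<le> a\<^sup>2 + b\<^sup>2"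
    using sum_squares_bound[of a b] by (simp_all add: mult.assoc)
  then show ?thesis by linarith
qed

lemma summable_on_mult_of_squares:
  fixes f g :: "'i \<Rightarrow> complex"
  assumes "(\<lambda>i. (cmod (f i))\<^sup>2) summable_on A" "(\<lambda>i. (cmod (g i))\<^sup>2) summable_on A"
  shows "(\<lambda>i. norm (f i * g i)) summable_on A"
proof (rule Infinite_Sum.abs_summable_on_comparison_test'[where g = "\<lambda>i. (cmod (f i))\<^sup>2 + (cmod (g i))\<^sup>2"])
  show "(\<lambda>i. (cmod (f i))\<^sup>2 + (cmod (g i))\<^sup>2) summable_on A"
    by (intro summable_on_add assms)
  show "norm (f i * g i) \<le> (cmod (f i))\<^sup>2 + (cmod (g i))\<^sup>2" for i
    by (simp add: norm_mult mult_le_sum_of_squares)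
qed

text \<open>
  The functional \<open>y \<mapsto> \<Sum>\<langle>x, e\<rangle>\<langle>e, y\<rangle>\<close> is represented by a vector that has the same coefficients
  as \<open>x\<close>, hence by \<open>x\<close> itself.
\<close>

lemma parseval_cinner:
  assumes B: "orthonormal_basis B"
  shows "((\<lambda>e. cinner x e * cinner e y) has_sum cinner x y) B"
proof -
  define \<psi> where "\<psi> y = (\<Sum>\<^sub>\<infinity>e\<in>B. cinner x e * cinner e y)" for y
  have sum: "(\<lambda>e. norm (cinner x e * cinner e y)) summable_on B" for y
    using bessel_summable[OF B] by (intro summable_on_mult_of_squares) (simp_all add: cmod_cinner_commute[of x])
  note summable = abs_summable_summable[OF this]
  have \<psi>_bound: "cmod (\<psi> y) \<le> (norm x)\<^sup>2 + (norm y)\<^sup>2" for y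
  proof -
    have "cmod (\<psi> y) \<le> (\<Sum>\<^sub>\<infinity>e\<in>B. cmod (cinner x e * cinner e y))"
      unfolding \<psi>_def by (rule norm_infsum_bound[OF sum])
    also have "\<dots> \<le> (\<Sum>\<^sub>\<infinity>e\<in>B. (cmod (cinner e x))\<^sup>2 + (cmod (cinner e y))\<^sup>2)"
    proof (rule infsum_mono[OF sum])
      show "(\<lambda>e. (cmod (cinner e x))\<^sup>2 + (cmod (cinner e y))\<^sup>2) summable_on B"
        by (intro summable_on_add bessel_summable[OF B])
      show "cmod (cinner x e * cinner e y) \<le> (cmod (cinner e x))\<^sup>2 + (cmod (cinner e y))\<^sup>2" for e
        by (simp add: norm_mult cmod_cinner_commute[of x] mult_le_sum_of_squares)
    qed
    also have "\<dots> = (\<Sum>\<^sub>\<infinity>e\<in>B. (cmod (cinner e x))\<^sup>2) + (\<Sum>\<^sub>\<infinity>e\<in>B. (cmod (cinner e y))\<^sup>2)"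
      by (intro infsum_add bessel_summable[OF B])
    also have "\<dots> \<le> (norm x)\<^sup>2 + (norm y)\<^sup>2"
      by (intro add_mono bessel_infsum[OF B])
    finally show ?thesis .
  qed
  have add: "\<psi> (y + z) = \<psi> y + \<psi> z" for y z
    unfolding \<psi>_def by (simp add: cinner_simps distrib_left infsum_add summable)
  have scale: "\<psi> (c *\<^sub>C y) = c * \<psi> y" for c y
    unfolding \<psi>_def by (simp add: cinner_scaleC_right mult.left_commute[of _ c] infsum_cmult_right' )
  have "cmod (\<psi> y) \<le> norm y * ((norm x)\<^sup>2 + 1)" for y
  proof (cases "y = 0")
    case True
    then show ?thesis using scale[of 0 0] by (simp add: scaleC_zero_right)
  next
    case False
    have "cmod (\<psi> (complex_of_real (1 / norm y) *\<^sub>C y)) \<le> (norm x)\<^sup>2 + 1"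
      using \<psi>_bound[of "complex_of_real (1 / norm y) *\<^sub>C y"] False by (simp add: norm_scaleC norm_divide)
    then show ?thesis
      unfolding scale using False by (simp add: norm_mult norm_divide field_simps)
  qed
  then obtain z where z: "\<And>y. \<psi> y = cinner z y"
    using riesz[OF add scale] by metis
  have "x = z"
  proof -
    have "cinner e (x - z) = 0" if e: "e \<in> B" for e
    proof -
      have "\<psi> e = (\<Sum>\<^sub>\<infinity>f\<in>{e}. cinner x f * cinner f e)"
        unfolding \<psi>_def using orthonormal_basisD(1,2)[OF B] e by (intro infsum_cong_neutral) auto
      then have "cinner z e = cinner x e"
        using orthonormal_basisD(1)[OF B e] by (simp add: z)
      then show ?thesis
        by (metis cinner_commute cinner_diff_right diff_self)
    qed
    then show ?thesis
      using orthonormal_basisD(3)[OF B, of "x - z"] by auto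
  qed
  with has_sum_infsum[OF summable[of y]] show ?thesis
    unfolding \<psi>_def[symmetric] z by simp
qed

lemma parseval:
  assumes "orthonormal_basis B"
  shows "((\<lambda>e. (cmod (cinner e x))\<^sup>2) has_sum (norm x)\<^sup>2) B"
proof -
  have "((\<lambda>e. Re (cinner x e * cinner e x)) has_sum Re (cinner x x)) B"
    by (intro has_sum_Re parseval_cinner assms)
  moreover have "Re (cinner x e * cinner e x) = (cmod (cinner e x))\<^sup>2" for e
  proof -
    have "cinner x e * cinner e x = complex_of_real ((cmod (cinner e x))\<^sup>2)"
      using cinner_commute[of x e] by (simp only: complex_norm_square mult.commute)
    then show ?thesis by (simp only: Re_complex_of_real)
  qed
  ultimately show ?thesis by (simp add: cinner_self del: of_real_power)
qed

section \<open>Hilbert--Schmidt operators and the trace\<close>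

lemma badj_badj: "bounded_clinear f \<Longrightarrow> badj (badj f) = f"
  by (rule ext, rule cinner_ext) (simp add: cinner_badj[symmetric] bounded_clinear_badj cinner_badj_left)

lemma badj_comp:
  assumes "bounded_clinear f" "bounded_clinear g"
  shows "badj (\<lambda>x. f (g x)) = (\<lambda>x. badj g (badj f x))"
  by (rule ext, rule cinner_ext)
    (simp add: cinner_badj[OF assms(1), symmetric] cinner_badj[OF assms(2), symmetric]
      cinner_badj[OF bounded_clinear_comp[OF assms], symmetric])

text \<open>
  The sums of \<open>\<parallel>T e\<parallel>\<^sup>2\<close> and of \<open>\<parallel>T\<^sup>* f\<parallel>\<^sup>2\<close> are the two iterated sums of
  \<open>\<bar>\<langle>f, T e\<rangle>\<bar>\<^sup>2 = \<bar>\<langle>T\<^sup>* f, e\<rangle>\<bar>\<^sup>2\<close>. So the Hilbert--Schmidt property neither depends on the basis nor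
  distinguishes between \<open>T\<close> and \<open>T\<^sup>*\<close>.
\<close>

lemma hilbert_schmidt_double_sum:
  assumes B: "orthonormal_basis B" and C: "orthonormal_basis C" and T: "bounded_clinear T"
    and sum: "(\<lambda>e. (norm (T e))\<^sup>2) summable_on B"
  shows "(\<lambda>(e, f). (cmod (cinner f (T e)))\<^sup>2) summable_on B \<times> C"
    and "((\<lambda>f. (norm (badj T f))\<^sup>2) has_sum (\<Sum>\<^sub>\<infinity>e\<in>B. (norm (T e))\<^sup>2)) C"
proof -
  let ?g = "\<lambda>(e, f). (cmod (cinner f (T e)))\<^sup>2"
  have row: "((\<lambda>f. ?g (e, f)) has_sum (norm (T e))\<^sup>2) C" for e
    using parseval[OF C] by simp
  show summable: "?g summable_on B \<times> C"
    by (rule summable_on_SigmaI[OF row sum]) auto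
  have "(?g has_sum (\<Sum>\<^sub>\<infinity>e\<in>B. (norm (T e))\<^sup>2)) (B \<times> C)"
    by (rule has_sum_SigmaI[OF row has_sum_infsum[OF sum] summable])
  then have swapped: "((\<lambda>(f, e). ?g (e, f)) has_sum (\<Sum>\<^sub>\<infinity>e\<in>B. (norm (T e))\<^sup>2)) (C \<times> B)"
    by (subst (asm) has_sum_swap)
  show "((\<lambda>f. (norm (badj T f))\<^sup>2) has_sum (\<Sum>\<^sub>\<infinity>e\<in>B. (norm (T e))\<^sup>2)) C"
  proof (rule has_sum_SigmaD[OF swapped])
    fix f
    have "(cmod (cinner f (T e)))\<^sup>2 = (cmod (cinner e (badj T f)))\<^sup>2" for e
      by (metis T cinner_badj cmod_cinner_commute)
    then show "((\<lambda>e. (\<lambda>(f, e). ?g (e, f)) (f, e)) has_sum (norm (badj T f))\<^sup>2) B"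
      using parseval[OF B, of "badj T f"] by simp
  qed
qed

lemma hilbert_schmidt_bounded: "hilbert_schmidt T \<Longrightarrow> bounded_clinear T"
  by (simp add: hilbert_schmidt_def)

lemma hilbert_schmidt_badj: "hilbert_schmidt T \<Longrightarrow> hilbert_schmidt (badj T)"
  unfolding hilbert_schmidt_def
  using hilbert_schmidt_double_sum(2) bounded_clinear_badj has_sum_imp_summable by blast

lemma hilbert_schmidt_has_sum_badj:
  assumes T: "hilbert_schmidt T" and C: "orthonormal_basis C"
  shows "(\<lambda>e. (norm (T e))\<^sup>2) summable_on C"
    and "((\<lambda>e. (norm (badj T e))\<^sup>2) has_sum (\<Sum>\<^sub>\<infinity>e\<in>C. (norm (T e))\<^sup>2)) C"
proof -
  have "hilbert_schmidt (badj T)"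
    using T by (rule hilbert_schmidt_badj)
  then show "(\<lambda>e. (norm (T e))\<^sup>2) summable_on C"
    using hilbert_schmidt_double_sum(2)[OF _ C] badj_badj[OF hilbert_schmidt_bounded[OF T]]
    unfolding hilbert_schmidt_def by (metis has_sum_imp_summable)
  then show "((\<lambda>e. (norm (badj T e))\<^sup>2) has_sum (\<Sum>\<^sub>\<infinity>e\<in>C. (norm (T e))\<^sup>2)) C"
    by (rule hilbert_schmidt_double_sum(2)[OF C C hilbert_schmidt_bounded[OF T]])
qed

lemma hilbert_schmidt_comp_left:
  assumes "bounded_clinear Y" "hilbert_schmidt T"
  shows "hilbert_schmidt (\<lambda>x. Y (T x))"
proof -
  obtain B where B: "orthonormal_basis B" "(\<lambda>e. (norm (T e))\<^sup>2) summable_on B"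
    using assms(2) unfolding hilbert_schmidt_def by blast
  have "(\<lambda>e. (norm (Y (T e)))\<^sup>2) summable_on B"
  proof (rule summable_on_comparison_test)
    show "(\<lambda>e. (onorm Y)\<^sup>2 * (norm (T e))\<^sup>2) summable_on B"
      by (intro summable_on_cmult_right B)
    show "(norm (Y (T e)))\<^sup>2 \<le> (onorm Y)\<^sup>2 * (norm (T e))\<^sup>2" for e
      using power_mono[OF bounded_clinear_norm[OF assms(1), of "T e"], of 2]
      by (simp add: power_mult_distrib)
  qed auto
  with B(1) show ?thesis
    unfolding hilbert_schmidt_def
    using bounded_clinear_comp[OF assms(1) hilbert_schmidt_bounded[OF assms(2)]] by blast
qed

lemma hilbert_schmidt_comp_right:
  assumes "bounded_clinear Y" "hilbert_schmidt T"
  shows "hilbert_schmidt (\<lambda>x. T (Y x))"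
proof -
  have T: "bounded_clinear T" using assms(2) by (rule hilbert_schmidt_bounded)
  have "hilbert_schmidt (badj (\<lambda>x. badj Y (badj T x)))"
    by (rule hilbert_schmidt_badj[OF hilbert_schmidt_comp_left[OF bounded_clinear_badj[OF assms(1)]
            hilbert_schmidt_badj[OF assms(2)]]])
  then show ?thesis
    unfolding badj_comp[OF bounded_clinear_badj[OF assms(1)] bounded_clinear_badj[OF T]]
      badj_badj[OF assms(1)] badj_badj[OF T] .
qed

text \<open>
  Both traces are the double sum of \<open>\<langle>e, R f\<rangle>\<langle>f, S e\<rangle>\<close>. This gives the cyclic property as well as
  the independence of the basis.
\<close>

lemma trace_sum_commute:
  assumes R: "hilbert_schmidt R" and S: "hilbert_schmidt S"
    and B: "orthonormal_basis B" and C: "orthonormal_basis C"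
  obtains t where "((\<lambda>e. cinner e (R (S e))) has_sum t) B" "((\<lambda>f. cinner f (S (R f))) has_sum t) C"
proof -
  note bR = hilbert_schmidt_bounded[OF R] and bS = hilbert_schmidt_bounded[OF S]
  let ?g = "\<lambda>(e, f). cinner (badj R e) f * cinner f (S e)"
  have "?g summable_on B \<times> C"
  proof (rule abs_summable_summable, rule Infinite_Sum.abs_summable_on_comparison_test')
    have "(\<lambda>(e, f). (cmod (cinner f (badj R e)))\<^sup>2) summable_on B \<times> C"
      by (rule hilbert_schmidt_double_sum(1)[OF B C bounded_clinear_badj[OF bR]
            hilbert_schmidt_has_sum_badj(1)[OF hilbert_schmidt_badj[OF R] B]])
    moreover have "(\<lambda>(e, f). (cmod (cinner f (S e)))\<^sup>2) summable_on B \<times> C"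
      by (rule hilbert_schmidt_double_sum(1)[OF B C bS hilbert_schmidt_has_sum_badj(1)[OF S B]])
    ultimately show "(\<lambda>p. (\<lambda>(e, f). (cmod (cinner f (badj R e)))\<^sup>2) p + (\<lambda>(e, f). (cmod (cinner f (S e)))\<^sup>2) p)
        summable_on B \<times> C"
      by (rule summable_on_add)
    show "norm (?g p) \<le> (\<lambda>(e, f). (cmod (cinner f (badj R e)))\<^sup>2) p + (\<lambda>(e, f). (cmod (cinner f (S e)))\<^sup>2) p" for p
    proof (cases p)
      case (Pair e f)
      then show ?thesis
        using mult_le_sum_of_squares[of "cmod (cinner f (badj R e))" "cmod (cinner f (S e))"]
          cmod_cinner_commute[of "badj R e" f] by (simp add: norm_mult)
    qed
  qed
  then obtain t where t: "(?g has_sum t) (B \<times> C)"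
    by (auto simp: summable_on_def)
  show ?thesis
  proof (rule that)
    show "((\<lambda>e. cinner e (R (S e))) has_sum t) B"
    proof (rule has_sum_SigmaD[OF t])
      show "((\<lambda>f. ?g (e, f)) has_sum cinner e (R (S e))) C" for e
        using parseval_cinner[OF C, of "badj R e" "S e"] by (simp add: cinner_badj_left[OF bR])
    qed
    show "((\<lambda>f. cinner f (S (R f))) has_sum t) C"
    proof (rule has_sum_SigmaD)
      show "((\<lambda>(f, e). ?g (e, f)) has_sum t) (C \<times> B)"
        using t by (subst (asm) has_sum_swap)
      have eq: "cinner (badj R e) f * cinner f (S e) = cinner (badj S f) e * cinner e (R f)" for e f
        by (simp only: cinner_badj_left[OF bR] cinner_badj_left[OF bS] mult.commute)
      show "((\<lambda>e. (\<lambda>(f, e). ?g (e, f)) (f, e)) has_sum cinner f (S (R f))) B" for f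
        using parseval_cinner[OF B, of "badj S f" "R f"] by (simp add: eq cinner_badj_left[OF bS])
    qed
  qed
qed

lemma trace_hilbert_schmidt:
  assumes R: "hilbert_schmidt R" and S: "hilbert_schmidt S"
  shows "orthonormal_basis B \<Longrightarrow> ((\<lambda>e. cinner e (R (S e))) has_sum trace_bounded (\<lambda>x. R (S x))) B"
    and "trace_bounded (\<lambda>x. R (S x)) = trace_bounded (\<lambda>x. S (R x))"
proof -
  have ex: "orthonormal_basis (SOME B :: 'a set. orthonormal_basis B)"
    using R unfolding hilbert_schmidt_def by (blast intro: someI)
  obtain t where t: "((\<lambda>e. cinner e (R (S e))) has_sum t) (SOME B. orthonormal_basis B)"
      "((\<lambda>e. cinner e (S (R e))) has_sum t) (SOME B. orthonormal_basis B)"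
    using trace_sum_commute[OF R S ex ex] by blast
  from t have tr: "trace_bounded (\<lambda>x. R (S x)) = t" "trace_bounded (\<lambda>x. S (R x)) = t"
    unfolding trace_bounded_def by (auto intro: infsumI)
  show "trace_bounded (\<lambda>x. R (S x)) = trace_bounded (\<lambda>x. S (R x))"
    by (simp add: tr)
  show "((\<lambda>e. cinner e (R (S e))) has_sum trace_bounded (\<lambda>x. R (S x))) B"
    if B: "orthonormal_basis B"
  proof -
    obtain t' where "((\<lambda>e. cinner e (R (S e))) has_sum t') B"
      "((\<lambda>e. cinner e (S (R e))) has_sum t') (SOME B. orthonormal_basis B)"
      using trace_sum_commute[OF R S B ex] by blast
    moreover from this(2) have "t' = t" using t(2) by (rule has_sum_unique)
    ultimately show ?thesis by (simp add: tr)
  qed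
qed

text \<open>
  Differences of trace class operators have to be treated as trace class operators. To write such a
  difference as a single product of two Hilbert--Schmidt operators takes a polar decomposition; closing
  the class under differences avoids it, since all properties of the trace carry over.
\<close>

inductive trace_span :: "('a::complex_hilbert \<Rightarrow> 'a) \<Rightarrow> bool" where
  base: "hilbert_schmidt R \<Longrightarrow> hilbert_schmidt S \<Longrightarrow> trace_span (\<lambda>x. R (S x))"
| diff: "trace_span S \<Longrightarrow> trace_span T \<Longrightarrow> trace_span (\<lambda>x. S x - T x)"

lemma trace_class_trace_span: "trace_class T \<Longrightarrow> trace_span T"
  unfolding trace_class_def comp_def using trace_span.base by auto

lemma trace_span_bounded: "trace_span T \<Longrightarrow> bounded_clinear T"
  by (induction rule: trace_span.induct)
    (simp_all add: bounded_clinear_comp bounded_clinear_diff hilbert_schmidt_bounded)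

lemma trace_span_ex_basis: "trace_span (T :: 'a \<Rightarrow> 'a::complex_hilbert) \<Longrightarrow> \<exists>B :: 'a set. orthonormal_basis B"
  by (induction rule: trace_span.induct) (auto simp: hilbert_schmidt_def)

lemma trace_bounded_eqI:
  assumes "\<And>B. orthonormal_basis B \<Longrightarrow> ((\<lambda>e. cinner e (T e)) has_sum t) B"
    and "\<exists>B :: 'a set. orthonormal_basis B"
  shows "trace_bounded (T :: 'a \<Rightarrow> 'a::complex_hilbert) = t"
  unfolding trace_bounded_def by (rule infsumI[OF assms(1)]) (rule someI_ex[OF assms(2)])

lemma trace_span_has_sum:
  assumes "trace_span T" "orthonormal_basis B"
  shows "((\<lambda>e. cinner e (T e)) has_sum trace_bounded T) B"
  using assms
proof (induction arbitrary: B rule: trace_span.induct)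
  case (diff S T)
  have sum: "((\<lambda>e. cinner e (S e - T e)) has_sum (trace_bounded S - trace_bounded T)) B'"
    if "orthonormal_basis B'" for B'
    using has_sum_add[OF diff.IH(1)[OF that] has_sum_uminusI[OF diff.IH(2)[OF that]]]
    by (simp add: cinner_simps)
  have "trace_bounded (\<lambda>x. S x - T x) = trace_bounded S - trace_bounded T"
    by (rule trace_bounded_eqI) (use sum diff.prems in auto)
  with sum[OF diff.prems] show ?case by simp
qed (rule trace_hilbert_schmidt)

lemma trace_bounded_diff:
  assumes "trace_span S" "trace_span T"
  shows "trace_bounded (\<lambda>x. S x - T x) = trace_bounded S - trace_bounded T"
proof (rule trace_bounded_eqI)
  show "((\<lambda>e. cinner e (S e - T e)) has_sum (trace_bounded S - trace_bounded T)) B"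
    if "orthonormal_basis B" for B
    using has_sum_add[OF trace_span_has_sum[OF assms(1) that] has_sum_uminusI[OF trace_span_has_sum[OF assms(2) that]]]
    by (simp add: cinner_simps)
qed (rule trace_span_ex_basis[OF assms(1)])

lemma trace_span_comp:
  assumes Y: "bounded_clinear Y" and T: "trace_span T"
  shows "trace_span (\<lambda>x. Y (T x))" "trace_span (\<lambda>x. T (Y x))"
    and "trace_bounded (\<lambda>x. Y (T x)) = trace_bounded (\<lambda>x. T (Y x))"
proof -
  have "trace_span (\<lambda>x. Y (T x)) \<and> trace_span (\<lambda>x. T (Y x)) \<and>
      trace_bounded (\<lambda>x. Y (T x)) = trace_bounded (\<lambda>x. T (Y x))"
    using T
  proof (induction rule: trace_span.induct)
    case (base R S)
    have YR: "hilbert_schmidt (\<lambda>x. Y (R x))" and SY: "hilbert_schmidt (\<lambda>x. S (Y x))"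
      by (rule hilbert_schmidt_comp_left[OF Y base(1)] hilbert_schmidt_comp_right[OF Y base(2)])+
    show ?case
      using trace_span.base[OF YR base(2)] trace_span.base[OF base(1) SY]
        trace_hilbert_schmidt(2)[OF YR base(2)] trace_hilbert_schmidt(2)[OF base(1) SY] by simp
  next
    case (diff S T)
    then show ?case
      by (auto simp: bounded_clinearD(2)[OF Y] trace_bounded_diff intro!: trace_span.diff)
  qed
  then show "trace_span (\<lambda>x. Y (T x))" "trace_span (\<lambda>x. T (Y x))"
    "trace_bounded (\<lambda>x. Y (T x)) = trace_bounded (\<lambda>x. T (Y x))" by blast+
qed

lemma infsum_dominated_convergence:
  fixes h :: "nat \<Rightarrow> 'i \<Rightarrow> complex"
  assumes lim: "\<And>i. i \<in> A \<Longrightarrow> (\<lambda>n. h n i) \<longlonglongrightarrow> l i"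
    and dom: "\<And>n i. i \<in> A \<Longrightarrow> cmod (h n i) \<le> g i" and g: "g summable_on A"
  shows "(\<lambda>n. \<Sum>\<^sub>\<infinity>i\<in>A. h n i) \<longlonglongrightarrow> (\<Sum>\<^sub>\<infinity>i\<in>A. l i)"
proof -
  have l_dom: "cmod (l i) \<le> g i" if "i \<in> A" for i
    by (rule LIMSEQ_le_const2[OF tendsto_norm[OF lim[OF that]]]) (use dom[OF that] in blast)
  define d where "d n i = h n i - l i" for n i
  have d_dom: "cmod (d n i) \<le> 2 * g i" if "i \<in> A" for n i
    using norm_triangle_ineq4[of "h n i" "l i"] dom[OF that, of n] l_dom[OF that] by (simp add: d_def)
  have g2: "(\<lambda>i. 2 * g i) summable_on A"
    using g by (rule summable_on_cmult_right)
  have sum_d: "(\<lambda>i. norm (d n i)) summable_on A" for n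
    by (rule Infinite_Sum.abs_summable_on_comparison_test'[OF g2 d_dom])
  have sum_h: "h n summable_on A" for n
    by (rule abs_summable_summable, rule Infinite_Sum.abs_summable_on_comparison_test'[OF g dom])
  have sum_l: "l summable_on A"
    by (rule abs_summable_summable, rule Infinite_Sum.abs_summable_on_comparison_test'[OF g l_dom])
  have "(\<lambda>n. \<Sum>\<^sub>\<infinity>i\<in>A. norm (d n i)) \<longlonglongrightarrow> 0"
  proof (rule LIMSEQ_I)
    fix r :: real assume "0 < r"
    obtain F where F: "finite F" "F \<subseteq> A" "dist (\<Sum>i\<in>F. 2 * g i) (\<Sum>\<^sub>\<infinity>i\<in>A. 2 * g i) \<le> r / 2"
      using has_sum_finite_approximation[OF has_sum_infsum[OF g2], of "r / 2"] \<open>0 < r\<close> by auto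
    have "(\<lambda>n. \<Sum>i\<in>F. norm (d n i)) \<longlonglongrightarrow> (\<Sum>i\<in>F. 0)"
    proof (rule tendsto_sum)
      show "(\<lambda>n. norm (d n i)) \<longlonglongrightarrow> 0" if "i \<in> F" for i
        unfolding d_def using F(2) that by (intro tendsto_norm_zero LIM_zero lim) auto
    qed
    then have "(\<lambda>n. \<Sum>i\<in>F. norm (d n i)) \<longlonglongrightarrow> 0" by simp
    from LIMSEQ_D[OF this, of "r / 2"] \<open>0 < r\<close>
    obtain N where N: "\<And>n. n \<ge> N \<Longrightarrow> norm ((\<Sum>i\<in>F. norm (d n i)) - 0) < r / 2" by auto
    have "norm ((\<Sum>\<^sub>\<infinity>i\<in>A. norm (d n i)) - 0) < r" if n: "n \<ge> N" for n
    proof -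
      have *: "f summable_on F" "f summable_on A - F" if "f summable_on A" for f :: "'i \<Rightarrow> real"
        using summable_on_subset_banach[OF that] F(2) by auto
      have split: "infsum f A = sum f F + infsum f (A - F)" if "f summable_on A" for f :: "'i \<Rightarrow> real"
        using infsum_Un_disjoint[OF *[OF that]] F(1,2) by (simp add: Un_absorb1 Int_Diff)
      have "(\<Sum>\<^sub>\<infinity>i\<in>A - F. norm (d n i)) \<le> (\<Sum>\<^sub>\<infinity>i\<in>A - F. 2 * g i)"
        by (rule infsum_mono[OF *(2)[OF sum_d] *(2)[OF g2]]) (use d_dom in auto)
      also have "\<dots> \<le> r / 2"
        using F(3) split[OF g2] by (auto simp: dist_real_def)
      finally have "(\<Sum>\<^sub>\<infinity>i\<in>A. norm (d n i)) < r"
        using split[OF sum_d, of n] N[OF n] by auto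
      then show ?thesis
        by (simp add: infsum_nonneg)
    qed
    then show "\<exists>N. \<forall>n\<ge>N. norm ((\<Sum>\<^sub>\<infinity>i\<in>A. norm (d n i)) - 0) < r" by blast
  qed
  then have "(\<lambda>n. infsum (d n) A) \<longlonglongrightarrow> 0"
    by (rule Lim_null_comparison[OF always_eventually, rotated])
      (rule allI, rule norm_infsum_bound, rule sum_d)
  moreover have "infsum (d n) A = infsum (h n) A - infsum l A" for n
    unfolding d_def using infsum_add[OF sum_h[of n], of "\<lambda>i. - l i"] sum_l
    by (simp add: infsum_uminus summable_on_uminus)
  ultimately show ?thesis
    by (simp add: LIM_zero_iff)
qed

text \<open>
  For \<open>T = R S\<close> the trace of \<open>T y\<^sub>n\<close> is \<open>\<Sum>\<langle>S\<^sup>* e, y\<^sub>n R e\<rangle>\<close>, a sum dominated by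
  \<open>\<parallel>S\<^sup>* e\<parallel>\<^sup>2 + \<parallel>R e\<parallel>\<^sup>2\<close> in which every term converges.
\<close>

lemma trace_bounded_tendsto:
  assumes T: "trace_span T" and y: "\<And>n. bounded_clinear (y n)" "bounded_clinear z"
    and lim: "\<And>w. (\<lambda>n. y n w) \<longlonglongrightarrow> z w" and bound: "\<And>n w. norm (y n w) \<le> norm w"
  shows "(\<lambda>n. trace_bounded (\<lambda>x. T (y n x))) \<longlonglongrightarrow> trace_bounded (\<lambda>x. T (z x))"
  using T
proof (induction rule: trace_span.induct)
  case (base R S)
  note bS = hilbert_schmidt_bounded[OF base(2)]
  obtain B :: "'a set" where B: "orthonormal_basis B"
    using base(1) unfolding hilbert_schmidt_def by blast
  have tr: "trace_bounded (\<lambda>x. R (S (u x))) = (\<Sum>\<^sub>\<infinity>e\<in>B. cinner (badj S e) (u (R e)))"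
    if "bounded_clinear u" for u
  proof -
    have "hilbert_schmidt (\<lambda>x. S (u x))"
      by (rule hilbert_schmidt_comp_right[OF that base(2)])
    then have "((\<lambda>e. cinner e (S (u (R e)))) has_sum trace_bounded (\<lambda>x. R (S (u x)))) B"
      using trace_hilbert_schmidt(1)[OF _ base(1) B] trace_hilbert_schmidt(2)[OF base(1)] by simp
    then show ?thesis
      by (simp add: infsumI cinner_badj_left[OF bS])
  qed
  show ?case
    unfolding tr[OF y(1)] tr[OF y(2)]
  proof (rule infsum_dominated_convergence)
    show "(\<lambda>n. cinner (badj S e) (y n (R e))) \<longlonglongrightarrow> cinner (badj S e) (z (R e))" for e
      by (intro tendsto_cinner tendsto_const lim)
    show "cmod (cinner (badj S e) (y n (R e))) \<le> (norm (badj S e))\<^sup>2 + (norm (R e))\<^sup>2" for n e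
      using cmod_cinner_le[of "badj S e" "y n (R e)"] mult_left_mono[OF bound[of n "R e"], of "norm (badj S e)"]
        mult_le_sum_of_squares[of "norm (badj S e)" "norm (R e)"] by simp
    show "(\<lambda>e. (norm (badj S e))\<^sup>2 + (norm (R e))\<^sup>2) summable_on B"
      by (rule summable_on_add[OF hilbert_schmidt_has_sum_badj(1)[OF hilbert_schmidt_badj[OF base(2)] B]
            hilbert_schmidt_has_sum_badj(1)[OF base(1) B]])
  qed
next
  case (diff S T)
  then show ?case
    by (simp add: trace_bounded_diff trace_span_comp y tendsto_diff)
qed

text \<open>
  If \<open>\<Sum> z\<^sub>n z\<^sub>n\<^sup>* \<le> 1\<close> then \<open>\<Sum> \<parallel>S z\<^sub>n\<parallel>\<^sup>2 = \<Sum> \<parallel>z\<^sub>n\<^sup>* S\<^sup>*\<parallel>\<^sup>2 \<le> \<parallel>S\<^sup>*\<parallel>\<^sup>2\<close> in Hilbert--Schmidt norm.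
\<close>

lemma hilbert_schmidt_family_summable:
  assumes S: "hilbert_schmidt S" and z: "\<And>n. bounded_clinear (z n)"
    and bound: "\<And>N w. (\<Sum>n<N. (norm (badj (z n) w))\<^sup>2) \<le> (norm w)\<^sup>2" and B: "orthonormal_basis B"
  shows "(\<lambda>(e, n). (norm (S (z n e)))\<^sup>2) summable_on B \<times> (UNIV :: nat set)"
proof (rule nonneg_bdd_above_summable_on)
  note bS = hilbert_schmidt_bounded[OF S]
  define K where "K = (\<Sum>\<^sub>\<infinity>f\<in>B. (norm (badj S f))\<^sup>2)"
  note sumS = hilbert_schmidt_has_sum_badj(1)[OF hilbert_schmidt_badj[OF S] B]
  have hs: "hilbert_schmidt (\<lambda>x. S (z n x))" for n
    by (rule hilbert_schmidt_comp_right[OF z S])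
  have hs': "(\<lambda>f. (norm (badj (z n) (badj S f)))\<^sup>2) summable_on B" for n
    by (rule hilbert_schmidt_has_sum_badj(1)[OF hilbert_schmidt_comp_left[OF bounded_clinear_badj[OF z]
            hilbert_schmidt_badj[OF S]] B])
  have eq: "(\<Sum>\<^sub>\<infinity>e\<in>B. (norm (S (z n e)))\<^sup>2) = (\<Sum>\<^sub>\<infinity>f\<in>B. (norm (badj (z n) (badj S f)))\<^sup>2)" for n
    using infsumI[OF hilbert_schmidt_has_sum_badj(2)[OF hs[of n] B]] by (simp only: badj_comp[OF bS z])
  show "bdd_above (sum (\<lambda>(e, n). (norm (S (z n e)))\<^sup>2) ` {F. F \<subseteq> B \<times> UNIV \<and> finite F})"
  proof (rule bdd_aboveI2)
    fix F assume F: "F \<in> {F. F \<subseteq> B \<times> (UNIV :: nat set) \<and> finite F}"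
    define N where "N = Suc (Max (snd ` F))"
    have fin: "finite (fst ` F)" and sub: "fst ` F \<subseteq> B" using F by auto
    have F_sub: "F \<subseteq> fst ` F \<times> {..<N}"
    proof
      fix p assume p: "p \<in> F"
      then have "snd p \<le> Max (snd ` F)" using F by (intro Max_ge) auto
      with p show "p \<in> fst ` F \<times> {..<N}"
        by (cases p) (auto simp: N_def image_iff intro: bexI[OF _ p])
    qed
    have "sum (\<lambda>(e, n). (norm (S (z n e)))\<^sup>2) F \<le> sum (\<lambda>(e, n). (norm (S (z n e)))\<^sup>2) (fst ` F \<times> {..<N})"
      by (rule sum_mono2) (use fin F_sub in auto)
    also have "\<dots> = (\<Sum>e\<in>fst ` F. \<Sum>n<N. (norm (S (z n e)))\<^sup>2)"
      by (simp add: sum.cartesian_product)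
    also have "\<dots> = (\<Sum>n<N. \<Sum>e\<in>fst ` F. (norm (S (z n e)))\<^sup>2)"
      by (rule sum.swap)
    also have "\<dots> \<le> (\<Sum>n<N. \<Sum>\<^sub>\<infinity>e\<in>B. (norm (S (z n e)))\<^sup>2)"
      by (intro sum_mono finite_sum_le_infsum hilbert_schmidt_has_sum_badj(1)[OF hs B] fin sub) auto
    also have "\<dots> = (\<Sum>\<^sub>\<infinity>f\<in>B. \<Sum>n<N. (norm (badj (z n) (badj S f)))\<^sup>2)"
      unfolding eq
    proof (induction N)
      case (Suc N)
      have "(\<lambda>f. \<Sum>n<N. (norm (badj (z n) (badj S f)))\<^sup>2) summable_on B"
        by (induction N) (auto intro: summable_on_add hs')
      with Suc show ?case by (simp add: infsum_add hs')
    qed simp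
    also have "\<dots> \<le> K"
      unfolding K_def
    proof (rule infsum_mono)
      show "(\<lambda>f. \<Sum>n<N. (norm (badj (z n) (badj S f)))\<^sup>2) summable_on B"
        by (induction N) (auto intro: summable_on_add hs')
    qed (auto intro: sumS bound)
    finally show "sum (\<lambda>(e, n). (norm (S (z n e)))\<^sup>2) F \<le> K" .
  qed
qed auto

text \<open>
  This is what permits interchanging the trace with the summation of a series of operators
  \<open>y\<^sub>n\<^sup>* T z\<^sub>n\<close>.
\<close>

lemma trace_span_family_summable:
  assumes T: "trace_span T" and y: "\<And>n. bounded_clinear (y n)" and z: "\<And>n. bounded_clinear (z n)"
    and bound: "\<And>N w. (\<Sum>n<N. (norm (badj (y n) w))\<^sup>2) \<le> (norm w)\<^sup>2"
      "\<And>N w. (\<Sum>n<N. (norm (badj (z n) w))\<^sup>2) \<le> (norm w)\<^sup>2"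
    and B: "orthonormal_basis B"
  shows "(\<lambda>(e, n). cinner (y n e) (T (z n e))) summable_on B \<times> (UNIV :: nat set)"
  using T
proof (induction rule: trace_span.induct)
  case (base R S)
  note bR = hilbert_schmidt_bounded[OF base(1)]
  show ?case
  proof (rule abs_summable_summable, rule Infinite_Sum.abs_summable_on_comparison_test')
    show "(\<lambda>p. (\<lambda>(e, n). (norm (badj R (y n e)))\<^sup>2) p + (\<lambda>(e, n). (norm (S (z n e)))\<^sup>2) p)
        summable_on B \<times> (UNIV :: nat set)"
      by (rule summable_on_add[OF hilbert_schmidt_family_summable[OF hilbert_schmidt_badj[OF base(1)] y bound(1) B]
            hilbert_schmidt_family_summable[OF base(2) z bound(2) B]])
    have "cmod (cinner (y n e) (R (S (z n e)))) \<le> (norm (badj R (y n e)))\<^sup>2 + (norm (S (z n e)))\<^sup>2" for n e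
      using cmod_cinner_le[of "badj R (y n e)" "S (z n e)"]
        mult_le_sum_of_squares[of "norm (badj R (y n e))" "norm (S (z n e))"]
      by (simp add: cinner_badj_left[OF bR])
    then show "norm ((\<lambda>(e, n). cinner (y n e) (R (S (z n e)))) p)
        \<le> (\<lambda>(e, n). (norm (badj R (y n e)))\<^sup>2) p + (\<lambda>(e, n). (norm (S (z n e)))\<^sup>2) p" for p
      by (cases p) simp
  qed
next
  case (diff S T)
  have "(\<lambda>p. (\<lambda>(e, n). cinner (y n e) (S (z n e))) p + - (\<lambda>(e, n). cinner (y n e) (T (z n e))) p)
      summable_on B \<times> (UNIV :: nat set)"
    by (rule summable_on_add[OF diff.IH(1) summable_on_uminus[THEN iffD2, OF diff.IH(2)]])
  then show ?case
    by (simp add: case_prod_unfold cinner_simps)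
qed

section \<open>The trace of \<open>x h x\<^sup>*\<close> for symmetric \<open>h\<close>\<close>

text \<open>
  In \<open>\<parallel>(1 - x\<^sup>*x) v\<parallel>\<^sup>2 = \<parallel>v\<parallel>\<^sup>2 - 2\<parallel>x v\<parallel>\<^sup>2 + \<parallel>x\<^sup>*x v\<parallel>\<^sup>2\<close> the last term is at most \<open>\<parallel>x v\<parallel>\<^sup>2\<close>.
  Iterated, the estimate bounds \<open>\<Sum> \<parallel>x (1 - x\<^sup>*x)\<^sup>n v\<parallel>\<^sup>2\<close>.
\<close>

lemma contraction_defect:
  assumes x: "bounded_clinear x" and y: "\<And>v. norm (badj x v) \<le> norm v"
  shows "(norm (v - badj x (x v)))\<^sup>2 + (norm (x v))\<^sup>2 \<le> (norm v)\<^sup>2"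
proof -
  let ?p = "badj x (x v)"
  have "v \<bullet> ?p = (norm (x v))\<^sup>2"
    unfolding Re_cinner[symmetric] cinner_badj[OF x, symmetric] cinner_self by (rule Re_complex_of_real)
  moreover have "(norm ?p)\<^sup>2 \<le> (norm (x v))\<^sup>2"
    using y by (intro power_mono) auto
  moreover have "(norm (v - ?p))\<^sup>2 = (norm v)\<^sup>2 - 2 * (v \<bullet> ?p) + (norm ?p)\<^sup>2"
    by (simp only: power2_norm_eq_inner) (simp add: inner_simps inner_commute)
  ultimately show ?thesis by linarith
qed

lemma sesquilinear_bound:
  fixes q :: "'a::complex_hilbert \<Rightarrow> 'a \<Rightarrow> complex"
  assumes left: "\<And>c v v'. q (c *\<^sub>C v') v = cnj c * q v' v"
    and right: "\<And>c v v'. q v' (c *\<^sub>C v) = c * q v' v"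
    and bound: "\<And>v v'. cmod (q v' v) \<le> L * ((norm v')\<^sup>2 + (norm v)\<^sup>2)"
  shows "cmod (q v' v) \<le> 2 * L * norm v' * norm v"
proof (cases "v = 0 \<or> v' = 0")
  case True
  have "q v' 0 = 0" "q 0 v = 0" for v v'
    using left[of 0 0 v] right[of v' 0 0] by (simp_all add: scaleC_zero_right)
  with True show ?thesis by auto
next
  case False
  define a b where "a = complex_of_real (1 / norm v)" and "b = complex_of_real (1 / norm v')"
  have "cmod (q (b *\<^sub>C v') (a *\<^sub>C v)) \<le> L * (1 + 1)"
    using bound[of "b *\<^sub>C v'" "a *\<^sub>C v"] False by (simp add: norm_scaleC a_def b_def norm_divide)
  then have "cmod (q v' v) / (norm v' * norm v) \<le> L * 2"
    by (simp add: left right a_def b_def norm_mult norm_divide field_simps)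
  then show ?thesis
    using False by (simp add: divide_le_eq mult_ac)
qed

text \<open>
  The operator \<open>h\<close> with domain \<open>D\<close> is symmetric, and \<open>\<alpha> = h x\<^sup>* x\<close> is everywhere defined. The aim is
  to give \<open>x h x\<^sup>*\<close> a meaning as a bounded sesquilinear form \<open>q\<close> with trace \<open>tr \<alpha>\<close>. With \<open>p = x\<^sup>* x\<close>
  and \<open>c = 1 - p\<close> one has \<open>h - c h c = p h + h p - p h p = \<alpha>\<^sup>* + \<alpha> - p \<alpha>\<close>, whose form is \<open>b\<close>, and hence
  formally \<open>h = \<Sum> c\<^sup>n (\<alpha> + \<alpha>\<^sup>* - p \<alpha>) c\<^sup>n\<close>. After multiplication by \<open>x\<close> and \<open>x\<^sup>*\<close> the series
  converges in the sense of the trace, as \<open>\<Sum> \<parallel>x c\<^sup>n v\<parallel>\<^sup>2 \<le> \<parallel>v\<parallel>\<^sup>2\<close> and, with \<open>d = 1 - x x\<^sup>*\<close> and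
  \<open>c\<^sup>n x\<^sup>* = x\<^sup>* d\<^sup>n\<close>, also \<open>\<Sum> \<parallel>c\<^sup>n x\<^sup>* v\<parallel>\<^sup>2 \<le> \<parallel>v\<parallel>\<^sup>2\<close>. Its trace telescopes: by cyclicity the
  \<open>n\<close>-th term has the trace \<open>tr(\<alpha> (2p - p\<^sup>2) c\<^sup>2\<^sup>n) = tr(\<alpha> c\<^sup>2\<^sup>n) - tr(\<alpha> c\<^sup>2\<^sup>n\<^sup>+\<^sup>2)\<close>, and
  \<open>tr(\<alpha> c\<^sup>2\<^sup>n)\<close> tends to \<open>0\<close> since \<open>\<alpha>\<close> vanishes on the kernel of \<open>x\<close>.
\<close>

locale symmetrizable =
  fixes D :: "'a::complex_hilbert set" and h x \<alpha> :: "'a \<Rightarrow> 'a"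
  assumes D_diff: "u \<in> D \<Longrightarrow> v \<in> D \<Longrightarrow> u - v \<in> D"
    and h_diff: "u \<in> D \<Longrightarrow> v \<in> D \<Longrightarrow> h (u - v) = h u - h v"
    and h_sym: "u \<in> D \<Longrightarrow> v \<in> D \<Longrightarrow> cinner (h u) v = cinner u (h v)"
    and x: "bounded_clinear x" and x_le: "norm (x v) \<le> norm v"
    and \<alpha>: "trace_span \<alpha>"
    and D_p: "badj x (x v) \<in> D" and h_p: "h (badj x (x v)) = \<alpha> v"
begin

abbreviation "y \<equiv> badj x"
abbreviation "K \<equiv> onorm \<alpha>"

definition p :: "'a \<Rightarrow> 'a" where "p v = y (x v)"
definition c :: "'a \<Rightarrow> 'a" where "c v = v - p v"
definition d :: "'a \<Rightarrow> 'a" where "d v = v - x (y v)"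
definition b :: "'a \<Rightarrow> 'a \<Rightarrow> complex"
  where "b u v = cinner u (\<alpha> v) + cinner (\<alpha> u) v - cinner (p u) (\<alpha> v)"
definition q :: "'a \<Rightarrow> 'a \<Rightarrow> complex"
  where "q v' v = (\<Sum>n. b ((c ^^ n) (y v')) ((c ^^ n) (y v)))"

lemmas \<alpha>_bounded = trace_span_bounded[OF \<alpha>]
lemmas y_bounded = bounded_clinear_badj[OF x]
lemmas x_y = cinner_badj[OF x]
lemmas y_x = cinner_badj_left[OF x]
lemmas \<alpha>_norm = bounded_clinear_norm[OF \<alpha>_bounded]

lemma K_nonneg: "0 \<le> K"
  by (rule onorm_pos_le[OF bounded_clinearD(6)[OF \<alpha>_bounded]])

lemma y_le: "norm (y v) \<le> norm v"
proof -
  have "norm (y v) * norm (y v) = cmod (cinner (y v) (y v))"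
    by (simp add: cinner_self norm_power power2_eq_square del: of_real_power) (simp add: norm_mult)
  also have "\<dots> = cmod (cinner v (x (y v)))" by (simp add: y_x)
  also have "\<dots> \<le> norm v * norm (y v)"
    using cmod_cinner_le[of v "x (y v)"] mult_left_mono[OF x_le[of "y v"], of "norm v"] by simp
  finally show ?thesis
    by (cases "y v = 0") auto
qed

lemma p_bounded: "bounded_clinear p"
  unfolding p_def by (rule bounded_clinear_comp[OF y_bounded x])

lemma c_bounded: "bounded_clinear c"
  unfolding c_def by (rule bounded_clinear_diff[OF bounded_clinear_id p_bounded])

lemma cn_bounded: "bounded_clinear (c ^^ n)"
proof (induction n)
  case (Suc n)
  then show ?case using bounded_clinear_comp[OF c_bounded Suc] by (simp add: comp_def)
qed (simp add: id_def bounded_clinear_id)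

lemma p_sym: "cinner (p u) v = cinner u (p v)"
  by (simp add: p_def x_y[symmetric] y_x)

lemma c_sym: "cinner (c u) v = cinner u (c v)"
  by (simp add: c_def cinner_simps p_sym)

lemma cn_sym: "cinner ((c ^^ n) u) v = cinner u ((c ^^ n) v)"
  by (induction n arbitrary: u v) (simp_all add: c_sym funpow_swap1)

lemma cn_p: "(c ^^ n) (p v) = p ((c ^^ n) v)"
proof (induction n)
  case (Suc n)
  then show ?case by (simp add: c_def bounded_clinearD(2)[OF p_bounded])
qed simp

lemma p_le: "norm (p v) \<le> norm v"
  unfolding p_def using y_le x_le order_trans by blast

lemma sum_x_cn: "(\<Sum>n<N. (norm (x ((c ^^ n) v)))\<^sup>2) + (norm ((c ^^ N) v))\<^sup>2 \<le> (norm v)\<^sup>2"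
proof (induction N)
  case (Suc N)
  have "(norm (c ((c ^^ N) v)))\<^sup>2 + (norm (x ((c ^^ N) v)))\<^sup>2 \<le> (norm ((c ^^ N) v))\<^sup>2"
    unfolding c_def p_def by (rule contraction_defect[OF x y_le])
  with Suc show ?case by simp
qed simp

lemma sum_x_cn': "(\<Sum>n<N. (norm (x ((c ^^ n) v)))\<^sup>2) \<le> (norm v)\<^sup>2"
  using sum_x_cn[of v N] zero_le_power2[of "norm ((c ^^ N) v)"] by linarith

lemma cn_le: "norm ((c ^^ N) v) \<le> norm v"
proof -
  have "0 \<le> (\<Sum>n<N. (norm (x ((c ^^ n) v)))\<^sup>2)" by (intro sum_nonneg) auto
  with sum_x_cn[of v N] have "(norm ((c ^^ N) v))\<^sup>2 \<le> (norm v)\<^sup>2" by linarith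
  then show ?thesis by (simp add: power2_le_iff_abs_le)
qed

lemma y_dn: "y ((d ^^ n) v) = (c ^^ n) (y v)"
proof (induction n)
  case (Suc n)
  then show ?case by (simp add: d_def c_def p_def bounded_clinearD(2)[OF y_bounded])
qed simp

lemma sum_cn_y: "(\<Sum>n<N. (norm ((c ^^ n) (y v)))\<^sup>2) \<le> (norm v)\<^sup>2"
proof -
  have "(\<Sum>n<N. (norm ((c ^^ n) (y v)))\<^sup>2) + (norm ((d ^^ N) v))\<^sup>2 \<le> (norm v)\<^sup>2"
  proof (induction N)
    case (Suc N)
    have "(norm (d ((d ^^ N) v)))\<^sup>2 + (norm (y ((d ^^ N) v)))\<^sup>2 \<le> (norm ((d ^^ N) v))\<^sup>2"
      using contraction_defect[OF y_bounded, of "(d ^^ N) v"] x_le by (simp add: badj_badj[OF x] d_def)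
    with Suc show ?case by (simp add: y_dn)
  qed simp
  then show ?thesis using zero_le_power2[of "norm ((d ^^ N) v)"] by linarith
qed

lemma summable_cn_y: "summable (\<lambda>n. (norm ((c ^^ n) (y v)))\<^sup>2)"
  and suminf_cn_y: "(\<Sum>n. (norm ((c ^^ n) (y v)))\<^sup>2) \<le> (norm v)\<^sup>2"
proof -
  show *: "summable (\<lambda>n. (norm ((c ^^ n) (y v)))\<^sup>2)"
    by (rule summableI_nonneg_bounded[OF _ sum_cn_y]) simp
  show "(\<Sum>n. (norm ((c ^^ n) (y v)))\<^sup>2) \<le> (norm v)\<^sup>2"
    by (rule suminf_le_const[OF * sum_cn_y])
qed

lemma cn_y_tendsto: "(\<lambda>n. (c ^^ n) (y v)) \<longlonglongrightarrow> 0"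
proof -
  have "(\<lambda>n. sqrt ((norm ((c ^^ n) (y v)))\<^sup>2)) \<longlonglongrightarrow> sqrt 0"
    by (intro tendsto_real_sqrt summable_LIMSEQ_zero summable_cn_y)
  then show ?thesis by (simp add: tendsto_norm_zero_iff)
qed

lemma b_bound: "cmod (b u v) \<le> 3 * K * ((norm u)\<^sup>2 + (norm v)\<^sup>2)"
proof -
  have 1: "cmod (cinner u' (\<alpha> v')) \<le> K * (norm u' * norm v')" for u' v'
    using cmod_cinner_le[of u' "\<alpha> v'"] mult_left_mono[OF \<alpha>_norm[of v'], of "norm u'"] by (simp add: mult_ac)
  have "cmod (b u v) \<le> cmod (cinner u (\<alpha> v)) + cmod (cinner (\<alpha> u) v) + cmod (cinner (p u) (\<alpha> v))"
    unfolding b_def using norm_triangle_ineq norm_triangle_ineq4 by (meson add_right_mono order_trans)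
  moreover have "cmod (cinner (\<alpha> u) v) \<le> K * (norm u * norm v)"
    using 1[of v u] cmod_cinner_commute[of v "\<alpha> u"] by (simp add: mult_ac)
  moreover have "cmod (cinner (p u) (\<alpha> v)) \<le> K * (norm u * norm v)"
    using 1[of "p u" v] mult_left_mono[OF mult_right_mono[OF p_le[of u], of "norm v"] K_nonneg] by simp
  ultimately have "cmod (b u v) \<le> 3 * (K * (norm u * norm v))"
    using 1[of u v] by linarith
  also have "\<dots> \<le> 3 * (K * ((norm u)\<^sup>2 + (norm v)\<^sup>2))"
    by (intro mult_left_mono K_nonneg mult_le_sum_of_squares) auto
  finally show ?thesis by (simp add: mult.assoc)
qed

lemma summable_b:
  "summable (\<lambda>n. b ((c ^^ n) (y v')) ((c ^^ n) (y v)))"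
  "cmod (q v' v) \<le> 3 * K * ((norm v')\<^sup>2 + (norm v)\<^sup>2)"
proof -
  let ?g = "\<lambda>n. 3 * K * ((norm ((c ^^ n) (y v')))\<^sup>2 + (norm ((c ^^ n) (y v)))\<^sup>2)"
  have g: "summable ?g"
    by (intro summable_mult summable_add summable_cn_y)
  show "summable (\<lambda>n. b ((c ^^ n) (y v')) ((c ^^ n) (y v)))"
    by (rule summable_comparison_test'[OF g b_bound])
  have "cmod (q v' v) \<le> suminf ?g"
    unfolding q_def by (rule norm_suminf_le[OF b_bound g])
  also have "\<dots> = 3 * K * ((\<Sum>n. (norm ((c ^^ n) (y v')))\<^sup>2) + (\<Sum>n. (norm ((c ^^ n) (y v)))\<^sup>2))"
    by (simp add: suminf_mult suminf_add summable_cn_y summable_add)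
  also have "\<dots> \<le> 3 * K * ((norm v')\<^sup>2 + (norm v)\<^sup>2)"
    by (intro mult_left_mono add_mono suminf_cn_y) (simp add: K_nonneg)
  finally show "cmod (q v' v) \<le> 3 * K * ((norm v')\<^sup>2 + (norm v)\<^sup>2)" .
qed

lemmas linear_simps' =
  bounded_clinearD(1,4)[OF \<alpha>_bounded] bounded_clinearD(1,4)[OF p_bounded] bounded_clinearD(1,4)[OF y_bounded]
  bounded_clinearD(1,4)[OF cn_bounded]

lemma q_linear:
  "q (u + v') v = q u v + q v' v" "q v' (u + v) = q v' u + q v' v"
  "q (k *\<^sub>C v') v = cnj k * q v' v" "q v' (k *\<^sub>C v) = k * q v' v"
proof -
  have "b (u + v') v = b u v + b v' v" "b v' (u + v) = b v' u + b v' v"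
    "b (k *\<^sub>C v') v = cnj k * b v' v" "b v' (k *\<^sub>C v) = k * b v' v" for u v v' k
    unfolding b_def linear_simps'
    by (simp_all add: cinner_simps cinner_scaleC_left cinner_scaleC_right algebra_simps)
  then show "q (u + v') v = q u v + q v' v" "q v' (u + v) = q v' u + q v' v"
    "q (k *\<^sub>C v') v = cnj k * q v' v" "q v' (k *\<^sub>C v) = k * q v' v"
    unfolding q_def linear_simps' by (simp_all add: suminf_add suminf_mult summable_b)
qed

lemma q_bound: "cmod (q v' v) \<le> 6 * K * norm v' * norm v"
  using sesquilinear_bound[of q, OF q_linear(3,4) summable_b(2)] by simp

lemma continuous_q: "continuous_on UNIV (q v')"
proof -
  have "bounded_linear (q v')"
  proof (rule bounded_linear_intro[where K = "6 * K * norm v'"])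
    show "q v' (r *\<^sub>R v) = r *\<^sub>R q v' v" for r v
      using q_linear(4)[of v' "complex_of_real r" v] by (simp only: scaleC_of_real scaleR_conv_of_real)
    show "norm (q v' v) \<le> norm v * (6 * K * norm v')" for v
      using q_bound[of v' v] by (simp add: mult_ac)
  qed (rule q_linear)
  then show ?thesis by (rule linear_continuous_on)
qed

lemma c_D: "u \<in> D \<Longrightarrow> c u \<in> D" and h_c: "u \<in> D \<Longrightarrow> h (c u) = h u - \<alpha> u"
  using D_p h_p by (auto simp: c_def p_def D_diff h_diff)

lemma cn_D: "u \<in> D \<Longrightarrow> (c ^^ n) u \<in> D"
  by (induction n) (auto simp: c_D)

lemma h_p_left: "u \<in> D \<Longrightarrow> cinner (p v) (h u) = cinner (\<alpha> v) u"
  using h_sym[OF D_p[of v]] by (simp add: p_def h_p)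

text \<open>The form \<open>b\<close> is that of \<open>h - c h c\<close>.\<close>

lemma telescope:
  assumes "u' \<in> D" "u \<in> D"
  shows "(\<Sum>n<N. b ((c ^^ n) u') ((c ^^ n) u)) = cinner u' (h u) - cinner ((c ^^ N) u') (h ((c ^^ N) u))"
proof (induction N)
  case (Suc N)
  have "b w' w = cinner w' (h w) - cinner (c w') (h (c w))" if "w \<in> D" "w' \<in> D" for w w'
    using that by (simp add: h_c) (simp add: b_def c_def cinner_simps h_p_left)
  from this[OF cn_D[OF assms(2)] cn_D[OF assms(1)]] Suc show ?case by simp
qed simp

text \<open>
  On the range of \<open>x\<close> the remainder of the telescoping sum tends to zero, and on its orthogonal
  complement both sides vanish.
\<close>

lemma q_eq:
  assumes v: "y v \<in> D"
  shows "cinner v' (x (h (y v))) = q v' v"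
proof -
  have range: "q (x w) v = cinner (x w) (x (h (y v)))" for w
  proof -
    have pw: "p w \<in> D" by (simp add: p_def D_p)
    have "cmod (cinner ((c ^^ N) (p w)) (h ((c ^^ N) (y v)))) \<le> K * norm w * norm ((c ^^ N) (y v))" for N
    proof -
      have "cmod (cinner ((c ^^ N) (p w)) (h ((c ^^ N) (y v)))) = cmod (cinner (\<alpha> ((c ^^ N) w)) ((c ^^ N) (y v)))"
        unfolding cn_p by (simp add: h_p_left cn_D v)
      also have "\<dots> \<le> norm (\<alpha> ((c ^^ N) w)) * norm ((c ^^ N) (y v))" by (rule cmod_cinner_le)
      also have "\<dots> \<le> K * norm w * norm ((c ^^ N) (y v))"
        using \<alpha>_norm[of "(c ^^ N) w"] mult_left_mono[OF cn_le[of N w] K_nonneg] by (intro mult_right_mono) auto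
      finally show ?thesis .
    qed
    moreover have "(\<lambda>N. K * norm w * norm ((c ^^ N) (y v))) \<longlonglongrightarrow> 0"
      by (intro tendsto_mult_right_zero tendsto_norm_zero cn_y_tendsto)
    ultimately have "(\<lambda>N. cinner ((c ^^ N) (p w)) (h ((c ^^ N) (y v)))) \<longlonglongrightarrow> 0"
      by (rule Lim_null_comparison[OF always_eventually, OF allI])
    then have "(\<lambda>N. cinner (p w) (h (y v)) - cinner ((c ^^ N) (p w)) (h ((c ^^ N) (y v)))) \<longlonglongrightarrow> cinner (p w) (h (y v)) - 0"
      by (intro tendsto_diff tendsto_const)
    then have "(\<lambda>n. b ((c ^^ n) (y (x w))) ((c ^^ n) (y v))) sums cinner (p w) (h (y v))"
      unfolding sums_def telescope[OF pw v, symmetric] by (simp add: p_def)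
    then have "q (x w) v = cinner (p w) (h (y v))"
      unfolding q_def by (rule sums_unique[symmetric])
    then show ?thesis by (simp add: p_def y_x)
  qed
  define r where "r v' = cinner v' (x (h (y v))) - q v' v" for v'
  obtain z where z: "\<And>v'. cnj (r v') = cinner z v'"
  proof (rule riesz[of "\<lambda>v'. cnj (r v')"])
    show "cmod (cnj (r v')) \<le> norm v' * (norm (x (h (y v))) + 6 * K * norm v)" for v'
    proof -
      have "cmod (r v') \<le> norm v' * norm (x (h (y v))) + 6 * K * norm v' * norm v"
        unfolding r_def using norm_triangle_ineq4[of "cinner v' (x (h (y v)))" "q v' v"]
          cmod_cinner_le[of v' "x (h (y v))"] q_bound[of v' v] by linarith
      then show ?thesis by (simp only: complex_mod_cnj) (simp add: algebra_simps)
    qed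
    show "cnj (r (u + v')) = cnj (r u) + cnj (r v')" for u v'
      unfolding r_def cinner_add_left q_linear by simp
    show "cnj (r (k *\<^sub>C v')) = k * cnj (r v')" for k v'
      unfolding r_def cinner_scaleC_left q_linear by (simp add: right_diff_distrib)
  qed blast
  have "cinner (x w) z = 0" for w
    using z[of "x w"] range[of w] cinner_eq_0_commute[of z "x w"] by (simp add: r_def)
  then have "cinner w (y z) = cinner w 0" for w
    by (simp add: x_y[symmetric])
  then have "y z = 0" by (rule cinner_ext)
  then have "r z = 0"
    unfolding r_def y_x[symmetric] q_def
    by (simp add: b_def bounded_clinearD(3)[OF cn_bounded] bounded_clinearD(3)[OF \<alpha>_bounded]
        bounded_clinearD(3)[OF p_bounded])
  then have "z = 0"
    using z[of z] by (simp add: cinner_self_eq_0)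
  then have "cnj (r v') = 0" using z[of v'] by simp
  then show ?thesis by (simp add: r_def)
qed

definition \<tau> :: "('a \<Rightarrow> 'a) \<Rightarrow> complex"
  where "\<tau> u = trace_bounded (\<lambda>v. \<alpha> (u v))"

lemma \<tau>_diff: "bounded_clinear u \<Longrightarrow> bounded_clinear w \<Longrightarrow> \<tau> (\<lambda>v. u v - w v) = \<tau> u - \<tau> w"
  unfolding \<tau>_def by (simp add: bounded_clinearD(2)[OF \<alpha>_bounded] trace_bounded_diff trace_span_comp(2)[OF _ \<alpha>])

lemma has_sum_\<tau>:
  assumes u: "bounded_clinear u" and w: "bounded_clinear w" and B: "orthonormal_basis B"
    and adj: "\<And>v v'. cinner (u v) v' = cinner v (u' v')" and u': "bounded_clinear u'"
  shows "((\<lambda>e. cinner (u e) (\<alpha> (w e))) has_sum \<tau> (\<lambda>v. w (u' v))) B"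
proof -
  have ts: "trace_span (\<lambda>v. \<alpha> (w v))" by (rule trace_span_comp(2)[OF w \<alpha>])
  have "trace_bounded (\<lambda>v. u' (\<alpha> (w v))) = \<tau> (\<lambda>v. w (u' v))"
    unfolding \<tau>_def by (rule trace_span_comp(3)[OF u' ts])
  with trace_span_has_sum[OF trace_span_comp(1)[OF u' ts] B] show ?thesis
    by (simp add: adj)
qed

lemma cn_y_adj: "cinner ((c ^^ n) (y v)) v' = cinner v (x ((c ^^ n) v'))"
  by (simp add: cn_sym y_x)

lemma x_cn_bounded: "bounded_clinear (\<lambda>v. x ((c ^^ n) v))"
  by (rule bounded_clinear_comp[OF x cn_bounded])

lemma cn_y_bounded: "bounded_clinear (\<lambda>v. (c ^^ n) (y v))"
  by (rule bounded_clinear_comp[OF cn_bounded y_bounded])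

lemma cnn_bounded: "bounded_clinear (\<lambda>v. (c ^^ n) ((c ^^ n) v))"
  by (rule bounded_clinear_comp[OF cn_bounded cn_bounded])

lemma cnnp_bounded: "bounded_clinear (\<lambda>v. (c ^^ n) ((c ^^ n) (p v)))"
  by (rule bounded_clinear_comp[OF cnn_bounded p_bounded])

lemma cnnpp_bounded: "bounded_clinear (\<lambda>v. (c ^^ n) ((c ^^ n) (p (p v))))"
  by (rule bounded_clinear_comp[OF cnnp_bounded p_bounded])

text \<open>By cyclicity the number is the trace of \<open>c\<^sup>n p \<alpha> c\<^sup>n\<close>, and \<open>p \<alpha> = p h p\<close> is symmetric.\<close>

lemma \<tau>_real:
  assumes B: "orthonormal_basis (B :: 'a set)"
  shows "cnj (\<tau> (\<lambda>v. (c ^^ n) ((c ^^ n) (p v)))) = \<tau> (\<lambda>v. (c ^^ n) ((c ^^ n) (p v)))"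
proof -
  have sym: "cnj (cinner (p u) (\<alpha> u)) = cinner (p u) (\<alpha> u)" for u
  proof -
    have "cinner (p u) (\<alpha> u) = cinner (\<alpha> u) (p u)"
      using h_p_left[of "p u" u] D_p[of u] h_p[of u] by (simp add: p_def)
    then show ?thesis by (metis cinner_commute)
  qed
  have adj: "cinner (p ((c ^^ n) v)) v' = cinner v ((c ^^ n) (p v'))" for v v'
    by (simp add: p_sym cn_sym)
  have s: "((\<lambda>e. cinner (p ((c ^^ n) e)) (\<alpha> ((c ^^ n) e))) has_sum \<tau> (\<lambda>v. (c ^^ n) ((c ^^ n) (p v)))) B"
    by (rule has_sum_\<tau>[OF bounded_clinear_comp[OF p_bounded cn_bounded] cn_bounded B adj
          bounded_clinear_comp[OF cn_bounded p_bounded]])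
  then have "((\<lambda>e. cnj (cinner (p ((c ^^ n) e)) (\<alpha> ((c ^^ n) e)))) has_sum cnj (\<tau> (\<lambda>v. (c ^^ n) ((c ^^ n) (p v))))) B"
    by (simp only: has_sum_cnj_iff)
  then have "((\<lambda>e. cinner (p ((c ^^ n) e)) (\<alpha> ((c ^^ n) e))) has_sum cnj (\<tau> (\<lambda>v. (c ^^ n) ((c ^^ n) (p v))))) B"
    unfolding sym .
  from this s show ?thesis by (rule has_sum_unique)
qed

lemma has_sum_b:
  assumes B: "orthonormal_basis B"
  shows "((\<lambda>e. b ((c ^^ n) (y e)) ((c ^^ n) (y e))) has_sum
    (\<tau> (\<lambda>v. (c ^^ n) ((c ^^ n) v)) - \<tau> (\<lambda>v. (c ^^ Suc n) ((c ^^ Suc n) v)))) B"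
proof -
  let ?Y = "\<lambda>v. (c ^^ n) (y v)"
  let ?t1 = "\<tau> (\<lambda>v. (c ^^ n) ((c ^^ n) (p v)))" and ?t2 = "\<tau> (\<lambda>v. (c ^^ n) ((c ^^ n) (p (p v))))"
  have 1: "((\<lambda>e. cinner (?Y e) (\<alpha> (?Y e))) has_sum ?t1) B"
    using has_sum_\<tau>[OF cn_y_bounded cn_y_bounded B cn_y_adj x_cn_bounded, of n n]
    by (simp add: p_def[symmetric] cn_p)
  then have "((\<lambda>e. cnj (cinner (?Y e) (\<alpha> (?Y e)))) has_sum cnj ?t1) B"
    by (simp only: has_sum_cnj_iff)
  then have 2: "((\<lambda>e. cinner (\<alpha> (?Y e)) (?Y e)) has_sum ?t1) B"
    by (simp only: cinner_commute[symmetric] \<tau>_real[OF B])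
  have adj: "cinner (p (?Y v)) v' = cinner v (x ((c ^^ n) (p v')))" for v v'
    by (simp add: p_sym cn_y_adj)
  have 3: "((\<lambda>e. cinner (p (?Y e)) (\<alpha> (?Y e))) has_sum ?t2) B"
    using has_sum_\<tau>[OF bounded_clinear_comp[OF p_bounded cn_y_bounded] cn_y_bounded B adj
        bounded_clinear_comp[OF x_cn_bounded p_bounded], of n]
    by (simp add: p_def[symmetric] cn_p)
  have step: "(c ^^ Suc n) ((c ^^ Suc n) v)
      = (c ^^ n) ((c ^^ n) v) - (c ^^ n) ((c ^^ n) (p v)) - ((c ^^ n) ((c ^^ n) (p v)) - (c ^^ n) ((c ^^ n) (p (p v))))" for v
  proof -
    have "(c ^^ Suc n) ((c ^^ Suc n) v) = (c ^^ n) ((c ^^ n) (c (c v)))"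
      by (simp add: funpow_swap1)
    also have "c (c v) = v - p v - (p v - p (p v))"
      by (simp add: c_def bounded_clinearD(2)[OF p_bounded])
    finally show ?thesis by (simp only: bounded_clinearD(2)[OF cn_bounded])
  qed
  have "\<tau> (\<lambda>v. (c ^^ Suc n) ((c ^^ Suc n) v)) = \<tau> (\<lambda>v. (c ^^ n) ((c ^^ n) v)) - ?t1 - (?t1 - ?t2)"
    unfolding step
    by (simp only: \<tau>_diff[OF bounded_clinear_diff[OF cnn_bounded cnnp_bounded] bounded_clinear_diff[OF cnnp_bounded cnnpp_bounded]]
        \<tau>_diff[OF cnn_bounded cnnp_bounded] \<tau>_diff[OF cnnp_bounded cnnpp_bounded])
  moreover have "((\<lambda>e. b (?Y e) (?Y e)) has_sum (?t1 + ?t1 + - ?t2)) B"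
    unfolding b_def diff_conv_add_uminus
    by (rule has_sum_add[OF has_sum_add[OF 1 2] has_sum_uminusI[OF 3]])
  ultimately show ?thesis by simp
qed

lemma cn_add: "cinner ((c ^^ m) v) ((c ^^ n) v) = cinner v ((c ^^ (m + n)) v)"
  by (simp add: cn_sym funpow_add)

text \<open>
  As \<open>0 \<le> c \<le> 1\<close>, the numbers \<open>\<langle>v, c\<^sup>2\<^sup>n v\<rangle> = \<parallel>c\<^sup>n v\<parallel>\<^sup>2\<close> decrease to a limit, and
  \<open>\<parallel>c\<^sup>2\<^sup>m v - c\<^sup>2\<^sup>n v\<parallel>\<^sup>2\<close> is a combination of them. The limit of \<open>c\<^sup>2\<^sup>n\<close> is the projector onto the kernel
  of \<open>x\<close>.
\<close>

lemma cn_limit: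
  obtains z where "bounded_clinear z" "\<And>v. (\<lambda>n. (c ^^ n) ((c ^^ n) v)) \<longlonglongrightarrow> z v" "\<And>v. x (z v) = 0"
proof -
  have conv: "convergent (\<lambda>n. (c ^^ n) ((c ^^ n) v))" for v
  proof -
    define a where "a n = (norm ((c ^^ n) v))\<^sup>2" for n
    have "decseq a"
      unfolding a_def decseq_Suc_iff using cn_le[of 1 "(c ^^ _) v"] by (auto intro!: power_mono)
    then obtain L where L: "a \<longlonglongrightarrow> L"
      using decseq_convergent[of a 0] by (auto simp: a_def)
    have inner: "(c ^^ (2 * m)) v \<bullet> (c ^^ (2 * n)) v = a (m + n)" for m n
    proof -
      have "cinner ((c ^^ (2 * m)) v) ((c ^^ (2 * n)) v) = cinner ((c ^^ (m + n)) v) ((c ^^ (m + n)) v)"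
        unfolding cn_add by (rule arg_cong[where f = "\<lambda>k. cinner v ((c ^^ k) v)"]) simp
      then show ?thesis
        unfolding a_def Re_cinner[symmetric] cinner_self by simp
    qed
    have "Cauchy (\<lambda>n. (c ^^ (2 * n)) v)"
    proof (rule metric_CauchyI)
      fix r :: real assume r: "0 < r"
      then obtain N where N: "\<And>n. n \<ge> N \<Longrightarrow> \<bar>a n - L\<bar> < r\<^sup>2 / 4"
        using LIMSEQ_D[OF L, of "r\<^sup>2 / 4"] by auto
      have "dist ((c ^^ (2 * m)) v) ((c ^^ (2 * n)) v) < r" if "m \<ge> N" "n \<ge> N" for m n
      proof -
        have "(norm ((c ^^ (2 * m)) v - (c ^^ (2 * n)) v))\<^sup>2 = a (m + m) + a (n + n) - 2 * a (m + n)"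
          by (simp only: power2_norm_eq_inner inner_diff_left inner_diff_right inner) (simp add: add.commute)
        also have "\<dots> < r\<^sup>2"
        proof -
          have "\<bar>a (m + m) - L\<bar> < r\<^sup>2 / 4" "\<bar>a (n + n) - L\<bar> < r\<^sup>2 / 4" "\<bar>a (m + n) - L\<bar> < r\<^sup>2 / 4"
            by (rule N, use that in linarith)+
          then show ?thesis by (simp only: abs_less_iff) linarith
        qed
        finally show ?thesis
          using r by (simp add: dist_norm power_less_imp_less_base)
      qed
      then show "\<exists>M. \<forall>m\<ge>M. \<forall>n\<ge>M. dist ((c ^^ (2 * m)) v) ((c ^^ (2 * n)) v) < r" by blast
    qed
    then show ?thesis
      by (simp add: Cauchy_convergent_iff mult_2 funpow_add)
  qed
  define z where "z v = lim (\<lambda>n. (c ^^ n) ((c ^^ n) v))" for v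
  have z: "(\<lambda>n. (c ^^ n) ((c ^^ n) v)) \<longlonglongrightarrow> z v" for v
    unfolding z_def using conv by (simp add: convergent_LIMSEQ_iff)
  have "bounded_clinear z"
  proof (rule bounded_clinearI[where K = 1])
    show "z (u + v) = z u + z v" for u v
      using z[of "u + v"] tendsto_add[OF z[of u] z[of v]]
      by (simp add: bounded_clinearD(1)[OF cn_bounded] LIMSEQ_unique)
    show "z (k *\<^sub>C v) = k *\<^sub>C z v" for k v
    proof -
      have "bounded_clinear (\<lambda>v::'a. k *\<^sub>C v)"
        by (rule bounded_clinearI[where K = "cmod k"])
          (simp_all add: scaleC_add_right scaleC_scaleC norm_scaleC mult.commute)
      from bounded_clinear_tendsto[OF this z[of v]] z[of "k *\<^sub>C v"] show ?thesis
        by (simp add: bounded_clinearD(4)[OF cn_bounded] LIMSEQ_unique)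
    qed
    show "norm (z v) \<le> norm v * 1" for v
      by (rule LIMSEQ_le_const2[OF tendsto_norm[OF z]]) (auto intro: order_trans[OF cn_le cn_le])
  qed
  moreover have "x (z v) = 0" for v
  proof -
    have "(\<lambda>n. (norm (x ((c ^^ n) v)))\<^sup>2) \<longlonglongrightarrow> 0"
      by (rule summable_LIMSEQ_zero, rule summableI_nonneg_bounded[OF _ sum_x_cn']) simp
    then have "(\<lambda>n. sqrt ((norm (x ((c ^^ n) v)))\<^sup>2)) \<longlonglongrightarrow> sqrt 0"
      by (rule tendsto_real_sqrt)
    then have "(\<lambda>n. x ((c ^^ n) v)) \<longlonglongrightarrow> 0"
      by (simp add: tendsto_norm_zero_iff)
    moreover have "strict_mono (\<lambda>n::nat. n + n)"
      by (simp add: strict_mono_def)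
    ultimately have "(\<lambda>n. x ((c ^^ (n + n)) v)) \<longlonglongrightarrow> 0"
      using LIMSEQ_subseq_LIMSEQ[of "\<lambda>n. x ((c ^^ n) v)" 0 "\<lambda>n. n + n"] by (simp add: comp_def)
    moreover have "(\<lambda>n. x ((c ^^ (n + n)) v)) \<longlonglongrightarrow> x (z v)"
      using bounded_clinear_tendsto[OF x z[of v]] by (simp add: funpow_add)
    ultimately show ?thesis using LIMSEQ_unique by blast
  qed
  ultimately show ?thesis using that z by blast
qed

lemma \<tau>_tendsto: "(\<lambda>n. \<tau> (\<lambda>v. (c ^^ n) ((c ^^ n) v))) \<longlonglongrightarrow> 0"
proof -
  obtain z where z: "bounded_clinear z" "\<And>v. (\<lambda>n. (c ^^ n) ((c ^^ n) v)) \<longlonglongrightarrow> z v" "\<And>v. x (z v) = 0"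
    by (rule cn_limit) blast
  have "\<alpha> (z v) = \<alpha> 0" for v
    using h_p[of "z v"] h_p[of 0] z(3) by (simp add: bounded_clinearD(3)[OF x])
  then have "\<tau> z = trace_bounded (\<lambda>v. 0 :: 'a)"
    by (simp add: \<tau>_def bounded_clinearD(3)[OF \<alpha>_bounded])
  also have "\<dots> = 0" by (simp add: trace_bounded_def)
  finally have "\<tau> z = 0" .
  with trace_bounded_tendsto[OF \<alpha> cnn_bounded z(1,2)] show ?thesis
    unfolding \<tau>_def[symmetric] using order_trans[OF cn_le cn_le] by auto
qed

lemma summable_b_basis:
  assumes B: "orthonormal_basis B"
  shows "(\<lambda>(e, n). b ((c ^^ n) (y e)) ((c ^^ n) (y e))) summable_on B \<times> UNIV"
proof -
  let ?Y = "\<lambda>n v. (c ^^ n) (y v)"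
  have Y': "badj (?Y n) = (\<lambda>v. x ((c ^^ n) v))" for n
    by (rule ext, rule cinner_ext) (simp add: cinner_badj[OF cn_y_bounded, symmetric] cn_y_adj)
  have pY: "bounded_clinear (\<lambda>v. p (?Y n v))" for n
    by (rule bounded_clinear_comp[OF p_bounded cn_y_bounded])
  have pY': "badj (\<lambda>v. p (?Y n v)) = (\<lambda>v. x ((c ^^ n) (p v)))" for n
    by (rule ext, rule cinner_ext) (simp add: cinner_badj[OF pY, symmetric] p_sym cn_y_adj)
  have bound: "(\<Sum>n<N. (norm (badj (?Y n) w))\<^sup>2) \<le> (norm w)\<^sup>2" for N w
    unfolding Y' by (rule sum_x_cn')
  have "(\<Sum>n<N. (norm (badj (\<lambda>v. p (?Y n v)) w))\<^sup>2) \<le> (norm w)\<^sup>2" for N w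
    unfolding pY' by (rule order_trans[OF sum_x_cn' power_mono[OF p_le]]) simp
  note 3 = trace_span_family_summable[OF \<alpha> pY cn_y_bounded this bound B]
  note 1 = trace_span_family_summable[OF \<alpha> cn_y_bounded cn_y_bounded bound bound B]
  have 2: "(\<lambda>(e, n). cinner (\<alpha> (?Y n e)) (?Y n e)) summable_on B \<times> UNIV"
  proof -
    have "(\<lambda>(e, n). cinner (\<alpha> (?Y n e)) (?Y n e)) = (\<lambda>q. cnj ((\<lambda>(e, n). cinner (?Y n e) (\<alpha> (?Y n e))) q))"
      by (auto simp: fun_eq_iff intro: cinner_commute)
    with 1 show ?thesis by (simp only: summable_on_cnj_iff)
  qed
  show ?thesis
    using summable_on_add[OF summable_on_add[OF 1 2] summable_on_uminus[THEN iffD2, OF 3]]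
    by (simp add: b_def case_prod_unfold)
qed

lemma has_sum_q:
  assumes B: "orthonormal_basis B"
  shows "((\<lambda>e. q e e) has_sum trace_bounded \<alpha>) B"
proof -
  let ?f = "\<lambda>(e, n). b ((c ^^ n) (y e)) ((c ^^ n) (y e))"
  let ?t = "\<lambda>n. \<tau> (\<lambda>v. (c ^^ n) ((c ^^ n) v))"
  obtain S where S: "(?f has_sum S) (B \<times> UNIV)"
    using summable_b_basis[OF B] by (auto simp: summable_on_def)
  have "((\<lambda>n. ?t n - ?t (Suc n)) has_sum S) UNIV"
  proof (rule has_sum_SigmaD)
    show "((\<lambda>(n, e). ?f (e, n)) has_sum S) (UNIV \<times> B)"
      using S by (subst (asm) has_sum_swap)
    show "((\<lambda>e. (\<lambda>(n, e). ?f (e, n)) (n, e)) has_sum ?t n - ?t (Suc n)) B" for n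
      using has_sum_b[OF B, of n] by simp
  qed
  then have "(\<lambda>n. ?t n - ?t (Suc n)) sums S" by (rule has_sum_imp_sums)
  moreover have "(\<lambda>n. ?t n - ?t (Suc n)) sums (?t 0 - 0)"
    by (rule telescope_sums'[OF \<tau>_tendsto])
  ultimately have "S = ?t 0" using sums_unique2 by fastforce
  then have S_eq: "S = trace_bounded \<alpha>" by (simp add: \<tau>_def)
  show ?thesis
  proof (rule has_sum_SigmaD[OF S[unfolded S_eq]])
    fix e assume "e \<in> B"
    with summable_b_basis[OF B] have "(\<lambda>n. ?f (e, n)) summable_on UNIV"
      using summable_on_SigmaD1[of "\<lambda>e n. ?f (e, n)" B "\<lambda>_. UNIV"] by (simp add: case_prod_unfold)
    then obtain s where s: "((\<lambda>n. ?f (e, n)) has_sum s) UNIV" by (auto simp: summable_on_def)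
    then have "s = q e e"
      unfolding q_def using has_sum_imp_sums[OF s] by (simp add: sums_unique)
    with s show "((\<lambda>n. ?f (e, n)) has_sum q e e) UNIV" by simp
  qed
qed

end

text \<open>
  Passing to \<open>k x\<close> and \<open>k\<^sup>2 \<alpha>\<close> with \<open>k \<le> 1 / \<parallel>x\<parallel>\<close> makes \<open>x\<close> a contraction, and \<open>q\<close> is scaled back
  by \<open>1 / k\<^sup>2\<close>.
\<close>

lemma symmetrizable_trace_form:
  fixes D :: "'a::complex_hilbert set"
  assumes D_diff: "\<And>u v. u \<in> D \<Longrightarrow> v \<in> D \<Longrightarrow> u - v \<in> D \<and> h (u - v) = h u - h v"
    and D_scale: "\<And>r u. u \<in> D \<Longrightarrow> r *\<^sub>R u \<in> D \<and> h (r *\<^sub>R u) = r *\<^sub>R h u"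
    and h_sym: "\<And>u v. u \<in> D \<Longrightarrow> v \<in> D \<Longrightarrow> cinner (h u) v = cinner u (h v)"
    and x: "bounded_clinear x" and \<alpha>: "trace_span \<alpha>"
    and h_p: "\<And>v. badj x (x v) \<in> D \<and> h (badj x (x v)) = \<alpha> v"
  obtains q where "\<And>v v'. badj x v \<in> D \<Longrightarrow> cinner v' (x (h (badj x v))) = q v' v"
    "\<And>v'. continuous_on UNIV (q v')"
    "\<And>B. orthonormal_basis B \<Longrightarrow> ((\<lambda>e. q e e) has_sum trace_bounded \<alpha>) B"
proof -
  define k where "k = 1 / (onorm x + 1)"
  have on: "0 \<le> onorm x" by (rule onorm_pos_le[OF bounded_clinearD(6)[OF x]])
  then have k: "0 < k" "k * onorm x \<le> 1" by (auto simp: k_def field_simps)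
  let ?x = "\<lambda>v. k *\<^sub>R x v" and ?\<alpha> = "\<lambda>v. (k * k) *\<^sub>R \<alpha> v"
  have bx: "bounded_clinear ?x" by (rule bounded_clinear_scaleR[OF x])
  have adj: "badj ?x = (\<lambda>v. k *\<^sub>R badj x v)"
    by (rule ext, rule cinner_ext)
      (simp add: cinner_badj[OF bx, symmetric] cinner_badj[OF x, symmetric] cinner_scaleR_left cinner_scaleR_right)
  have p: "badj ?x (?x v) = (k * k) *\<^sub>R badj x (x v)" for v
    by (simp add: adj bounded_clinearD(5)[OF bounded_clinear_badj[OF x]])
  have ts: "trace_span ?\<alpha>"
    by (rule trace_span_comp(1)[OF bounded_clinear_scaleR[OF bounded_clinear_id] \<alpha>])
  interpret s: symmetrizable D h ?x ?\<alpha>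
  proof
    show "norm (k *\<^sub>R x v) \<le> norm v" for v
    proof -
      have "k * norm (x v) \<le> k * (onorm x * norm v)"
        using k by (intro mult_left_mono bounded_clinear_norm[OF x]) auto
      also have "\<dots> = (k * onorm x) * norm v" by simp
      also have "\<dots> \<le> 1 * norm v" by (intro mult_right_mono k) auto
      finally show ?thesis using k by simp
    qed
  qed (use D_diff D_scale h_sym h_p bx ts p in \<open>auto simp del: scaleR_scaleR\<close>)
  have tr: "trace_bounded ?\<alpha> = complex_of_real (k * k) * trace_bounded \<alpha>"
  proof (rule trace_bounded_eqI)
    show "((\<lambda>e. cinner e ((k * k) *\<^sub>R \<alpha> e)) has_sum complex_of_real (k * k) * trace_bounded \<alpha>) B"
      if "orthonormal_basis B" for B
      unfolding cinner_scaleR_right by (rule has_sum_cmult_right[OF trace_span_has_sum[OF \<alpha> that]])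
  qed (rule trace_span_ex_basis[OF \<alpha>])
  show ?thesis
  proof (rule that[of "\<lambda>v' v. complex_of_real (1 / (k * k)) * s.q v' v"])
    show "cinner v' (x (h (badj x v))) = complex_of_real (1 / (k * k)) * s.q v' v" if "badj x v \<in> D" for v v'
    proof -
      have "s.q v' v = cinner v' (?x (h (badj ?x v)))"
        using D_scale that by (intro s.q_eq[symmetric]) (simp add: adj)
      also have "\<dots> = complex_of_real (k * k) * cinner v' (x (h (badj x v)))"
        using D_scale that by (simp add: adj bounded_clinearD(5)[OF x] cinner_scaleR_right)
      finally show ?thesis using k by simp
    qed
    show "continuous_on UNIV (\<lambda>v. complex_of_real (1 / (k * k)) * s.q v' v)" for v'
      by (intro continuous_intros s.continuous_q)
    show "((\<lambda>e. complex_of_real (1 / (k * k)) * s.q e e) has_sum trace_bounded \<alpha>) B"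
      if "orthonormal_basis B" for B
      using has_sum_cmult_right[OF s.has_sum_q[OF that], of "complex_of_real (1 / (k * k))"] k
      unfolding tr by simp
  qed
qed

section \<open>Bounded extensions\<close>

text \<open>
  The closed sets of all \<open>v\<close> with \<open>\<bar>\<langle>s, v\<rangle>\<bar> \<le> n\<close> for \<open>s \<in> S\<close> exhaust the space, so that by Baire's
  theorem one of them contains a ball.
\<close>

lemma uniform_boundedness:
  fixes S :: "'a::complex_hilbert set"
  assumes "\<And>v. \<exists>C. \<forall>s\<in>S. cmod (cinner s v) \<le> C"
  obtains C where "0 \<le> C" "\<And>s. s \<in> S \<Longrightarrow> norm s \<le> C"
proof -
  define A where "A n = (\<Inter>s\<in>S. {v. cmod (cinner s v) \<le> real n})" for n
  have closed: "closed (A n)" for n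
    unfolding A_def
    by (intro closed_INT ballI closed_Collect_le continuous_intros continuous_on_cinner)
  have "\<Union> (range A) = UNIV"
  proof -
    have "\<exists>n. v \<in> A n" for v
    proof -
      obtain C where C: "\<forall>s\<in>S. cmod (cinner s v) \<le> C" using assms by blast
      obtain n where "C \<le> real n" using real_arch_simple by blast
      with C have "v \<in> A n" by (auto simp: A_def intro: order_trans)
      then show ?thesis ..
    qed
    then show ?thesis by blast
  qed
  moreover have "completely_metrizable_space (euclidean :: 'a topology)"
    by (rule completely_metrizable_space_euclidean)
  ultimately have "\<exists>n. interior (A n) \<noteq> {}"
    using Baire_category_alt[of "euclidean :: 'a topology" "range A"] closed by fastforce
  then obtain n a where "a \<in> interior (A n)" by blast
  then obtain r where r: "0 < r" "cball a r \<subseteq> A n"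
    using mem_interior_cball by blast
  show ?thesis
  proof (rule that[of "2 * real n / r"])
    show "norm s \<le> 2 * real n / r" if s: "s \<in> S" for s
    proof (cases "s = 0")
      case False
      define v where "v = (r / norm s) *\<^sub>R s"
      have "a + v \<in> A n" "a \<in> A n"
        using r False by (auto simp: v_def dist_norm subset_iff)
      then have "cmod (cinner s (a + v)) \<le> real n" "cmod (cinner s a) \<le> real n"
        using s by (auto simp: A_def)
      moreover have "cinner s (a + v) = cinner s a + complex_of_real (r * norm s)"
        using False by (simp add: v_def cinner_simps cinner_scaleR_right cinner_self power2_eq_square)
      ultimately have "cmod (complex_of_real (r * norm s)) \<le> 2 * real n"
        using norm_triangle_ineq4[of "cinner s (a + v)" "cinner s a"] by simp
      then have "r * norm s \<le> 2 * real n"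
        using r by (simp add: norm_mult)
      with r show ?thesis by (simp add: field_simps)
    qed (use r in simp)
  qed (use r in simp)
qed

text \<open>
  The functionals \<open>\<langle>f y, -\<rangle>\<close> with \<open>\<parallel>y\<parallel> \<le> 1\<close> are bounded at each \<open>v\<close> by \<open>\<parallel>T v\<parallel>\<close>, hence uniformly
  bounded. This takes the place of the closed graph theorem.
\<close>

lemma formal_adjoint_bounded:
  fixes T f :: "'a::complex_hilbert \<Rightarrow> 'a"
  assumes W: "dense_set W" "\<And>r y. y \<in> W \<Longrightarrow> r *\<^sub>R y \<in> W"
    and adj: "\<And>v y. y \<in> W \<Longrightarrow> cinner (f y) v = cinner y (T v)"
  shows "\<exists>C. 0 \<le> C \<and> (\<forall>v. norm (T v) \<le> C * norm v)"
proof -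
  let ?S = "f ` {y \<in> W. norm y \<le> 1}"
  have pw: "\<exists>C. \<forall>s\<in>?S. cmod (cinner s v) \<le> C" for v
  proof (intro exI ballI)
    fix s assume "s \<in> ?S"
    then obtain y where "y \<in> W" "norm y \<le> 1" "s = f y" by blast
    then show "cmod (cinner s v) \<le> norm (T v)"
      using cmod_cinner_le[of y "T v"] mult_right_mono[of "norm y" 1 "norm (T v)"] by (simp add: adj)
  qed
  obtain C where C: "0 \<le> C" "\<And>s. s \<in> ?S \<Longrightarrow> norm s \<le> C"
    by (rule uniform_boundedness[of ?S, OF pw]) blast
  show ?thesis
  proof (intro exI conjI allI)
    show "0 \<le> C" by (rule C(1))
    fix v
    show "norm (T v) \<le> C * norm v"
    proof (rule norm_le_if_cinner_le[OF W(1)])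
      fix y assume y: "y \<in> W"
      show "cmod (cinner y (T v)) \<le> norm y * (C * norm v)"
      proof (cases "y = 0")
        case False
        define z where "z = (1 / norm y) *\<^sub>R y"
        have z: "z \<in> W" "norm z \<le> 1" using W(2)[OF y] False by (auto simp: z_def)
        have "cmod (cinner z (T v)) \<le> norm (f z) * norm v"
          using cmod_cinner_le[of "f z" v] by (simp add: adj z)
        also have "\<dots> \<le> C * norm v"
          using z by (intro mult_right_mono C(2)) auto
        finally show ?thesis
          using False by (simp add: z_def cinner_scaleR_left norm_mult norm_divide field_simps)
      qed simp
    qed (use C in simp)
  qed
qed

text \<open>
  A bound for \<open>T\<close> on the dense set \<open>V0\<close> makes the formal adjoint \<open>f\<close> bounded on \<open>W\<close>, and \<open>f\<close> extends
  by continuity. The adjoint of the extension agrees with \<open>T\<close> on all of \<open>V\<close>, although \<open>V0\<close> need not be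
  a core of \<open>T\<close>.
\<close>

lemma formal_adjoint_extension:
  fixes T f :: "'a::complex_hilbert \<Rightarrow> 'a"
  assumes V0: "dense_set V0" "V0 \<subseteq> V" and W: "dense_set W" and C: "0 \<le> C"
    and adj: "\<And>v y. y \<in> W \<Longrightarrow> v \<in> V \<Longrightarrow> cinner (f y) v = cinner y (T v)"
    and bound: "\<And>v. v \<in> V0 \<Longrightarrow> norm (T v) \<le> C * norm v"
  shows "\<exists>M. bounded_clinear M \<and> (\<forall>v\<in>V. M v = T v)"
proof -
  have V: "dense_set V" using V0 by (rule dense_set_mono)
  have adj': "cinner v (f y) = cinner (T v) y" if "y \<in> W" "v \<in> V" for v y
    using adj[OF that] by (metis cinner_commute)
  have lip: "norm (f y - f y') \<le> C * norm (y - y')" if "y \<in> W" "y' \<in> W" for y y'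
  proof (rule norm_le_if_cinner_le[OF V0(1)])
    fix v assume v: "v \<in> V0"
    then have "cinner v (f y - f y') = cinner (T v) (y - y')"
      using V0(2) that by (simp add: cinner_simps adj' subset_iff)
    then have "cmod (cinner v (f y - f y')) \<le> norm (T v) * norm (y - y')"
      using cmod_cinner_le by simp
    also have "\<dots> \<le> C * norm v * norm (y - y')"
      by (intro mult_right_mono bound v) simp
    finally show "cmod (cinner v (f y - f y')) \<le> norm v * (C * norm (y - y'))"
      by (simp add: mult_ac)
  qed (use C in simp)
  have "uniformly_continuous_on W f"
    unfolding uniformly_continuous_on_def
  proof (intro allI impI)
    fix e :: real assume e: "0 < e"
    have "dist (f y') (f y) < e" if "y \<in> W" "y' \<in> W" "dist y' y < e / (C + 1)" for y y'
    proof -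
      have "dist (f y') (f y) \<le> C * dist y' y"
        using lip[OF that(2,1)] by (simp add: dist_norm)
      also have "\<dots> \<le> (C + 1) * dist y' y" using C by (intro mult_right_mono) auto
      also have "\<dots> < e" using that(3) C by (simp add: field_simps)
      finally show ?thesis .
    qed
    moreover have "0 < e / (C + 1)" using e C by simp
    ultimately show "\<exists>d>0. \<forall>x\<in>W. \<forall>x'\<in>W. dist x' x < d \<longrightarrow> dist (f x') (f x) < e" by blast
  qed
  then obtain F where F: "uniformly_continuous_on (closure W) F" "\<And>y. y \<in> W \<Longrightarrow> f y = F y"
    by (rule uniformly_continuous_on_extension_on_closure) blast
  have contF: "continuous_on UNIV F"
    using uniformly_continuous_imp_continuous[OF F(1)] W by (simp add: dense_set_def)
  have F_adj: "cinner v (F y) = cinner (T v) y" if "v \<in> V" for v y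
    by (rule dense_set_eqI[OF W]) (auto intro!: continuous_on_cinner continuous_intros contF simp: F(2)[symmetric] adj' that)
  have bF: "bounded_clinear F"
  proof (rule bounded_clinearI[where K = C])
    show "F (u + v) = F u + F v" for u v
      by (rule dense_cinner_ext[OF V]) (simp add: F_adj cinner_simps)
    show "F (c *\<^sub>C v) = c *\<^sub>C F v" for c v
      by (rule dense_cinner_ext[OF V]) (simp add: F_adj cinner_scaleC_right)
    show "norm (F y) \<le> norm y * C" for y
    proof (rule norm_le_if_cinner_le[OF V0(1)])
      fix v assume v: "v \<in> V0"
      then have "cmod (cinner v (F y)) \<le> norm (T v) * norm y"
        using cmod_cinner_le V0(2) by (simp add: F_adj subset_iff)
      also have "\<dots> \<le> C * norm v * norm y" by (intro mult_right_mono bound v) simp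
      finally show "cmod (cinner v (F y)) \<le> norm v * (norm y * C)" by (simp add: mult_ac)
    qed (use C in simp)
  qed
  show ?thesis
  proof (intro exI conjI ballI)
    show "bounded_clinear (badj F)" by (rule bounded_clinear_badj[OF bF])
    show "badj F v = T v" if "v \<in> V" for v
    proof (rule cinner_ext)
      show "cinner y (badj F v) = cinner y (T v)" for y
        by (simp add: cinner_badj[OF bF, symmetric]) (metis F_adj[OF that] cinner_commute)
    qed
  qed
qed

lemma quadratic_bound:
  fixes t n :: real
  assumes "t\<^sup>2 \<le> K * n\<^sup>2 + C * n * t" "0 \<le> K" "0 \<le> C" "0 \<le> n" "0 \<le> t"
  shows "t \<le> (K + C + 1) * n"
proof (rule ccontr)
  assume "\<not> t \<le> (K + C + 1) * n"
  then have t: "(K + C + 1) * n < t" by simp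
  have "1 * n \<le> (K + C + 1) * n" using assms by (intro mult_right_mono) auto
  with t have nt: "n < t" by simp
  then have "0 < t" using assms by simp
  have "K * n\<^sup>2 \<le> K * n * t"
    using nt assms by (simp add: power2_eq_square mult.assoc mult_left_mono)
  with assms(1) have "t * t \<le> ((K + C) * n) * t" by (simp add: power2_eq_square algebra_simps)
  with \<open>0 < t\<close> have "t \<le> (K + C) * n" by simp
  also have "\<dots> \<le> (K + C + 1) * n" using assms by (intro mult_right_mono) auto
  finally show False using t by simp
qed

section \<open>Half of the trace identity\<close>

lemma orthogonal_projectorD:
  assumes "orthogonal_projector Q"
  shows "bounded_clinear Q" "Q (Q v) = Q v" "cinner (Q u) v = cinner u (Q v)" "norm (Q v) \<le> norm v"
proof -
  show "bounded_clinear Q" "Q (Q v) = Q v" and sym: "\<And>u v. cinner (Q u) v = cinner u (Q v)"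
    using assms unfolding orthogonal_projector_def by simp_all
  then have "cinner (Q v) (Q v) = cinner (Q v) v" by (metis \<open>Q (Q v) = Q v\<close>)
  then have "norm (Q v) * norm (Q v) = cmod (cinner (Q v) v)"
    unfolding cinner_self using norm_of_real[of "(norm (Q v))\<^sup>2", where 'a = complex]
    by (metis abs_of_nonneg power2_eq_square zero_le_power2)
  also have "\<dots> \<le> norm (Q v) * norm v" by (rule cmod_cinner_le)
  finally show "norm (Q v) \<le> norm v" by (cases "Q v = 0") auto
qed

text \<open>
  The model is a self-adjoint operator \<open>h\<close> with domain \<open>D\<close>, a spectral projector \<open>P\<close> of it, and the
  spectral projector \<open>E n\<close> of the interval \<open>[-n-1, n+1]\<close>.
\<close>

locale spectral_cutoff =
  fixes D :: "'a::complex_hilbert set" and h P :: "'a \<Rightarrow> 'a" and E :: "nat \<Rightarrow> 'a \<Rightarrow> 'a"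
  assumes D_lin: "u \<in> D \<Longrightarrow> v \<in> D \<Longrightarrow> a *\<^sub>C u + b *\<^sub>C v \<in> D"
    and h_lin: "u \<in> D \<Longrightarrow> v \<in> D \<Longrightarrow> h (a *\<^sub>C u + b *\<^sub>C v) = a *\<^sub>C h u + b *\<^sub>C h v"
    and h_sym: "u \<in> D \<Longrightarrow> v \<in> D \<Longrightarrow> cinner (h u) v = cinner u (h v)"
    and h_max: "(\<And>u. u \<in> D \<Longrightarrow> cinner v (h u) = cinner z u) \<Longrightarrow> v \<in> D \<and> h v = z"
    and P: "orthogonal_projector P"
    and P_D: "u \<in> D \<Longrightarrow> P u \<in> D" and h_P: "u \<in> D \<Longrightarrow> h (P u) = P (h u)"
    and E: "orthogonal_projector (E n)" and E_D: "E n v \<in> D"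
    and h_E: "u \<in> D \<Longrightarrow> h (E n u) = E n (h u)" and E_P: "E n (P v) = P (E n v)"
    and E_lim: "(\<lambda>n. E n v) \<longlonglongrightarrow> v"
    and gap: "u \<in> D \<Longrightarrow> norm (u - E 0 u) \<le> norm (h u)"
begin

definition Q :: "'a \<Rightarrow> 'a" where "Q v = v - P v"

lemmas P_bounded = orthogonal_projectorD(1)[OF P]
lemmas PP = orthogonal_projectorD(2)[OF P]
lemmas P_sym = orthogonal_projectorD(3)[OF P]

lemma Q_bounded: "bounded_clinear Q"
  unfolding Q_def by (rule bounded_clinear_diff[OF bounded_clinear_id P_bounded])

lemma Q_sym: "cinner (Q u) v = cinner u (Q v)"
  by (simp add: Q_def cinner_simps P_sym)

lemma PQ: "P (Q v) = 0" and QP: "Q (P v) = 0" and QQ: "Q (Q v) = Q v"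
  by (simp_all add: Q_def bounded_clinearD(2)[OF P_bounded] PP)

lemma D_diff: "u \<in> D \<Longrightarrow> v \<in> D \<Longrightarrow> u - v \<in> D \<and> h (u - v) = h u - h v"
  using D_lin[of u v 1 "-1"] h_lin[of u v 1 "-1"] by (simp add: scaleC_one scaleC_minus_one)

lemma D_scale: "u \<in> D \<Longrightarrow> r *\<^sub>R u \<in> D \<and> h (r *\<^sub>R u) = r *\<^sub>R h u"
  using D_lin[of u u "complex_of_real r" 0] h_lin[of u u "complex_of_real r" 0]
    scaleC_of_real[of 0 u] scaleC_of_real[of 0 "h u"] by (simp add: scaleC_of_real)

lemma D_add: "u \<in> D \<Longrightarrow> v \<in> D \<Longrightarrow> u + v \<in> D \<and> h (u + v) = h u + h v"
  using D_lin[of u v 1 1] h_lin[of u v 1 1] by (simp add: scaleC_one)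

lemma Q_D: "u \<in> D \<Longrightarrow> Q u \<in> D" and h_Q: "u \<in> D \<Longrightarrow> h (Q u) = Q (h u)"
  unfolding Q_def using D_diff P_D h_P by auto

text \<open>The domain of \<open>h\<^sup>2\<close>, on which the formal adjoints of \<open>h g P\<close> and of \<open>h b\<close> are defined.\<close>

definition D2 :: "'a set" where "D2 = {y \<in> D. h y \<in> D}"

lemma D2_dense: "dense_set D2"
proof -
  have "v \<in> closure D2" for v
  proof -
    have "E n v \<in> D2" for n
    proof -
      have "h (E n v) = E n (h (E n v))"
        using h_E[OF E_D[of n v], of n] by (simp add: orthogonal_projectorD(2)[OF E])
      then show ?thesis unfolding D2_def using E_D by (metis (mono_tags, lifting) mem_Collect_eq)
    qed
    then show ?thesis using E_lim[of v] by (meson closure_sequential)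
  qed
  then show ?thesis by (auto simp: dense_set_def)
qed

lemma D_dense: "dense_set D"
  using D2_dense by (rule dense_set_mono) (auto simp: D2_def)

lemma D2_scale: "y \<in> D2 \<Longrightarrow> r *\<^sub>R y \<in> D2"
  using D_scale by (auto simp: D2_def)

text \<open>
  Pairing with \<open>h u\<close> turns the hypothesis into an equation of continuous functions of \<open>v\<close>, and
  \<open>h_max\<close> puts \<open>R v\<close> into the domain.
\<close>

lemma h_closed:
  assumes R: "bounded_clinear R" and S: "bounded_clinear S" and X: "dense_set X"
    and eq: "\<And>v. v \<in> X \<Longrightarrow> R v \<in> D \<and> h (R v) = S v"
  shows "R v \<in> D \<and> h (R v) = S v"
proof (rule h_max)
  fix u assume u: "u \<in> D"
  show "cinner (R v) (h u) = cinner (S v) u"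
  proof (rule dense_set_eqI[OF X, of "\<lambda>v. cinner (R v) (h u)" "\<lambda>v. cinner (S v) u"])
    show "cinner (R v) (h u) = cinner (S v) u" if "v \<in> X" for v
      using h_sym[of "R v" u] eq[OF that] u by simp
  qed (intro continuous_on_cinner continuous_intros bounded_clinear_continuous_on R S)+
qed

text \<open>
  In \<open>\<parallel>f\<parallel>\<^sup>2 = \<langle>v, w\<rangle>\<close> the part of \<open>w\<close> that belongs to the spectrum outside \<open>[-1, 1]\<close> has norm at most
  \<open>\<parallel>h w\<parallel>\<close>, and the part inside contributes \<open>\<langle>f', f\<rangle>\<close>. This gives a quadratic inequality for \<open>\<parallel>f\<parallel>\<close>.
  It is applied to \<open>f = h g v\<close> and to \<open>f = h b v\<close>.
\<close>

lemma cutoff_bound: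
  assumes w: "w \<in> D" and f: "cinner f f = cinner v w" and f': "cinner (E 0 v) w = cinner f' f"
    and C: "norm f' \<le> C * norm v" "0 \<le> C" and K: "norm (h w) \<le> K * norm v" "0 \<le> K"
  shows "norm f \<le> (K + C + 1) * norm v"
proof (rule quadratic_bound)
  have "cinner v w = cinner v (w - E 0 w) + cinner f' f"
    by (simp add: cinner_simps f'[symmetric] orthogonal_projectorD(3)[OF E])
  with f have "complex_of_real ((norm f)\<^sup>2) = cinner v (w - E 0 w) + cinner f' f"
    by (simp add: cinner_self)
  then have "(norm f)\<^sup>2 = cmod (cinner v (w - E 0 w) + cinner f' f)"
    by (metis abs_of_nonneg norm_of_real zero_le_power2)
  also have "\<dots> \<le> norm v * norm (w - E 0 w) + norm f' * norm f"
    by (intro order_trans[OF norm_triangle_ineq] add_mono cmod_cinner_le)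
  also have "\<dots> \<le> norm v * (K * norm v) + C * norm v * norm f"
    using gap[OF w] K(1) C(1) by (intro add_mono mult_left_mono mult_right_mono) auto
  finally show "(norm f)\<^sup>2 \<le> K * (norm v)\<^sup>2 + C * norm v * norm f"
    by (simp add: power2_eq_square mult_ac)
qed (use C K in auto)

text \<open>
  The products \<open>h g P\<close> and \<open>h b\<close> have bounded extensions \<open>M\<close> and \<open>N\<close>. Then \<open>P S3 = h M\<^sup>* M\<close>,
  \<open>S7 = h M\<^sup>* Q M\<close> and \<open>S10 = h N\<^sup>* N\<close>, whereas \<open>P S6\<close> is the sum of \<open>P M h M\<^sup>* P\<close> and \<open>N h N\<^sup>*\<close>. The
  traces of the latter two are those of \<open>h M\<^sup>* P M = P S3 - S7\<close> and of \<open>S10\<close>.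

  The statement is symmetric in \<open>g\<close> and its formal adjoint \<open>k\<close>, so that it applies to both halves of
  the identity; the domains of \<open>g, k, a, a', b, b'\<close> are \<open>G, K, A, A', B, B'\<close>. The pairs \<open>a, a'\<close> and
  \<open>b, b'\<close> are only required to be formally adjoint, since either member may be the adjoint of the other.
\<close>

lemma half_trace_identity:
  fixes g k a a' b b' S3 S6 S7 S10 :: "'a \<Rightarrow> 'a"
  assumes gk: "\<And>u v. u \<in> G \<Longrightarrow> v \<in> K \<Longrightarrow> cinner (g u) v = cinner u (k v)"
    and aa': "\<And>u v. u \<in> A \<Longrightarrow> v \<in> A' \<Longrightarrow> cinner (a u) v = cinner u (a' v)"
    and bb': "\<And>u v. u \<in> B \<Longrightarrow> v \<in> B' \<Longrightarrow> cinner (b u) v = cinner u (b' v)"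
    and g_D: "\<And>u. u \<in> D \<Longrightarrow> u \<in> G \<and> g u \<in> D" and k_D: "\<And>u. u \<in> D \<Longrightarrow> u \<in> K \<and> k u \<in> D"
    and a: "\<And>v. P v \<in> D \<Longrightarrow> v \<in> A \<and> a v = Q (g (P v))"
    and b: "\<And>v. Q v \<in> D \<Longrightarrow> v \<in> B \<and> b v = P (g (Q v))"
    and b': "\<And>v. P v \<in> D \<Longrightarrow> v \<in> B' \<and> b' v = Q (k (P v))"
    and X: "dense_set X"
    and S3: "\<And>v. v \<in> X \<Longrightarrow> P v \<in> D \<and> h (g (P v)) \<in> D \<and> h (h (g (P v))) \<in> K \<and>
      k (h (h (g (P v)))) \<in> D \<and> S3 v = h (k (h (h (g (P v)))))"
    and S6: "\<And>v. v \<in> X \<Longrightarrow> h (P v) \<in> K \<and> k (h (P v)) \<in> D \<and> h (k (h (P v))) \<in> G \<and>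
      g (h (k (h (P v)))) \<in> D \<and> S6 v = h (g (h (k (h (P v)))))"
    and S7: "\<And>v. v \<in> X \<Longrightarrow> a v \<in> D \<and> h (a v) \<in> D \<and> h (h (a v)) \<in> A' \<and>
      a' (h (h (a v))) \<in> D \<and> S7 v = h (a' (h (h (a v))))"
    and S10: "\<And>v. v \<in> X \<Longrightarrow> v \<in> B \<and> b v \<in> D \<and> h (b v) \<in> D \<and> h (h (b v)) \<in> B' \<and>
      b' (h (h (b v))) \<in> D \<and> S10 v = h (b' (h (h (b v))))"
    and tr: "trace_span S3" "trace_span S6" "trace_span S7" "trace_span S10"
    and SP: "\<And>v. S3 (P v) = S3 v" "\<And>v. S6 (P v) = S6 v"
  shows "trace_bounded S3 - trace_bounded S6 = trace_bounded S7 - trace_bounded S10"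
proof -
  note bounded = tr[THEN trace_span_bounded]
  have kg: "cinner (k v) u = cinner v (g u)" if "u \<in> G" "v \<in> K" for u v
    using gk[OF that] by (metis cinner_commute)
  have b'b: "cinner (b' v) u = cinner v (b u)" if "u \<in> B" "v \<in> B'" for u v
    using bb'[OF that] by (metis cinner_commute)
  have gD: "u \<in> G" "g u \<in> D" and kD: "u \<in> K" "k u \<in> D" if "u \<in> D" for u
    using g_D k_D that by auto
  have D2D: "y \<in> D" "h y \<in> D" if "y \<in> D2" for y
    using that by (auto simp: D2_def)
  note PhP = h_P[symmetric]

  have adjC: "cinner (E 0 (k (h y))) v = cinner y (h (g (E 0 v)))" if y: "y \<in> D2" for v y
  proof -
    have "cinner (E 0 (k (h y))) v = cinner (h y) (g (E 0 v))"
      by (simp add: orthogonal_projectorD(3)[OF E] kg gD kD E_D D2D y)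
    also have "\<dots> = cinner y (h (g (E 0 v)))"
      by (simp add: h_sym gD E_D D2D y)
    finally show ?thesis .
  qed
  have "\<exists>C. 0 \<le> C \<and> (\<forall>v. norm (h (g (E 0 v))) \<le> C * norm v)"
    by (rule formal_adjoint_bounded[OF D2_dense D2_scale adjC])
  then obtain C where C: "0 \<le> C" "\<And>v. norm (h (g (E 0 v))) \<le> C * norm v" by blast

  have hgP: "norm (h (g (P v))) \<le> (onorm S3 + C + 1) * norm v" if v: "v \<in> X" for v
  proof -
    define w where "w = k (h (h (g (P v))))"
    have D: "P v \<in> D" "h (g (P v)) \<in> D" "h (h (g (P v))) \<in> K" "w \<in> D" "S3 v = h w"
      using S3[OF v] by (auto simp: w_def)
    have "norm (h (g (P v))) \<le> (onorm S3 + C + 1) * norm (P v)"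
    proof (rule cutoff_bound[where w = w and f' = "h (g (E 0 (P v)))"])
      show "cinner (h (g (P v))) (h (g (P v))) = cinner (P v) w"
        using D by (simp add: h_sym gD gk w_def)
      show "cinner (E 0 (P v)) w = cinner (h (g (E 0 (P v)))) (h (g (P v)))"
        using D by (simp add: h_sym gD gk w_def E_D)
      show "norm (h w) \<le> onorm S3 * norm (P v)"
        using bounded_clinear_norm[OF bounded(1), of "P v"] by (simp add: SP D)
    qed (use D C onorm_pos_le[OF bounded_clinearD(6)[OF bounded(1)]] in auto)
    also have "\<dots> \<le> (onorm S3 + C + 1) * norm v"
      using C onorm_pos_le[OF bounded_clinearD(6)[OF bounded(1)]]
      by (intro mult_left_mono orthogonal_projectorD(4)[OF P]) auto
    finally show ?thesis .
  qed
  have M_adj: "cinner (P (k (h y))) v = cinner y (h (g (P v)))" if "y \<in> D2" "v \<in> {v. P v \<in> D}" for v y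
  proof -
      have "cinner (P (k (h y))) v = cinner (h y) (g (P v))"
        using that by (simp add: P_sym kg gD kD D2D)
      also have "\<dots> = cinner y (h (g (P v)))"
        using that by (simp add: h_sym gD D2D)
      finally show ?thesis .
  qed
  have "X \<subseteq> {v. P v \<in> D}" "0 \<le> onorm S3 + C + 1"
    using S3 C onorm_pos_le[OF bounded_clinearD(6)[OF bounded(1)]] by auto
  from formal_adjoint_extension[OF X this(1) D2_dense this(2) M_adj hgP]
  obtain M where M: "bounded_clinear M" "\<And>v. P v \<in> D \<Longrightarrow> M v = h (g (P v))" by auto
  let ?M' = "badj M"
  note M' = cinner_badj[OF M(1)] and bM' = bounded_clinear_badj[OF M(1)]
  have MP: "M (P v) = M v" for v
  proof (rule dense_set_eqI[OF D_dense, of "\<lambda>v. M (P v)" M])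
    show "M (P v) = M v" if "v \<in> D" for v
      using that by (simp add: M(2) PP P_D)
    show "continuous_on UNIV (\<lambda>v. M (P v))"
      by (rule bounded_clinear_continuous_on[OF bounded_clinear_comp[OF M(1) P_bounded]])
  qed (rule bounded_clinear_continuous_on[OF M(1)])

  \<comment> \<open>On the spectral subspace of \<open>[-1, 1]\<close> the operator \<open>h b\<close> is \<open>P h g Q\<close> and inherits the bound \<open>C\<close>.\<close>
  have hb: "norm (h (b v)) \<le> (onorm S10 + C + 1) * norm v" if v: "v \<in> X" for v
  proof -
    define w where "w = b' (h (h (b v)))"
    have D: "v \<in> B" "b v \<in> D" "h (b v) \<in> D" "h (h (b v)) \<in> B'" "w \<in> D" "S10 v = h w"
      using S10[OF v] by (auto simp: w_def)
    have QE: "Q (E 0 v) = E 0 (Q v)"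
      by (simp add: Q_def E_P bounded_clinearD(2)[OF orthogonal_projectorD(1)[OF E]])
    have QE_D: "Q (E 0 v) \<in> D" using E_D QE by simp
    have bE: "b (E 0 v) = P (g (E 0 (Q v)))" "b (E 0 v) \<in> D" "E 0 v \<in> B"
      using b[OF QE_D] QE QE_D gD(2) P_D by auto
    show ?thesis
    proof (rule cutoff_bound[where w = w and f' = "h (b (E 0 v))"])
      show "cinner (h (b v)) (h (b v)) = cinner v w"
        using D by (simp add: h_sym bb' w_def)
      show "cinner (E 0 v) w = cinner (h (b (E 0 v))) (h (b v))"
        using D bE(2,3) by (simp add: h_sym bb' w_def)
      have "norm (h (b (E 0 v))) \<le> norm (h (g (E 0 (Q v))))"
        unfolding bE(1) using QE_D QE by (simp add: h_P gD orthogonal_projectorD(4)[OF P])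
      also have "\<dots> = norm (h (g (E 0 (E 0 (Q v)))))"
        by (simp add: orthogonal_projectorD(2)[OF E])
      also have "\<dots> \<le> C * norm (E 0 (Q v))" by (rule C)
      also have "\<dots> = C * norm (Q (E 0 v))" by (simp add: QE)
      also have "\<dots> \<le> C * norm v"
      proof (intro mult_left_mono C)
        have "(norm (Q u))\<^sup>2 + (norm (P u))\<^sup>2 = (norm u)\<^sup>2" for u
        proof -
          have "Q u \<bullet> P u = 0"
            by (simp add: Re_cinner[symmetric] P_sym[symmetric] PQ)
          then show ?thesis
            using norm_add_Pythagorean[of "Q u" "P u"] by (simp add: Q_def orthogonal_def)
        qed
        from this[of "E 0 v"] have "(norm (Q (E 0 v)))\<^sup>2 \<le> (norm (E 0 v))\<^sup>2"
          by (metis le_add_same_cancel1 zero_le_power2)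
        then have "norm (Q (E 0 v)) \<le> norm (E 0 v)" by (simp add: power2_le_iff_abs_le)
        then show "norm (Q (E 0 v)) \<le> norm v"
          using orthogonal_projectorD(4)[OF E, of 0 v] by simp
      qed
      finally show "norm (h (b (E 0 v))) \<le> C * norm v" .
      show "norm (h w) \<le> onorm S10 * norm v"
        using bounded_clinear_norm[OF bounded(4), of v] by (simp add: D)
    qed (use D C onorm_pos_le[OF bounded_clinearD(6)[OF bounded(4)]] in auto)
  qed
  have N_adj: "cinner (b' (h y)) v = cinner y (h (b v))" if "y \<in> D2" "v \<in> {v \<in> B. b v \<in> D}" for v y
  proof -
      have "h y \<in> B'" using b'[of "h y"] that P_D D2D by blast
      then show ?thesis using that by (simp add: b'b h_sym D2D)
  qed
  have "X \<subseteq> {v \<in> B. b v \<in> D}" "0 \<le> onorm S10 + C + 1"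
    using S10 C onorm_pos_le[OF bounded_clinearD(6)[OF bounded(4)]] by auto
  from formal_adjoint_extension[OF X this(1) D2_dense this(2) N_adj hb]
  obtain N where N: "bounded_clinear N" "\<And>v. v \<in> B \<Longrightarrow> b v \<in> D \<Longrightarrow> N v = h (b v)" by auto
  let ?N' = "badj N"
  note N' = cinner_badj[OF N(1)] and bN' = bounded_clinear_badj[OF N(1)]
  have N_D: "N u = P (h (g (Q u)))" "b u \<in> D" "u \<in> B" "b u = P (g (Q u))" if "u \<in> D" for u
  proof -
    show bu: "u \<in> B" "b u = P (g (Q u))" using b[OF Q_D[OF that]] by auto
    then show "b u \<in> D" using that by (simp add: P_D gD Q_D)
    with bu show "N u = P (h (g (Q u)))" using that by (simp add: N(2) h_P gD Q_D)
  qed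

  \<comment> \<open>On \<open>X\<close> the next three equations hold by the definition of \<open>M\<close> and \<open>N\<close>; closedness of \<open>h\<close> extends
    them to the whole space.\<close>
  have S3_eq: "?M' (M v) \<in> D \<and> h (?M' (M v)) = P (S3 v)" for v
  proof (rule h_closed[OF bounded_clinear_comp[OF bM' M(1)] bounded_clinear_comp[OF P_bounded bounded(1)] X])
    fix v assume v: "v \<in> X"
    define w where "w = k (h (h (g (P v))))"
    have D: "P v \<in> D" "h (g (P v)) \<in> D" "h (h (g (P v))) \<in> K" "w \<in> D" "S3 v = h w"
      using S3[OF v] by (auto simp: w_def)
    have "?M' (M v) = P w"
    proof (rule dense_cinner_ext[OF D_dense])
      fix u assume u: "u \<in> D"
      show "cinner u (?M' (M v)) = cinner u (P w)"
        using D u by (simp add: M'[symmetric] M(2) P_D h_sym gD gk P_sym[symmetric] w_def)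
    qed
    then show "?M' (M v) \<in> D \<and> h (?M' (M v)) = P (S3 v)"
      using D by (simp add: P_D h_P)
  qed
  have S7_eq: "?M' (Q (M v)) \<in> D \<and> h (?M' (Q (M v))) = S7 v" for v
  proof (rule h_closed[OF bounded_clinear_comp[OF bM' bounded_clinear_comp[OF Q_bounded M(1)]] bounded(3) X])
    fix v assume v: "v \<in> X"
    define w where "w = a' (h (h (a v)))"
    have D: "a v \<in> D" "h (a v) \<in> D" "h (h (a v)) \<in> A'" "w \<in> D" "S7 v = h w" "P v \<in> D"
      using S7[OF v] S3[OF v] by (auto simp: w_def)
    have QM: "Q (M u) = h (a u) \<and> a u \<in> D \<and> u \<in> A" if "P u \<in> D" for u
      using a[OF that] that by (simp add: M(2) h_Q gD Q_D)
    have "?M' (Q (M v)) = w"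
    proof (rule dense_cinner_ext[OF D_dense])
      fix u assume u: "u \<in> D"
      have "cinner u (?M' (Q (M v))) = cinner (Q (M u)) (Q (M v))"
        by (simp add: M'[symmetric] Q_sym QQ)
      also have "\<dots> = cinner u w"
        using D QM[OF P_D[OF u]] QM[OF D(6)] by (simp add: h_sym aa' w_def)
      finally show "cinner u (?M' (Q (M v))) = cinner u w" .
    qed
    then show "?M' (Q (M v)) \<in> D \<and> h (?M' (Q (M v))) = S7 v"
      using D by simp
  qed
  have S10_eq: "?N' (N v) \<in> D \<and> h (?N' (N v)) = S10 v" for v
  proof (rule h_closed[OF bounded_clinear_comp[OF bN' N(1)] bounded(4) X])
    fix v assume v: "v \<in> X"
    define w where "w = b' (h (h (b v)))"
    have D: "v \<in> B" "b v \<in> D" "h (b v) \<in> D" "h (h (b v)) \<in> B'" "w \<in> D" "S10 v = h w"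
      using S10[OF v] by (auto simp: w_def)
    have "?N' (N v) = w"
    proof (rule dense_cinner_ext[OF D_dense])
      fix u assume u: "u \<in> D"
      show "cinner u (?N' (N v)) = cinner u w"
        using D N_D(2,3)[OF u] by (simp add: N'[symmetric] N(2) h_sym bb' w_def)
    qed
    then show "?N' (N v) \<in> D \<and> h (?N' (N v)) = S10 v"
      using D by simp
  qed

  define x1 where "x1 v = P (M v)" for v
  have bx1: "bounded_clinear x1"
    unfolding x1_def by (rule bounded_clinear_comp[OF P_bounded M(1)])
  have x1': "badj x1 = (\<lambda>v. ?M' (P v))"
    by (rule ext, rule cinner_ext) (simp add: cinner_badj[OF bx1, symmetric] M'[symmetric] x1_def P_sym)
  have "badj x1 (x1 v) = ?M' (M v) - ?M' (Q (M v))" for v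
    by (simp add: x1' x1_def PP Q_def bounded_clinearD(2)[OF bM'])
  then have x1_eq: "badj x1 (x1 v) \<in> D \<and> h (badj x1 (x1 v)) = P (S3 v) - S7 v" for v
    using D_diff S3_eq[of v] S7_eq[of v] by simp
  have PS3: "trace_span (\<lambda>v. P (S3 v))" by (rule trace_span_comp(1)[OF P_bounded tr(1)])
  have \<alpha>1: "trace_span (\<lambda>v. P (S3 v) - S7 v)" by (rule trace_span.diff[OF PS3 tr(3)])
  obtain q1 where q1: "\<And>v v'. badj x1 v \<in> D \<Longrightarrow> cinner v' (x1 (h (badj x1 v))) = q1 v' v"
    "\<And>v'. continuous_on UNIV (q1 v')"
    "\<And>B. orthonormal_basis B \<Longrightarrow> ((\<lambda>e. q1 e e) has_sum trace_bounded (\<lambda>v. P (S3 v) - S7 v)) B"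
    by (rule symmetrizable_trace_form[OF D_diff D_scale h_sym bx1 \<alpha>1 x1_eq]) blast+
  obtain q2 where q2: "\<And>v v'. ?N' v \<in> D \<Longrightarrow> cinner v' (N (h (?N' v))) = q2 v' v"
    "\<And>v'. continuous_on UNIV (q2 v')"
    "\<And>B. orthonormal_basis B \<Longrightarrow> ((\<lambda>e. q2 e e) has_sum trace_bounded S10) B"
    by (rule symmetrizable_trace_form[OF D_diff D_scale h_sym N(1) tr(4) S10_eq]) blast+

  \<comment> \<open>The adjoints of \<open>M\<close> and \<open>N\<close> extend \<open>P k h P\<close> and \<open>Q k h P\<close>, which add up to \<open>k h P\<close>.\<close>
  have adj: "?M' (P y) = P (k (h (P y)))" "?N' y = Q (k (h (P y)))" if y: "P y \<in> D" "h (P y) \<in> K" for y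
  proof -
    show "?M' (P y) = P (k (h (P y)))"
    proof (rule dense_cinner_ext[OF D_dense])
      fix u assume u: "u \<in> D"
      show "cinner u (?M' (P y)) = cinner u (P (k (h (P y))))"
        using y u by (simp add: M'[symmetric] M(2) P_D h_sym gD gk P_sym[of u, symmetric])
    qed
    show "?N' y = Q (k (h (P y)))"
    proof (rule dense_cinner_ext[OF D_dense])
      fix u assume u: "u \<in> D"
      show "cinner u (?N' y) = cinner u (Q (k (h (P y))))"
        using y u by (simp add: N'[symmetric] N_D P_sym Q_D h_sym gD gk Q_sym[symmetric])
    qed
  qed
  have form: "cinner v' (P (S6 v)) = q1 v' v + q2 v' v" for v v'
  proof (rule dense_set_eqI[OF X, of "\<lambda>v. cinner v' (P (S6 v))" "\<lambda>v. q1 v' v + q2 v' v"])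
    fix v assume v: "v \<in> X"
    define z where "z = k (h (P v))"
    have D: "P v \<in> D" "h (P v) \<in> K" "z \<in> D" "h z \<in> G" "g (h z) \<in> D" "S6 v = h (g (h z))"
      using S3[OF v] S6[OF v] by (auto simp: z_def)
    have x1v: "badj x1 v = P z" and Nv: "?N' v = Q z"
      using adj[OF D(1,2)] by (simp_all add: x1' z_def)
    have "P (S6 v) = x1 (P (h z)) + N (Q (h z))"
    proof (rule dense_cinner_ext[OF D2_dense])
      fix y assume y: "y \<in> D2"
      have Py: "P y \<in> D" "h (P y) \<in> D" "h (P y) \<in> K"
        using D2D[OF y] by (simp_all add: P_D h_P kD)
      have "cinner y (P (S6 v)) = cinner (h (P y)) (g (h z))"
        using D Py by (simp add: P_sym[symmetric] h_sym)
      also have "\<dots> = cinner (k (h (P y))) (h z)"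
        using D Py by (simp add: kg)
      also have "\<dots> = cinner (P (k (h (P y)))) (P (h z)) + cinner (Q (k (h (P y)))) (Q (h z))"
        by (simp add: P_sym PP Q_sym QQ) (simp add: Q_def cinner_simps)
      also have "\<dots> = cinner y (x1 (P (h z))) + cinner y (N (Q (h z)))"
        unfolding adj[OF Py(1,3), symmetric]
        by (simp add: cinner_badj_left[OF M(1)] cinner_badj_left[OF N(1)] x1_def P_sym)
      finally show "cinner y (P (S6 v)) = cinner y (x1 (P (h z)) + N (Q (h z)))"
        by (simp add: cinner_simps)
    qed
    moreover have "cinner v' (x1 (P (h z))) = q1 v' v"
      using q1(1)[of v v'] D by (simp add: x1v P_D h_P)
    moreover have "cinner v' (N (Q (h z))) = q2 v' v"
      using q2(1)[of v v'] D by (simp add: Nv Q_D h_Q)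
    ultimately show "cinner v' (P (S6 v)) = q1 v' v + q2 v' v"
      by (simp add: cinner_simps)
  next
    show "continuous_on UNIV (\<lambda>v. cinner v' (P (S6 v)))"
      by (intro continuous_on_cinner continuous_intros
          bounded_clinear_continuous_on[OF bounded_clinear_comp[OF P_bounded bounded(2)]])
  qed (intro continuous_intros q1(2) q2(2))
  have "trace_bounded (\<lambda>v. P (S6 v)) = trace_bounded (\<lambda>v. P (S3 v) - S7 v) + trace_bounded S10"
  proof (rule trace_bounded_eqI)
    show "((\<lambda>e. cinner e (P (S6 e))) has_sum trace_bounded (\<lambda>v. P (S3 v) - S7 v) + trace_bounded S10) B"
      if "orthonormal_basis B" for B
      unfolding form by (rule has_sum_add[OF q1(3)[OF that] q2(3)[OF that]])
  qed (rule trace_span_ex_basis[OF tr(1)])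
  moreover have "trace_bounded (\<lambda>v. P (S6 v)) = trace_bounded S6"
    using trace_span_comp(3)[OF P_bounded tr(2)] by (simp add: SP)
  moreover have "trace_bounded (\<lambda>v. P (S3 v) - S7 v) = trace_bounded S3 - trace_bounded S7"
    using trace_bounded_diff[OF PS3 tr(3)] trace_span_comp(3)[OF P_bounded tr(1)] by (simp add: SP)
  ultimately show ?thesis by simp
qed

end

section \<open>Adjoints and spectral projectors\<close>

lemma adj_SomeD:
  assumes "adj T x = Some z" "y \<in> dom T"
  shows "cinner x (the (T y)) = cinner z y"
proof -
  have ex: "\<exists>!z. \<forall>y\<in>dom T. cinner x (the (T y)) = cinner z y"
    using assms(1) unfolding adj_def by (rule contrapos_pp) simp
  with assms(1) have "z = (THE z. \<forall>y\<in>dom T. cinner x (the (T y)) = cinner z y)"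
    unfolding adj_def by simp
  with theI'[OF ex] assms(2) show ?thesis by blast
qed

lemma adj_SomeI:
  assumes "dense_set (dom T)" "\<And>y. y \<in> dom T \<Longrightarrow> cinner x (the (T y)) = cinner z y"
  shows "adj T x = Some z"
proof -
  have "z' = z" if "\<forall>y\<in>dom T. cinner x (the (T y)) = cinner z' y" for z'
  proof (rule dense_cinner_ext[OF assms(1)])
    fix y assume "y \<in> dom T"
    with that assms(2) have "cinner z' y = cinner z y" by metis
    then show "cinner y z' = cinner y z" by (metis cinner_commute)
  qed
  then have ex: "\<exists>!z. \<forall>y\<in>dom T. cinner x (the (T y)) = cinner z y"
    using assms(2) by (intro ex1I[of _ z]) blast+
  moreover have "(THE z. \<forall>y\<in>dom T. cinner x (the (T y)) = cinner z y) = z"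
    using assms(2) by (intro the1_equality[OF ex]) blast
  ultimately show ?thesis by (simp add: adj_def)
qed

lemma linear_opD:
  assumes "linear_op T" "x \<in> dom T" "y \<in> dom T"
  shows "a *\<^sub>C x + b *\<^sub>C y \<in> dom T"
    "the (T (a *\<^sub>C x + b *\<^sub>C y)) = a *\<^sub>C the (T x) + b *\<^sub>C the (T y)"
proof -
  obtain u v where "T x = Some u" "T y = Some v" using assms(2,3) by blast
  moreover from this have "T (a *\<^sub>C x + b *\<^sub>C y) = Some (a *\<^sub>C u + b *\<^sub>C v)"
    using assms(1) unfolding linear_op_def by blast
  ultimately show "a *\<^sub>C x + b *\<^sub>C y \<in> dom T"
    "the (T (a *\<^sub>C x + b *\<^sub>C y)) = a *\<^sub>C the (T x) + b *\<^sub>C the (T y)" by auto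
qed

locale spectral_resolution =
  fixes H :: "'a::complex_hilbert lop" and E :: "real set \<Rightarrow> 'a \<Rightarrow> 'a"
  assumes self_adjoint: "self_adjoint H" and resolution: "spectral_measure_of H E"
begin

abbreviation "D \<equiv> dom H"
definition h :: "'a \<Rightarrow> 'a" where "h u = the (H u)"

lemma D_lin: "u \<in> D \<Longrightarrow> v \<in> D \<Longrightarrow> a *\<^sub>C u + b *\<^sub>C v \<in> D"
  and h_lin: "u \<in> D \<Longrightarrow> v \<in> D \<Longrightarrow> h (a *\<^sub>C u + b *\<^sub>C v) = a *\<^sub>C h u + b *\<^sub>C h v"
  using self_adjoint linear_opD[of H] by (auto simp: self_adjoint_def h_def)

lemma D_dense: "dense_set D"
  using self_adjoint by (simp add: self_adjoint_def)

lemma adj_H: "adj H = H"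
  using self_adjoint by (simp add: self_adjoint_def)

lemma h_sym: "u \<in> D \<Longrightarrow> v \<in> D \<Longrightarrow> cinner (h u) v = cinner u (h v)"
  using adj_SomeD[of H u "h u" v] unfolding adj_H h_def by (simp add: domIff)

lemma h_max: "(\<And>u. u \<in> D \<Longrightarrow> cinner v (h u) = cinner z u) \<Longrightarrow> v \<in> D \<and> h v = z"
proof -
  assume "\<And>u. u \<in> D \<Longrightarrow> cinner v (h u) = cinner z u"
  then have "adj H v = Some z" by (intro adj_SomeI D_dense) (simp add: h_def)
  then show ?thesis by (auto simp: adj_H h_def)
qed

lemma D_add: "u \<in> D \<Longrightarrow> v \<in> D \<Longrightarrow> u + v \<in> D" "u \<in> D \<Longrightarrow> v \<in> D \<Longrightarrow> u - v \<in> D"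
  using D_lin[of u v 1 1] D_lin[of u v 1 "-1"] by (simp_all add: scaleC_one scaleC_minus_one)

lemma pvm:
  "S \<in> sets borel \<Longrightarrow> orthogonal_projector (E S)"
  "E UNIV x = x"
  "S \<in> sets borel \<Longrightarrow> T \<in> sets borel \<Longrightarrow> E (S \<inter> T) x = E S (E T x)"
  "range F \<subseteq> sets borel \<Longrightarrow> disjoint_family F \<Longrightarrow> (\<lambda>n::nat. E (F n) x) sums E (\<Union>n. F n) x"
proof -
  have "projection_valued_measure E"
    using resolution unfolding spectral_measure_of_def by (rule conjunct1)
  note * = this[unfolded projection_valued_measure_def]
  show "S \<in> sets borel \<Longrightarrow> orthogonal_projector (E S)"
    using * by (elim conjE) (erule bspec)
  show "E UNIV x = x" using * by (elim conjE) (erule spec)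
  show "S \<in> sets borel \<Longrightarrow> T \<in> sets borel \<Longrightarrow> E (S \<inter> T) x = E S (E T x)"
    using * by (elim conjE) (drule (1) bspec, drule (1) bspec, erule spec)
  show "range F \<subseteq> sets borel \<Longrightarrow> disjoint_family F \<Longrightarrow> (\<lambda>n::nat. E (F n) x) sums E (\<Union>n. F n) x"
    using * by (elim conjE) (drule spec, drule (1) mp, drule (1) mp, erule spec)
qed

lemma dom_iff: "x \<in> D \<longleftrightarrow> (\<integral>\<^sup>+ t. ennreal (t\<^sup>2) \<partial>scalar_measure E x) < \<infinity>"
  and h_eq: "x \<in> D \<Longrightarrow> cinner x (h x) = complex_of_real (\<integral> t. t \<partial>scalar_measure E x)"
  using resolution unfolding spectral_measure_of_def h_def by auto

lemmas E_bounded = orthogonal_projectorD(1)[OF pvm(1)]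
lemmas EE = orthogonal_projectorD(2)[OF pvm(1)]
lemmas E_sym = orthogonal_projectorD(3)[OF pvm(1)]
lemmas E_le = orthogonal_projectorD(4)[OF pvm(1)]

lemma E_commute: "S \<in> sets borel \<Longrightarrow> T \<in> sets borel \<Longrightarrow> E S (E T x) = E T (E S x)"
  by (metis Int_commute pvm(3))

lemma E_empty: "E {} x = 0"
proof -
  have "(\<lambda>n::nat. E {} x) sums E (\<Union>n::nat. {}) x"
    by (rule pvm(4)) (auto simp: disjoint_family_on_def)
  then have "(\<lambda>n::nat. E {} x) \<longlonglongrightarrow> 0"
    by (intro summable_LIMSEQ_zero) (auto simp: sums_iff)
  then show ?thesis by (simp add: LIMSEQ_const_iff)
qed

lemma E_Un:
  assumes "S \<in> sets borel" "T \<in> sets borel" "S \<inter> T = {}"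
  shows "E (S \<union> T) x = E S x + E T x"
proof -
  define F where "F n = (if n = 0 then S else if n = 1 then T else {})" for n :: nat
  have "(\<lambda>n. E (F n) x) sums E (\<Union>n. F n) x"
    using assms by (intro pvm(4)) (auto simp: F_def disjoint_family_on_def)
  moreover have "(\<Union>n. F n) = S \<union> T"
    by (auto simp: F_def split: if_splits)
  moreover have "(\<lambda>n. E (F n) x) sums (\<Sum>n\<in>{0, 1}. E (F n) x)"
    by (rule sums_finite) (auto simp: F_def E_empty)
  ultimately show ?thesis
    using sums_unique2[of "\<lambda>n. E (F n) x"] by (simp add: F_def)
qed

lemma inner_E: "S \<in> sets borel \<Longrightarrow> x \<bullet> E S x = (norm (E S x))\<^sup>2"
proof -
  assume S: "S \<in> sets borel"
  have "cinner (E S x) (E S x) = cinner x (E S x)"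
    by (simp only: E_sym[OF S] EE[OF S])
  then have "Re (cinner (E S x) (E S x)) = Re (cinner x (E S x))" by simp
  then show ?thesis by (simp only: Re_cinner power2_norm_eq_inner)
qed

lemma norm_diff_E: "S \<in> sets borel \<Longrightarrow> (norm (x - E S x))\<^sup>2 = (norm x)\<^sup>2 - (norm (E S x))\<^sup>2"
  using inner_E[of S x] by (simp only: power2_norm_eq_inner inner_diff_left inner_diff_right)
    (simp add: inner_commute)

lemma space_scalar_measure [simp]: "space (scalar_measure E x) = UNIV"
  by (simp add: scalar_measure_def space_measure_of_conv)

lemma sets_scalar_measure [simp, measurable_cong]: "sets (scalar_measure E x) = sets borel"
  unfolding scalar_measure_def by (metis sets.sets_measure_of_eq space_borel)

lemma emeasure_scalar_measure:
  assumes "S \<in> sets borel"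
  shows "emeasure (scalar_measure E x) S = ennreal ((norm (E S x))\<^sup>2)"
proof (rule emeasure_measure_of[OF scalar_measure_def])
  show "positive (sets (scalar_measure E x)) (\<lambda>S. ennreal ((norm (E S x))\<^sup>2))"
    by (simp add: positive_def E_empty)
  show "countably_additive (sets (scalar_measure E x)) (\<lambda>S. ennreal ((norm (E S x))\<^sup>2))"
  proof (rule countably_additiveI)
    fix F :: "nat \<Rightarrow> real set"
    assume "range F \<subseteq> sets (scalar_measure E x)" and F': "disjoint_family F"
    then have F: "range F \<subseteq> sets borel" by simp
    then have UF: "(\<Union>n. F n) \<in> sets borel" by auto
    have "(\<lambda>n. x \<bullet> E (F n) x) sums (x \<bullet> E (\<Union>n. F n) x)"
      by (rule bounded_linear.sums[OF bounded_linear_inner_right pvm(4)[OF F F']])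
    then have "(\<lambda>n. (norm (E (F n) x))\<^sup>2) sums (norm (E (\<Union>n. F n) x))\<^sup>2"
      using F UF by (subst (asm) (1 2) inner_E) auto
    then show "(\<Sum>n. ennreal ((norm (E (F n) x))\<^sup>2)) = ennreal ((norm (E (\<Union>n. F n) x))\<^sup>2)"
      by (intro suminf_ennreal_eq) auto
  qed
qed (use assms in auto)

lemma emeasure_space: "emeasure (scalar_measure E x) UNIV = ennreal ((norm x)\<^sup>2)"
  using emeasure_scalar_measure[of UNIV x] by (simp add: pvm(2))

lemma AE_in:
  assumes S: "S \<in> sets borel"
  shows "AE t in scalar_measure E (E S x). t \<in> S"
proof (rule AE_I)
  show "emeasure (scalar_measure E (E S x)) (- S) = 0"
    using S pvm(3)[of "- S" S x] by (simp add: emeasure_scalar_measure E_empty)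
qed (use S in auto)

lemma E_D:
  assumes "x \<in> D" and S: "S \<in> sets borel"
  shows "E S x \<in> D"
proof -
  have "scalar_measure E (E S x) \<le> scalar_measure E x"
  proof -
    have "emeasure (scalar_measure E (E S x)) A \<le> emeasure (scalar_measure E x) A" for A
    proof (cases "A \<in> sets borel")
      case True
      then show ?thesis
        using E_le[OF S, of "E A x"] E_commute[OF S True, of x]
        by (simp add: emeasure_scalar_measure ennreal_leI power_mono)
    qed (simp add: emeasure_notin_sets)
    then show ?thesis by (simp add: le_measure_iff le_fun_def)
  qed
  then have "(\<integral>\<^sup>+ t. ennreal (t\<^sup>2) \<partial>scalar_measure E (E S x)) \<le> (\<integral>\<^sup>+ t. ennreal (t\<^sup>2) \<partial>scalar_measure E x)"
    by (intro nn_integral_mono_measure) simp_all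
  then show ?thesis
    using assms(1) unfolding dom_iff by (rule le_less_trans)
qed

text \<open>
  For \<open>a\<close> in the range of \<open>E S\<close> and \<open>b\<close> in its complement the measure of \<open>a + c b\<close> is the same for all
  \<open>c\<close> on the unit circle. Hence so is \<open>\<langle>a + c b, h(a + c b)\<rangle>\<close>, and by polarization \<open>h\<close> has no matrix
  elements between \<open>a\<close> and \<open>b\<close>.
\<close>

lemma h_cross:
  assumes a: "a \<in> D" "E S a = a" and b: "b \<in> D" "E S b = 0" and S: "S \<in> sets borel"
  shows "cinner a (h b) = 0" "cinner b (h a) = 0"
proof -
  have norm: "(norm (E T (a + c *\<^sub>C b)))\<^sup>2 = (norm (E T a))\<^sup>2 + (norm (E T b))\<^sup>2"
    if T: "T \<in> sets borel" and c: "cmod c = 1" for T c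
  proof -
    have "cinner (E T a) (E T b) = cinner (E S (E T a)) (E T b)"
      using E_commute[OF S T, of a] by (simp add: a)
    also have "\<dots> = cinner (E T a) (E T (E S b))"
      by (simp only: E_sym[OF S, of "E T a"] E_commute[OF S T, of b])
    also have "\<dots> = 0" by (simp add: b bounded_clinearD(3)[OF E_bounded[OF T]])
    finally have "cinner (E T a) (c *\<^sub>C E T b) = 0" by (simp add: cinner_scaleC_right)
    then have "E T a \<bullet> (c *\<^sub>C E T b) = 0" by (simp add: Re_cinner[symmetric])
    then have "(norm (E T a + c *\<^sub>C E T b))\<^sup>2 = (norm (E T a))\<^sup>2 + (norm (c *\<^sub>C E T b))\<^sup>2"
      by (simp add: norm_add_Pythagorean orthogonal_def)
    then show ?thesis
      using c by (simp add: bounded_clinearD(1,4)[OF E_bounded[OF T]] norm_scaleC)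
  qed
  have meas: "scalar_measure E (a + c *\<^sub>C b) = scalar_measure E (a + 1 *\<^sub>C b)" if "cmod c = 1" for c
    unfolding scalar_measure_def
  proof (rule measure_of_eq)
    fix T :: "real set" assume "T \<in> sigma_sets UNIV (sets borel)"
    then have T: "T \<in> sets borel" by (metis sets.sigma_sets_eq space_borel)
    show "ennreal ((norm (E T (a + c *\<^sub>C b)))\<^sup>2) = ennreal ((norm (E T (a + 1 *\<^sub>C b)))\<^sup>2)"
      using norm[OF T that] norm[OF T, of 1] by simp
  qed auto
  have mem: "a + c *\<^sub>C b \<in> D" and hab: "h (a + c *\<^sub>C b) = h a + c *\<^sub>C h b" for c
    using D_lin[OF a(1) b(1), of 1 c] h_lin[OF a(1) b(1), of 1 c] by (simp_all add: scaleC_one)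
  define X Y where "X = cinner a (h b)" and "Y = cinner b (h a)"
  have XY: "c * X + cnj c * Y = X + Y" if c: "cmod c = 1" for c
  proof -
    have "cinner (a + c *\<^sub>C b) (h (a + c *\<^sub>C b)) = cinner (a + 1 *\<^sub>C b) (h (a + 1 *\<^sub>C b))"
      using h_eq[OF mem] by (simp only: meas[OF c])
    moreover have "cinner (a + c *\<^sub>C b) (h (a + c *\<^sub>C b)) = cinner a (h a) + cinner b (h b) + (c * X + cnj c * Y)"
      if c: "cmod c = 1" for c
    proof -
      have "c * cnj c = 1"
        using complex_norm_square[of c] c by simp
      then show ?thesis
        unfolding hab X_def Y_def
        by (simp add: cinner_simps cinner_scaleC_left cinner_scaleC_right distrib_left mult.assoc[symmetric])
    qed
    ultimately show ?thesis using c by simp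
  qed
  have "- (X + Y) = X + Y" using XY[of "-1"] by simp
  then have "2 * (X + Y) = 0" by (metis add.left_inverse mult_2)
  then have 1: "X + Y = 0" by (simp only: mult_eq_0_iff) simp
  then have "\<i> * (X - Y) = 0" using XY[of \<i>] by (simp add: right_diff_distrib)
  then have "X = Y" by simp
  with 1 have "X = 0" "Y = 0" by (simp_all flip: mult_2)
  then show "cinner a (h b) = 0" "cinner b (h a) = 0" by (simp_all add: X_def Y_def)
qed

lemma h_E:
  assumes x: "x \<in> D" and S: "S \<in> sets borel"
  shows "h (E S x) = E S (h x)"
proof -
  have Sx: "E S x \<in> D" by (rule E_D[OF x S])
  have split: "E S (y - E S y) = 0" for y
    by (simp add: bounded_clinearD(2)[OF E_bounded[OF S]] EE[OF S])
  have 1: "h (E S x) = E S (h (E S x))"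
  proof (rule dense_cinner_ext[OF D_dense])
    fix y assume y: "y \<in> D"
    have "cinner (y - E S y) (h (E S x)) = 0"
      by (rule h_cross(2)[OF Sx EE[OF S] D_add(2)[OF y E_D[OF y S]] split S])
    then show "cinner y (h (E S x)) = cinner y (E S (h (E S x)))"
      by (simp add: cinner_simps E_sym[OF S])
  qed
  have 2: "E S (h x) = E S (h (E S x))"
  proof (rule dense_cinner_ext[OF D_dense])
    fix y assume y: "y \<in> D"
    have "cinner (E S y) (h (x - E S x)) = 0"
      by (rule h_cross(1)[OF E_D[OF y S] EE[OF S] D_add(2)[OF x Sx] split S])
    moreover have "h (x - E S x) = h x - h (E S x)"
      using h_lin[OF x Sx, of 1 "-1"] by (simp add: scaleC_one scaleC_minus_one)
    ultimately show "cinner y (E S (h x)) = cinner y (E S (h (E S x)))"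
      by (simp add: cinner_simps E_sym[OF S])
  qed
  from 1 2 show ?thesis by simp
qed

lemma E_bounded_D:
  assumes S: "S \<in> sets borel" and r: "\<And>t. t \<in> S \<Longrightarrow> \<bar>t\<bar> \<le> r"
  shows "E S x \<in> D"
  unfolding dom_iff
proof -
  have "(\<integral>\<^sup>+ t. ennreal (t\<^sup>2) \<partial>scalar_measure E (E S x)) \<le> (\<integral>\<^sup>+ t. ennreal (r\<^sup>2) \<partial>scalar_measure E (E S x))"
  proof (rule nn_integral_mono_AE)
    show "AE t in scalar_measure E (E S x). ennreal (t\<^sup>2) \<le> ennreal (r\<^sup>2)"
      using AE_in[OF S, of x] by eventually_elim (use r in \<open>auto intro!: ennreal_leI simp: abs_le_square_iff[symmetric] intro: order_trans[OF r]\<close>)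
  qed
  also have "\<dots> = ennreal (r\<^sup>2) * ennreal ((norm (E S x))\<^sup>2)"
    by (simp add: emeasure_space)
  also have "\<dots> < \<infinity>" by (simp add: ennreal_mult[symmetric])
  finally show "(\<integral>\<^sup>+ t. ennreal (t\<^sup>2) \<partial>scalar_measure E (E S x)) < \<infinity>" .
qed

text \<open>
  The measures \<open>\<parallel>E(A n) x\<parallel>\<^sup>2\<close> of the increasing sets tend to \<open>\<parallel>x\<parallel>\<^sup>2\<close>, and by Pythagoras the
  difference is \<open>\<parallel>x - E(A n) x\<parallel>\<^sup>2\<close>.
\<close>

lemma E_tendsto:
  assumes A: "\<And>n. A n \<in> sets borel" "incseq A" "(\<Union>n. A n) = UNIV"
  shows "(\<lambda>n. E (A n) x) \<longlonglongrightarrow> x"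
proof -
  have "(\<lambda>n. emeasure (scalar_measure E x) (A n)) \<longlonglongrightarrow> emeasure (scalar_measure E x) (\<Union>n. A n)"
    using A by (intro Lim_emeasure_incseq) auto
  then have "(\<lambda>n. ennreal ((norm (E (A n) x))\<^sup>2)) \<longlonglongrightarrow> ennreal ((norm x)\<^sup>2)"
    by (simp add: A emeasure_space emeasure_scalar_measure)
  then have "(\<lambda>n. (norm (E (A n) x))\<^sup>2) \<longlonglongrightarrow> (norm x)\<^sup>2"
    by (rule tendsto_ennrealD) auto
  then have "(\<lambda>n. (norm x)\<^sup>2 - (norm (E (A n) x))\<^sup>2) \<longlonglongrightarrow> (norm x)\<^sup>2 - (norm x)\<^sup>2"
    by (intro tendsto_diff tendsto_const)
  then have "(\<lambda>n. (norm (x - E (A n) x))\<^sup>2) \<longlonglongrightarrow> 0"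
    by (simp add: norm_diff_E A)
  then have "(\<lambda>n. sqrt ((norm (x - E (A n) x))\<^sup>2)) \<longlonglongrightarrow> sqrt 0"
    by (rule tendsto_real_sqrt)
  then have "(\<lambda>n. x - E (A n) x) \<longlonglongrightarrow> 0"
    by (simp add: tendsto_norm_zero_iff)
  then have "(\<lambda>n. x - (x - E (A n) x)) \<longlonglongrightarrow> x - 0"
    by (intro tendsto_diff tendsto_const)
  then show ?thesis by simp
qed

lemma integrable_id:
  assumes "x \<in> D"
  shows "integrable (scalar_measure E x) (\<lambda>t. t)"
proof (rule integrableI_bounded)
  have "\<bar>t\<bar> \<le> 1 + t\<^sup>2" for t :: real
    using mult_le_sum_of_squares[of 1 "\<bar>t\<bar>"] by simp
  then have "(\<integral>\<^sup>+ t. ennreal (norm t) \<partial>scalar_measure E x) \<le> (\<integral>\<^sup>+ t. 1 + ennreal (t\<^sup>2) \<partial>scalar_measure E x)"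
    by (intro nn_integral_mono) (simp add: ennreal_plus[symmetric] ennreal_1[symmetric] del: ennreal_plus ennreal_1)
  also have "\<dots> = ennreal ((norm x)\<^sup>2) + (\<integral>\<^sup>+ t. ennreal (t\<^sup>2) \<partial>scalar_measure E x)"
    by (subst nn_integral_add) (simp_all add: emeasure_space)
  also have "\<dots> < \<infinity>" using assms unfolding dom_iff by simp
  finally show "(\<integral>\<^sup>+ t. ennreal (norm t) \<partial>scalar_measure E x) < \<infinity>" .
qed simp

lemma integral_const: "(\<integral> t. r \<partial>scalar_measure E x) = r * (norm x)\<^sup>2" "integrable (scalar_measure E x) (\<lambda>t. r :: real)"
proof -
  have fin: "finite_measure (scalar_measure E x)"
    by (rule finite_measureI) (simp add: emeasure_space)
  then show "integrable (scalar_measure E x) (\<lambda>t. r :: real)"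
    by (rule finite_measure.integrable_const)
  show "(\<integral> t. r \<partial>scalar_measure E x) = r * (norm x)\<^sup>2"
    using fin by (simp add: measure_def emeasure_space)
qed

text \<open>
  Split \<open>w - E[-1,1] w\<close> into the parts of \<open>w\<close> above \<open>1\<close> and below \<open>-1\<close>. The form of \<open>h\<close> is at least
  \<open>1\<close> on the former and at most \<open>-1\<close> on the latter.
\<close>

lemma gap:
  assumes w: "w \<in> D"
  shows "norm (w - E {-1..1} w) \<le> norm (h w)"
proof -
  define u v where "u = E {1<..} w" and "v = E {..<-1} w"
  have uv_D: "u \<in> D" "v \<in> D" unfolding u_def v_def by (intro E_D[OF w]; simp)+
  have w_eq: "w - E {-1..1} w = u + v"
  proof -
    have U: "{1<..} \<union> ({..<-1} \<union> {-1..1}) = (UNIV :: real set)" by auto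
    have "w = E ({1<..} \<union> ({..<-1} \<union> {-1..1})) w"
      unfolding U by (simp add: pvm(2))
    also have "\<dots> = u + (v + E {-1..1} w)"
      unfolding u_def v_def by (subst E_Un, simp, simp, force, subst E_Un) auto
    finally show ?thesis by (simp add: algebra_simps)
  qed
  have orth: "u \<bullet> v = 0"
  proof -
    have "cinner u v = cinner w (E ({1<..} \<inter> {..<-1}) w)"
      unfolding u_def v_def by (simp add: E_sym pvm(3))
    also have "{1<..} \<inter> {..<-1} = ({} :: real set)" by auto
    finally show ?thesis by (simp add: E_empty Re_cinner[symmetric])
  qed
  have form: "cinner (E S w) (h w) = complex_of_real (\<integral> t. t \<partial>scalar_measure E (E S w))"
    if S: "S \<in> sets borel" for S
  proof -
    have "cinner (E S w) (h w) = cinner (E S w) (h (E S w))"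
      using h_E[OF w S] E_sym[OF S, of "E S w" "h w"] EE[OF S, of w] by simp
    then show ?thesis using h_eq[OF E_D[OF w S]] by simp
  qed
  have u: "(norm u)\<^sup>2 \<le> Re (cinner u (h w))"
  proof -
    have "(\<integral> t. 1 \<partial>scalar_measure E u) \<le> (\<integral> t. t \<partial>scalar_measure E u)"
    proof (rule integral_mono_AE)
      show "AE t in scalar_measure E u. 1 \<le> t"
        unfolding u_def using AE_in[of "{1<..}" w] by (rule AE_mp) auto
    qed (use integrable_id[OF uv_D(1)] integral_const(2) in auto)
    then show ?thesis
      using form[of "{1<..}"] by (simp add: u_def integral_const(1)[where r = 1, simplified])
  qed
  have v: "Re (cinner v (h w)) \<le> - (norm v)\<^sup>2"
  proof -
    have "(\<integral> t. t \<partial>scalar_measure E v) \<le> (\<integral> t. -1 \<partial>scalar_measure E v)"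
    proof (rule integral_mono_AE)
      show "AE t in scalar_measure E v. t \<le> -1"
        unfolding v_def using AE_in[of "{..<-1}" w] by (rule AE_mp) auto
    qed (use integrable_id[OF uv_D(2)] integral_const(2) in auto)
    then show ?thesis
      using form[of "{..<-1}"] by (simp add: v_def integral_const(1)[where r = "-1", simplified])
  qed
  have eq: "(norm (u - v))\<^sup>2 = (norm (u + v))\<^sup>2"
    using orth by (simp only: power2_norm_eq_inner inner_simps) (simp add: inner_commute)
  then have eq': "norm (u - v) = norm (u + v)" by simp
  have "(norm (u + v))\<^sup>2 = (norm u)\<^sup>2 + (norm v)\<^sup>2"
    using orth by (simp add: norm_add_Pythagorean orthogonal_def)
  also have "\<dots> \<le> Re (cinner (u - v) (h w))"
    using u v by (simp add: cinner_simps)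
  also have "\<dots> \<le> norm (u + v) * norm (h w)"
    using Re_cinner_le[of "u - v" "h w"] eq' by simp
  finally have "norm (u + v) * norm (u + v) \<le> norm (u + v) * norm (h w)"
    by (simp add: power2_eq_square)
  then show ?thesis
    unfolding w_eq by (cases "u + v = 0") auto
qed

lemma spectral_cutoff:
  assumes S: "S \<in> sets borel"
  shows "spectral_cutoff D h (E S) (\<lambda>n. E {- real (Suc n)..real (Suc n)})"
proof
  have "(\<Union>n. {- real (Suc n)..real (Suc n)}) = UNIV"
  proof -
    have "\<exists>n. - real (Suc n) \<le> t \<and> t \<le> real (Suc n)" for t
    proof -
      obtain n where "\<bar>t\<bar> \<le> real n" using real_arch_simple by blast
      then show ?thesis by (intro exI[of _ n]) auto
    qed
    then show ?thesis by auto
  qed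
  then show "(\<lambda>n. E {- real (Suc n)..real (Suc n)} v) \<longlonglongrightarrow> v" for v
    by (intro E_tendsto) (auto simp: incseq_def)
  show "E {- real (Suc n)..real (Suc n)} v \<in> D" for n v
    by (rule E_bounded_D[where r = "real (Suc n)"]) auto
  show "norm (u - E {- real (Suc 0)..real (Suc 0)} u) \<le> norm (h u)" if "u \<in> D" for u
    using gap[OF that] by simp
  show "v \<in> D \<and> h v = z" if "\<And>u. u \<in> D \<Longrightarrow> cinner v (h u) = cinner z u" for v z
    using that by (rule h_max)
qed (simp_all add: D_lin h_lin h_sym pvm(1) E_D h_E E_commute S del: domIff)

end

section \<open>Products on their natural domains\<close>

lemma comp_dom: "x \<in> dom (f \<circ>\<^sub>m g) \<longleftrightarrow> x \<in> dom g \<and> the (g x) \<in> dom f"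
  by (auto simp: map_comp_def split: option.splits)

lemma comp_the: "x \<in> dom g \<Longrightarrow> the ((f \<circ>\<^sub>m g) x) = the (f (the (g x)))"
  by (auto simp: map_comp_def)

lemma op_plus_dom: "x \<in> dom (S +\<^sub>o T) \<longleftrightarrow> x \<in> dom S \<and> x \<in> dom T"
  and op_plus_the: "x \<in> dom S \<Longrightarrow> x \<in> dom T \<Longrightarrow> the ((S +\<^sub>o T) x) = the (S x) + the (T x)"
  unfolding op_plus_def by (auto simp: domIff split: if_splits)

lemma op_minus_dom: "x \<in> dom (S -\<^sub>o T) \<longleftrightarrow> x \<in> dom S \<and> x \<in> dom T"
  and op_minus_the: "x \<in> dom S \<Longrightarrow> x \<in> dom T \<Longrightarrow> the ((S -\<^sub>o T) x) = the (S x) - the (T x)"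
  unfolding op_minus_def by (auto simp: domIff split: if_splits)

lemmas op_simps = comp_dom comp_the op_plus_dom op_plus_the op_minus_dom op_minus_the commutator_def

lemma adj_cinner:
  assumes "u \<in> dom T" "v \<in> dom (adj T)"
  shows "cinner (the (T u)) v = cinner u (the (adj T v))"
proof -
  obtain z where "adj T v = Some z" using assms(2) by blast
  then have "cinner v (the (T u)) = cinner (the (adj T v)) u"
    using adj_SomeD[OF _ assms(1)] by simp
  then show ?thesis by (metis cinner_commute)
qed

lemma adj_diff:
  assumes "dense_set (dom T)" "u \<in> dom (adj T)" "v \<in> dom (adj T)"
  shows "the (adj T (u - v)) = the (adj T u) - the (adj T v)"
proof -
  have "adj T (u - v) = Some (the (adj T u) - the (adj T v))"
  proof (rule adj_SomeI[OF assms(1)])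
    fix y assume y: "y \<in> dom T"
    have "cinner w (the (T y)) = cinner (the (adj T w)) y" if "w \<in> dom (adj T)" for w
      using adj_cinner[OF y that] by (metis cinner_commute)
    with assms(2,3) show "cinner (u - v) (the (T y)) = cinner (the (adj T u) - the (adj T v)) y"
      by (simp add: cinner_simps del: domIff)
  qed
  then show ?thesis by simp
qed

lemma linear_op_diff:
  assumes "linear_op T" "u \<in> dom T" "v \<in> dom T"
  shows "the (T (u - v)) = the (T u) - the (T v)"
  using linear_opD(2)[OF assms, of 1 "-1"] by (simp add: scaleC_one scaleC_minus_one)

text \<open>Two bounded extensions agree on the dense domain, hence everywhere.\<close>

lemma tr_eq:
  assumes S: "bounded_clinear S" "T \<subseteq>\<^sub>m (Some \<circ> S)" and dense: "dense_set (dom T)"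
  shows "tr T = trace_bounded S"
proof -
  have "S' = S" if S': "bounded_clinear S'" "T \<subseteq>\<^sub>m (Some \<circ> S')" for S'
  proof
    show "S' v = S v" for v
    proof (rule dense_set_eqI[OF dense, of S' S])
      fix v assume v: "v \<in> dom T"
      then have "T v = (Some \<circ> S') v" "T v = (Some \<circ> S) v"
        using S'(2) S(2) by (auto simp: map_le_def)
      then show "S' v = S v" by simp
    qed (intro bounded_clinear_continuous_on S S')+
  qed
  with S have "bounded_extension T = S"
    unfolding bounded_extension_def by (intro the_equality) blast+
  then show ?thesis by (simp add: tr_def)
qed

lemma map_le_the: "T \<subseteq>\<^sub>m (Some \<circ> S) \<Longrightarrow> v \<in> dom T \<Longrightarrow> S v = the (T v)"
  by (auto simp: map_le_def)

theorem theorem2p2: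
  fixes H G P A B :: "'a::complex_hilbert lop"
  assumes H: "self_adjoint H"
    and P: "spectral_projector H P"
    and G: "linear_op G"
    and G_dom: "ran (G |` dom H) \<subseteq> dom H" "dom H \<subseteq> dom G"
    and adj_G_dom: "ran (adj G |` dom H) \<subseteq> dom H" "dom H \<subseteq> dom (adj G)"
    and A: "A = (Some -\<^sub>o P) \<circ>\<^sub>m G \<circ>\<^sub>m P"
    and B: "B = P \<circ>\<^sub>m G \<circ>\<^sub>m (Some -\<^sub>o P)"
    and traces: "traces_well_defined
      {H \<circ>\<^sub>m H \<circ>\<^sub>m (adj G \<circ>\<^sub>m commutator H G +\<^sub>o G \<circ>\<^sub>m commutator H (adj G)) \<circ>\<^sub>m P,
       H \<circ>\<^sub>m (commutator H (adj G) \<circ>\<^sub>m commutator H G +\<^sub>o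
             commutator H G \<circ>\<^sub>m commutator H (adj G)) \<circ>\<^sub>m P,
       H \<circ>\<^sub>m adj G \<circ>\<^sub>m H \<circ>\<^sub>m H \<circ>\<^sub>m G \<circ>\<^sub>m P,
       H \<circ>\<^sub>m adj G \<circ>\<^sub>m H \<circ>\<^sub>m G \<circ>\<^sub>m H \<circ>\<^sub>m P,
       H \<circ>\<^sub>m G \<circ>\<^sub>m H \<circ>\<^sub>m H \<circ>\<^sub>m adj G \<circ>\<^sub>m P,
       H \<circ>\<^sub>m G \<circ>\<^sub>m H \<circ>\<^sub>m adj G \<circ>\<^sub>m H \<circ>\<^sub>m P,
       H \<circ>\<^sub>m adj A \<circ>\<^sub>m H \<circ>\<^sub>m H \<circ>\<^sub>m A,
       H \<circ>\<^sub>m A \<circ>\<^sub>m H \<circ>\<^sub>m H \<circ>\<^sub>m adj A,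
       H \<circ>\<^sub>m B \<circ>\<^sub>m H \<circ>\<^sub>m H \<circ>\<^sub>m adj B,
       H \<circ>\<^sub>m adj B \<circ>\<^sub>m H \<circ>\<^sub>m H \<circ>\<^sub>m B}"
  shows "tr (H \<circ>\<^sub>m H \<circ>\<^sub>m (adj G \<circ>\<^sub>m commutator H G +\<^sub>o G \<circ>\<^sub>m commutator H (adj G)) \<circ>\<^sub>m P) -
      tr (H \<circ>\<^sub>m (commutator H (adj G) \<circ>\<^sub>m commutator H G +\<^sub>o
             commutator H G \<circ>\<^sub>m commutator H (adj G)) \<circ>\<^sub>m P) =
      tr (H \<circ>\<^sub>m adj A \<circ>\<^sub>m H \<circ>\<^sub>m H \<circ>\<^sub>m A -\<^sub>o H \<circ>\<^sub>m A \<circ>\<^sub>m H \<circ>\<^sub>m H \<circ>\<^sub>m adj A) +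
      tr (H \<circ>\<^sub>m B \<circ>\<^sub>m H \<circ>\<^sub>m H \<circ>\<^sub>m adj B -\<^sub>o H \<circ>\<^sub>m adj B \<circ>\<^sub>m H \<circ>\<^sub>m H \<circ>\<^sub>m B)"
proof -
  \<comment> \<open>Domains are kept as sets, for the rules about products, sums and differences.\<close>
  note [iff del] = domIff and [simp del] = domIff
  obtain E S where E: "spectral_measure_of H E" and S: "S \<in> sets borel" and P_eq: "P = Some \<circ> E S"
    using P unfolding spectral_projector_def by blast
  interpret r: spectral_resolution H E by standard (rule H, rule E)
  define p where "p = E S"
  interpret c: spectral_cutoff "dom H" r.h p "\<lambda>n. E {- real (Suc n)..real (Suc n)}"
    unfolding p_def by (rule r.spectral_cutoff[OF S])
  define K where "K = adj G"
  define g where "g u = the (G u)" for u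
  define k where "k u = the (K u)" for u
  define a where "a u = the (A u)" for u
  define a' where "a' u = the (adj A u)" for u
  define b where "b u = the (B u)" for u
  define b' where "b' u = the (adj B u)" for u
  note the_simps = r.h_def[symmetric] g_def[symmetric] k_def[symmetric] a_def[symmetric]
    a'_def[symmetric] b_def[symmetric] b'_def[symmetric]

  have P_simps: "v \<in> dom P" "the (P v) = p v" for v
    by (auto simp: P_eq p_def domIff)
  have Q_simps: "v \<in> dom (Some -\<^sub>o P)" "the ((Some -\<^sub>o P) v) = c.Q v" for v
  proof -
    have "v \<in> dom Some" by (simp add: domIff)
    then show "v \<in> dom (Some -\<^sub>o P)" "the ((Some -\<^sub>o P) v) = c.Q v"
      by (simp_all add: op_minus_dom op_minus_the P_simps c.Q_def)
  qed
  have A_simps: "v \<in> dom A \<longleftrightarrow> p v \<in> dom G" "p v \<in> dom G \<Longrightarrow> a v = c.Q (g (p v))" for v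
    by (simp_all add: A op_simps P_simps Q_simps a_def g_def)
  have B_simps: "v \<in> dom B \<longleftrightarrow> c.Q v \<in> dom G" "c.Q v \<in> dom G \<Longrightarrow> b v = p (g (c.Q v))" for v
    by (simp_all add: B op_simps P_simps Q_simps b_def g_def)

  have G_D: "u \<in> dom G \<and> g u \<in> dom H" if "u \<in> dom H" for u
    using G_dom that unfolding g_def by (force simp: ran_def restrict_map_def domIff)
  have K_D: "u \<in> dom K \<and> k u \<in> dom H" if "u \<in> dom H" for u
    using adj_G_dom that unfolding k_def K_def by (force simp: ran_def restrict_map_def domIff)
  have G_dense: "dense_set (dom G)"
    using r.D_dense G_dom(2) by (rule dense_set_mono)
  have A_dense: "dense_set (dom A)"
    by (rule dense_set_mono[OF r.D_dense]) (use c.P_D G_D in \<open>auto simp: A_simps\<close>)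
  have B_dense: "dense_set (dom B)"
    by (rule dense_set_mono[OF r.D_dense]) (use c.Q_D G_D in \<open>auto simp: B_simps\<close>)

  have GK: "cinner (g u) v = cinner u (k v)" if "u \<in> dom G" "v \<in> dom K" for u v
    using adj_cinner[of u G v] that by (simp add: g_def k_def K_def)
  have KG: "cinner (k v) u = cinner v (g u)" if "v \<in> dom K" "u \<in> dom G" for u v
    using GK[OF that(2,1)] by (metis cinner_commute)
  have AA': "cinner (a u) v = cinner u (a' v)" if "u \<in> dom A" "v \<in> dom (adj A)" for u v
    using adj_cinner[OF that] by (simp add: a_def a'_def)
  have A'A: "cinner (a' v) u = cinner v (a u)" if "v \<in> dom (adj A)" "u \<in> dom A" for u v
    using AA'[OF that(2,1)] by (metis cinner_commute)
  have BB': "cinner (b u) v = cinner u (b' v)" if "u \<in> dom B" "v \<in> dom (adj B)" for u v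
    using adj_cinner[OF that] by (simp add: b_def b'_def)
  have B'B: "cinner (b' v) u = cinner v (b u)" if "v \<in> dom (adj B)" "u \<in> dom B" for u v
    using BB'[OF that(2,1)] by (metis cinner_commute)

  have A_eq: "v \<in> dom A \<and> a v = c.Q (g (p v))" if "p v \<in> dom H" for v
    using G_D[OF that] by (simp add: A_simps)
  have B_eq: "v \<in> dom B \<and> b v = p (g (c.Q v))" if "c.Q v \<in> dom H" for v
    using G_D[OF that] by (simp add: B_simps)
  have A'_eq: "v \<in> dom (adj A) \<and> a' v = p (k (c.Q v))" if v: "c.Q v \<in> dom H" for v
  proof -
    have "adj A v = Some (p (k (c.Q v)))"
    proof (rule adj_SomeI[OF A_dense])
      fix u assume "u \<in> dom A"
      then show "cinner v (the (A u)) = cinner (p (k (c.Q v))) u"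
        using K_D[OF v] by (simp add: A_simps a_def[symmetric] c.Q_sym[symmetric] c.P_sym KG)
    qed
    then show ?thesis by (simp add: a'_def domIff)
  qed
  have B'_eq: "v \<in> dom (adj B) \<and> b' v = c.Q (k (p v))" if v: "p v \<in> dom H" for v
  proof -
    have "adj B v = Some (c.Q (k (p v)))"
    proof (rule adj_SomeI[OF B_dense])
      fix u assume "u \<in> dom B"
      then show "cinner v (the (B u)) = cinner (c.Q (k (p v))) u"
        using K_D[OF v] by (simp add: B_simps b_def[symmetric] c.P_sym[symmetric] c.Q_sym KG)
    qed
    then show ?thesis by (simp add: b'_def domIff)
  qed

  let ?T1 = "H \<circ>\<^sub>m H \<circ>\<^sub>m (adj G \<circ>\<^sub>m commutator H G +\<^sub>o G \<circ>\<^sub>m commutator H (adj G)) \<circ>\<^sub>m P"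
  let ?T2 = "H \<circ>\<^sub>m (commutator H (adj G) \<circ>\<^sub>m commutator H G +\<^sub>o commutator H G \<circ>\<^sub>m commutator H (adj G)) \<circ>\<^sub>m P"
  let ?T3 = "H \<circ>\<^sub>m adj G \<circ>\<^sub>m H \<circ>\<^sub>m H \<circ>\<^sub>m G \<circ>\<^sub>m P"
  let ?T4 = "H \<circ>\<^sub>m adj G \<circ>\<^sub>m H \<circ>\<^sub>m G \<circ>\<^sub>m H \<circ>\<^sub>m P"
  let ?T5 = "H \<circ>\<^sub>m G \<circ>\<^sub>m H \<circ>\<^sub>m H \<circ>\<^sub>m adj G \<circ>\<^sub>m P"
  let ?T6 = "H \<circ>\<^sub>m G \<circ>\<^sub>m H \<circ>\<^sub>m adj G \<circ>\<^sub>m H \<circ>\<^sub>m P"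
  let ?T7 = "H \<circ>\<^sub>m adj A \<circ>\<^sub>m H \<circ>\<^sub>m H \<circ>\<^sub>m A"
  let ?T8 = "H \<circ>\<^sub>m A \<circ>\<^sub>m H \<circ>\<^sub>m H \<circ>\<^sub>m adj A"
  let ?T9 = "H \<circ>\<^sub>m B \<circ>\<^sub>m H \<circ>\<^sub>m H \<circ>\<^sub>m adj B"
  let ?T10 = "H \<circ>\<^sub>m adj B \<circ>\<^sub>m H \<circ>\<^sub>m H \<circ>\<^sub>m B"
  let ?\<T> = "{?T1, ?T2, ?T3, ?T4, ?T5, ?T6, ?T7, ?T8, ?T9, ?T10}"
  define X where "X = (\<Inter>T\<in>?\<T>. dom T)"
  have X: "dense_set X"
    using traces unfolding traces_well_defined_def X_def by (rule conjunct1)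
  have X_dom: "v \<in> dom T" if "v \<in> X" "T \<in> ?\<T>" for v T
    using that unfolding X_def by (rule INT_D)
  have "\<forall>T\<in>?\<T>. \<exists>S. trace_class S \<and> T \<subseteq>\<^sub>m (Some \<circ> S)"
    using traces unfolding traces_well_defined_def by (rule conjunct2)
  then obtain ext where "\<forall>T\<in>?\<T>. trace_class (ext T) \<and> T \<subseteq>\<^sub>m (Some \<circ> ext T)"
    by (rule bchoice[THEN exE])
  then have ext: "trace_span (ext T)" "T \<subseteq>\<^sub>m (Some \<circ> ext T)" if "T \<in> ?\<T>" for T
    using that trace_class_trace_span by blast+
  have tr: "tr T = trace_bounded (ext T)" if "T \<in> ?\<T>" for T
    using X_dom[OF _ that] by (intro tr_eq trace_span_bounded ext that dense_set_mono[OF X]) blast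
  have tr_diff: "tr (T -\<^sub>o T') = trace_bounded (ext T) - trace_bounded (ext T')"
    if T: "T \<in> ?\<T>" and T': "T' \<in> ?\<T>" for T T'
  proof -
    have "tr (T -\<^sub>o T') = trace_bounded (\<lambda>v. ext T v - ext T' v)"
    proof (rule tr_eq)
      show "T -\<^sub>o T' \<subseteq>\<^sub>m Some \<circ> (\<lambda>v. ext T v - ext T' v)"
        unfolding map_le_def
      proof
        fix v assume "v \<in> dom (T -\<^sub>o T')"
        then have v: "v \<in> dom T" "v \<in> dom T'" by (simp_all add: op_minus_dom)
        then have "(T -\<^sub>o T') v = Some (the (T v) - the (T' v))"
          by (simp add: op_minus_def)
        then show "(T -\<^sub>o T') v = (Some \<circ> (\<lambda>v. ext T v - ext T' v)) v"
          using map_le_the[OF ext(2)[OF T] v(1)] map_le_the[OF ext(2)[OF T'] v(2)] by simp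
      qed
      show "dense_set (dom (T -\<^sub>o T'))"
        by (rule dense_set_mono[OF X]) (auto simp: op_minus_dom X_dom[OF _ T] X_dom[OF _ T'])
    qed (intro bounded_clinear_diff trace_span_bounded ext T T')
    then show ?thesis unfolding trace_bounded_diff[OF ext(1)[OF T] ext(1)[OF T']] .
  qed
  have val: "v \<in> dom T \<and> ext T v = the (T v)" if "v \<in> X" "T \<in> ?\<T>" for v T
    using X_dom[OF that] map_le_the[OF ext(2)[OF that(2)]] by blast

  note unfold = K_def[symmetric] op_simps P_simps the_simps
  have 1: "v \<in> dom ?T1 \<and> ext ?T1 v = the (?T1 v)" if "v \<in> X" for v by (rule val[OF that]) simp
  have 2: "v \<in> dom ?T2 \<and> ext ?T2 v = the (?T2 v)" if "v \<in> X" for v by (rule val[OF that]) simp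
  have 3: "v \<in> dom ?T3 \<and> ext ?T3 v = the (?T3 v)" if "v \<in> X" for v by (rule val[OF that]) simp
  have 4: "v \<in> dom ?T4 \<and> ext ?T4 v = the (?T4 v)" if "v \<in> X" for v by (rule val[OF that]) simp
  have 5: "v \<in> dom ?T5 \<and> ext ?T5 v = the (?T5 v)" if "v \<in> X" for v by (rule val[OF that]) simp
  have 6: "v \<in> dom ?T6 \<and> ext ?T6 v = the (?T6 v)" if "v \<in> X" for v by (rule val[OF that]) simp
  have 7: "v \<in> dom ?T7 \<and> ext ?T7 v = the (?T7 v)" if "v \<in> X" for v by (rule val[OF that]) simp
  have 8: "v \<in> dom ?T8 \<and> ext ?T8 v = the (?T8 v)" if "v \<in> X" for v by (rule val[OF that]) simp
  have 9: "v \<in> dom ?T9 \<and> ext ?T9 v = the (?T9 v)" if "v \<in> X" for v by (rule val[OF that]) simp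
  have 10: "v \<in> dom ?T10 \<and> ext ?T10 v = the (?T10 v)" if "v \<in> X" for v by (rule val[OF that]) simp

  \<comment> \<open>All operators are defined at zero and vanish there. Hence a product with the last factor \<open>P\<close>
    vanishes on the range of \<open>1 - P\<close>, and so does its extension.\<close>
  have zero: "H 0 = Some 0" "G 0 = Some 0" "adj G 0 = Some 0"
    using H G by (auto simp: self_adjoint_def linear_op_def intro!: adj_SomeI[OF G_dense])
  have ext_P: "ext T (p v) = ext T v" if T: "T \<in> ?\<T>" and 0: "T (c.Q v) = Some 0" for T v
  proof -
    have "c.Q v \<in> dom T" using 0 by (simp add: domIff)
    then have "ext T (c.Q v) = 0"
      using map_le_the[OF ext(2)[OF T]] 0 by simp
    then show ?thesis
      by (simp add: c.Q_def bounded_clinearD(2)[OF trace_span_bounded[OF ext(1)[OF T]]])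
  qed
  have P0: "P (c.Q v) = Some 0" for v
    using c.PQ[of v] by (simp add: P_eq p_def)

  have half1: "trace_bounded (ext ?T3) - trace_bounded (ext ?T6) = trace_bounded (ext ?T7) - trace_bounded (ext ?T10)"
  proof (rule c.half_trace_identity[OF GK AA' BB' G_D K_D A_eq B_eq B'_eq X])
    show "p v \<in> dom H \<and> r.h (g (p v)) \<in> dom H \<and> r.h (r.h (g (p v))) \<in> dom K \<and>
      k (r.h (r.h (g (p v)))) \<in> dom H \<and> ext ?T3 v = r.h (k (r.h (r.h (g (p v)))))" if "v \<in> X" for v
      using 3[OF that] 4[OF that] by (simp add: unfold)
    show "r.h (p v) \<in> dom K \<and> k (r.h (p v)) \<in> dom H \<and> r.h (k (r.h (p v))) \<in> dom G \<and>
      g (r.h (k (r.h (p v)))) \<in> dom H \<and> ext ?T6 v = r.h (g (r.h (k (r.h (p v)))))" if "v \<in> X" for v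
      using 6[OF that] by (simp add: unfold)
    show "a v \<in> dom H \<and> r.h (a v) \<in> dom H \<and> r.h (r.h (a v)) \<in> dom (adj A) \<and>
      a' (r.h (r.h (a v))) \<in> dom H \<and> ext ?T7 v = r.h (a' (r.h (r.h (a v))))" if "v \<in> X" for v
      using 7[OF that] by (simp add: unfold)
    show "v \<in> dom B \<and> b v \<in> dom H \<and> r.h (b v) \<in> dom H \<and> r.h (r.h (b v)) \<in> dom (adj B) \<and>
      b' (r.h (r.h (b v))) \<in> dom H \<and> ext ?T10 v = r.h (b' (r.h (r.h (b v))))" if "v \<in> X" for v
      using 10[OF that] by (simp add: unfold)
    show "ext ?T3 (p v) = ext ?T3 v" for v
      by (rule ext_P) (simp_all add: map_comp_def P0 zero)
    show "ext ?T6 (p v) = ext ?T6 v" for v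
      by (rule ext_P) (simp_all add: map_comp_def P0 zero)
  qed (assumption | (rule ext(1), simp))+
  \<comment> \<open>Exchanging \<open>G\<close> with its adjoint turns \<open>A\<close> into the adjoint of \<open>B\<close>, and \<open>B\<close> into that of \<open>A\<close>.\<close>
  have half2: "trace_bounded (ext ?T5) - trace_bounded (ext ?T4) = trace_bounded (ext ?T9) - trace_bounded (ext ?T8)"
  proof (rule c.half_trace_identity[OF KG B'B A'A K_D G_D B'_eq A'_eq A_eq X])
    show "p v \<in> dom H \<and> r.h (k (p v)) \<in> dom H \<and> r.h (r.h (k (p v))) \<in> dom G \<and>
      g (r.h (r.h (k (p v)))) \<in> dom H \<and> ext ?T5 v = r.h (g (r.h (r.h (k (p v)))))" if "v \<in> X" for v
      using 5[OF that] 4[OF that] by (simp add: unfold)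
    show "r.h (p v) \<in> dom G \<and> g (r.h (p v)) \<in> dom H \<and> r.h (g (r.h (p v))) \<in> dom K \<and>
      k (r.h (g (r.h (p v)))) \<in> dom H \<and> ext ?T4 v = r.h (k (r.h (g (r.h (p v)))))" if "v \<in> X" for v
      using 4[OF that] by (simp add: unfold)
    show "b' v \<in> dom H \<and> r.h (b' v) \<in> dom H \<and> r.h (r.h (b' v)) \<in> dom B \<and>
      b (r.h (r.h (b' v))) \<in> dom H \<and> ext ?T9 v = r.h (b (r.h (r.h (b' v))))" if "v \<in> X" for v
      using 9[OF that] by (simp add: unfold)
    show "v \<in> dom (adj A) \<and> a' v \<in> dom H \<and> r.h (a' v) \<in> dom H \<and> r.h (r.h (a' v)) \<in> dom A \<and>
      a (r.h (r.h (a' v))) \<in> dom H \<and> ext ?T8 v = r.h (a (r.h (r.h (a' v))))" if "v \<in> X" for v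
      using 8[OF that] by (simp add: unfold)
    show "ext ?T5 (p v) = ext ?T5 v" for v
      by (rule ext_P) (simp_all add: map_comp_def P0 zero)
    show "ext ?T4 (p v) = ext ?T4 v" for v
      by (rule ext_P) (simp_all add: map_comp_def P0 zero)
  qed (assumption | (rule ext(1), simp))+

  \<comment> \<open>Multiplying out is an identity of vectors in \<open>X\<close>, as all intermediate products are defined there.\<close>
  have expand: "ext ?T1 v - ext ?T2 v = (ext ?T3 v - ext ?T4 v) - (ext ?T6 v - ext ?T5 v)" for v
  proof (rule dense_set_eqI[OF X, of "\<lambda>v. ext ?T1 v - ext ?T2 v"
        "\<lambda>v. (ext ?T3 v - ext ?T4 v) - (ext ?T6 v - ext ?T5 v)"])
    fix v assume v: "v \<in> X"
    let ?h = "r.h"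
    define y where "y = p v"
    define e f where "e = ?h (g y) - g (?h y)" and "f = ?h (k y) - k (?h y)"
    have d3: "?h (g y) \<in> dom H" "?h (?h (g y)) \<in> dom K" "k (?h (?h (g y))) \<in> dom H"
        "ext ?T3 v = ?h (k (?h (?h (g y))))"
      and d4: "y \<in> dom H" "g (?h y) \<in> dom H" "?h (g (?h y)) \<in> dom K" "k (?h (g (?h y))) \<in> dom H"
        "ext ?T4 v = ?h (k (?h (g (?h y))))"
      and d5: "?h (k y) \<in> dom H" "?h (?h (k y)) \<in> dom G" "g (?h (?h (k y))) \<in> dom H"
        "ext ?T5 v = ?h (g (?h (?h (k y))))"
      and d6: "k (?h y) \<in> dom H" "?h (k (?h y)) \<in> dom G" "g (?h (k (?h y))) \<in> dom H"
        "ext ?T6 v = ?h (g (?h (k (?h y))))"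
      using 3[OF v] 4[OF v] 5[OF v] 6[OF v] by (simp_all add: unfold y_def)
    have d1: "?h (k e + g f) \<in> dom H" "ext ?T1 v = ?h (?h (k e + g f))"
      using 1[OF v] by (simp_all add: unfold y_def e_def f_def cong: conj_cong)
    have d2: "k e \<in> dom H" "g f \<in> dom H" "(?h (k e) - k (?h e)) + (?h (g f) - g (?h f)) \<in> dom H"
        "ext ?T2 v = ?h ((?h (k e) - k (?h e)) + (?h (g f) - g (?h f)))"
      using 2[OF v] by (simp_all add: unfold y_def e_def f_def cong: conj_cong)
    have he: "?h e = ?h (?h (g y)) - ?h (g (?h y))" and hf: "?h f = ?h (?h (k y)) - ?h (k (?h y))"
      unfolding e_def f_def using c.D_diff d3 d4 d5 d6 by simp_all
    have khe: "k (?h e) = k (?h (?h (g y))) - k (?h (g (?h y)))"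
      unfolding he k_def K_def
      by (rule adj_diff[OF G_dense d3(2)[unfolded K_def] d4(3)[unfolded K_def]])
    have ghf: "g (?h f) = g (?h (?h (k y))) - g (?h (k (?h y)))"
      unfolding hf g_def by (rule linear_op_diff[OF G d5(2) d6(2)])
    have sum: "?h (k e + g f) = ?h (k e) + ?h (g f)"
      using c.D_add d2 by simp
    have khe_D: "k (?h e) \<in> dom H \<and> ?h (k (?h e)) = ext ?T3 v - ext ?T4 v"
      unfolding khe d3(4) d4(5) by (rule c.D_diff[OF d3(3) d4(4)])
    have ghf_D: "g (?h f) \<in> dom H \<and> ?h (g (?h f)) = ext ?T5 v - ext ?T6 v"
      unfolding ghf d5(4) d6(4) by (rule c.D_diff[OF d5(3) d6(3)])
    have "?h (?h (k e + g f)) - ?h ((?h (k e) - k (?h e)) + (?h (g f) - g (?h f)))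
        = ?h (?h (k e + g f) - ((?h (k e) - k (?h e)) + (?h (g f) - g (?h f))))"
      using c.D_diff[OF d1(1) d2(3)] by simp
    also have "\<dots> = ?h (k (?h e) + g (?h f))"
      unfolding sum by (simp add: algebra_simps)
    also have "\<dots> = (ext ?T3 v - ext ?T4 v) + (ext ?T5 v - ext ?T6 v)"
      using c.D_add khe_D ghf_D by simp
    finally show "ext ?T1 v - ext ?T2 v = (ext ?T3 v - ext ?T4 v) - (ext ?T6 v - ext ?T5 v)"
      by (simp add: d1(2) d2(4))
  qed (intro continuous_intros bounded_clinear_continuous_on trace_span_bounded ext(1); simp)+
  have "trace_bounded (ext ?T1) - trace_bounded (ext ?T2) = trace_bounded (\<lambda>v. ext ?T1 v - ext ?T2 v)"
    by (intro trace_bounded_diff[symmetric] ext(1)) simp_all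
  also have "\<dots> = trace_bounded (\<lambda>v. (ext ?T3 v - ext ?T4 v) - (ext ?T6 v - ext ?T5 v))"
    unfolding expand ..
  also have "\<dots> = (trace_bounded (ext ?T3) - trace_bounded (ext ?T4)) - (trace_bounded (ext ?T6) - trace_bounded (ext ?T5))"
    by (simp add: trace_bounded_diff trace_span.diff ext(1))
  finally have lhs: "tr ?T1 - tr ?T2
      = (trace_bounded (ext ?T3) - trace_bounded (ext ?T6)) + (trace_bounded (ext ?T5) - trace_bounded (ext ?T4))"
    by (simp add: tr)
  have rhs: "tr (?T7 -\<^sub>o ?T8) + tr (?T9 -\<^sub>o ?T10)
      = (trace_bounded (ext ?T7) - trace_bounded (ext ?T8)) + (trace_bounded (ext ?T9) - trace_bounded (ext ?T10))"
    by (simp add: tr_diff)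
  show ?thesis
    unfolding lhs rhs half1 half2 by simp
qed

end
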